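(* Suppose that $V(x)=c\|x\|^\delta$ on $\mathbb R^d$ with $c>0$ and $\frac d2<\delta<d$, and that $\theta_j\equiv\theta>0$ is constant. If $\rho>\rho_{\rm c}$, then as $n,L\to\infty$ with $n=\rho L^d$, under $\mathbb P_{L,n}$, $$\frac{H_0-(\rho-\rho_{\rm c}^L)L^d}{L^\delta}\longrightarrow\frac1c\sum_{x\in\mathbb Z^d\setminus\{0\}}\frac{\theta-G_x}{\|x\|^\delta}\quad\text{in distribution},$$ where $(G_x)_{x\in\mathbb Z^d}$ are i.i.d. Gamma random variables with parameters $(\theta,1)$, i.e. with density $\Gamma(\theta)^{-1}t^{\theta-1}e^{-t}$ on $t\ge0$.
   Context: A spatial partition of $n$ is a family $\boldsymbol\lambda=(\lambda_x)_{x\in\mathbb Z^d}$ of integer partitions (possibly empty) whose parts sum in total to $n$; $\Lambda_n$ is the set of these. $r_{xj}(\boldsymbol\lambda)$ is the number of parts of $\lambda_x$ equal to $j$; $H_x=\sum_jj\,r_{xj}$, so $H_0$ is the occupation of the origin. The probability measure on $\Lambda_n$ is $$\mathbb P_{L,n}(\boldsymbol\lambda)=\frac1{Z_{L,n}}\prod_{x\in\mathbb Z^d}\prod_{j\ge1}\frac1{r_{xj}(\boldsymbol\lambda)!}\Bigl(\frac{\theta_j}{j}e^{-jV(x/L)}\Bigr)^{r_{xj}(\boldsymbol\lambda)},$$ with $Z_{L,n}$ the normalization. Further $$\rho_{\rm c}=\sum_{j\ge1}\theta_j\int_{\mathbb R^d}e^{-jV(x)}dx,\qquad\rho_{\rm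 c}^L=\frac1{L^d}\sum_{j\ge1}\sum_{x\in\mathbb Z^d\setminus\{0\}}\theta_je^{-jV(x/L)}.$$ The infinite random series denotes a random variable with the law of the almost sure limit $\lim_{n\to\infty}\sum_{x\in\Lambda_n\setminus\{0\}}(\theta-G_x)\|x\|^{-\delta}$ along an increasing sequence of finite domains $\Lambda_n$ with union $\mathbb Z^d$; this limit exists almost surely and its law does not depend on the sequence. $\|\cdot\|$ is the Euclidean norm. *)

theory Defs
  imports "HOL-Probability.Probability" "HOL-Library.Multiset"
begin

definition lattice_point :: "int ^ 'd \<Rightarrow> real ^ 'd" where
  "lattice_point x = (\<chi> i. real_of_int (x $ i))"

text \<open>A family of integer partitions indexed by the lattice is represented by a function into
  multisets of positive integers, the elements of a multiset being the parts of the partition.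
  The multiplicity of part \<open>j\<close> at site \<open>x\<close> is therefore \<open>count (p x) j\<close>.\<close>

definition occupation :: "int ^ 'd \<Rightarrow> (int ^ 'd \<Rightarrow> nat multiset) \<Rightarrow> nat" where
  "occupation x p = (\<Sum>j\<in>set_mset (p x). j * count (p x) j)"

definition spatial_partitions :: "nat \<Rightarrow> (int ^ 'd \<Rightarrow> nat multiset) set" where
  "spatial_partitions n =
    {p. (\<forall>x. 0 \<notin># p x) \<and> finite {x. p x \<noteq> {#}} \<and> (\<Sum>x | p x \<noteq> {#}. occupation x p) = n}"

text \<open>The product over all sites and all positive integers is restricted to the parts that actually
  occur: all other factors are equal to 1, having multiplicity 0.\<close>

definition partition_weight ::
  "(nat \<Rightarrow> real) \<Rightarrow> (real ^ 'd \<Rightarrow> real) \<Rightarrow> real \<Rightarrow> (int ^ 'd \<Rightarrow> nat multiset) \<Rightarrow> real" where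
  "partition_weight \<theta> V L p =
    (\<Prod>x | p x \<noteq> {#}. \<Prod>j\<in>set_mset (p x).
      1 / fact (count (p x) j) *
      (\<theta> j / real j * exp (- real j * V (lattice_point x /\<^sub>R L))) ^ count (p x) j)"

definition partition_function :: "(nat \<Rightarrow> real) \<Rightarrow> (real ^ 'd \<Rightarrow> real) \<Rightarrow> real \<Rightarrow> nat \<Rightarrow> real" where
  "partition_function \<theta> V L n = (\<Sum>\<^sub>\<infinity>p\<in>spatial_partitions n. partition_weight \<theta> V L p)"

definition spatial_partition_measure ::
  "(nat \<Rightarrow> real) \<Rightarrow> (real ^ 'd \<Rightarrow> real) \<Rightarrow> real \<Rightarrow> nat \<Rightarrow> (int ^ 'd \<Rightarrow> nat multiset) measure" where
  "spatial_partition_measure \<theta> V L n =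
    density (count_space (spatial_partitions n))
      (\<lambda>p. ennreal (partition_weight \<theta> V L p / partition_function \<theta> V L n))"

text \<open>The two critical densities are real-valued, hence meaningful only when the series and integrals
  converge. For \<open>V x = c * norm x powr \<delta>\<close> with \<open>c > 0\<close>, \<open>0 < \<delta> < d\<close> and constant weights they do:
  the \<open>j\<close>-th term of \<open>critical_density\<close> is a multiple of \<open>j powr (- d / \<delta>)\<close>.\<close>

definition critical_density :: "(nat \<Rightarrow> real) \<Rightarrow> (real ^ 'd \<Rightarrow> real) \<Rightarrow> real" where
  "critical_density \<theta> V = (\<Sum>\<^sub>\<infinity>j\<in>{1..}. \<theta> j * (LINT x|lborel. exp (- real j * V x)))"

definition critical_density_scaled :: "(nat \<Rightarrow> real) \<Rightarrow> (real ^ 'd \<Rightarrow> real) \<Rightarrow> real \<Rightarrow> real" where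
  "critical_density_scaled \<theta> V L =
    1 / L ^ CARD('d) *
    (\<Sum>\<^sub>\<infinity>j\<in>{1..}. \<Sum>\<^sub>\<infinity>x\<in>UNIV - {0}. \<theta> j * exp (- real j * V (lattice_point x /\<^sub>R L)))"

definition gamma_density :: "real \<Rightarrow> real \<Rightarrow> real" where
  "gamma_density a t = (if t \<ge> 0 then t powr (a - 1) * exp (- t) / Gamma a else 0)"

end

theory Submission
  imports Defs "HOL-Real_Asymp.Real_Asymp"
begin

text \<open>Let \<open>d\<close> be the dimension and \<open>q x = exp (- V (x / L))\<close>. Summing out the parts at one site by
  \<open>exp (\<Sum>j. \<theta> / j * s ^ j) = (1 - s) powr (- \<theta>)\<close> turns the model into independent negative binomial
  occupations: at the site \<open>x\<close> the weight of occupation \<open>k\<close> is the \<open>k\<close>-th coefficient of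
  \<open>(1 - q x * z) powr (- \<theta>)\<close>. At the origin \<open>q 0 = 1\<close>, so the origin alone has a weight, \<open>negbin \<theta> k\<close>,
  that cannot be normalised; it grows only like \<open>k powr (\<theta> - 1)\<close>. Conditioning on the total \<open>n\<close> gives
  that the sum \<open>S\<close> of the occupations away from the origin has its unconditioned law, reweighted by
  \<open>negbin \<theta> (n - S)\<close>, while the origin takes the remaining \<open>n - S\<close> particles.

  A negative binomial variable is a Poisson variable with a Gamma distributed mean. Hence \<open>S\<close> is a mixed
  Poisson variable with random mean \<open>\<Lambda> = (\<Sum>x. a x * G x)\<close>, \<open>a x = q x / (1 - q x) = 1 / (exp (V (x / L)) - 1)\<close>,
  built from the very variables \<open>G x\<close> of the limit. The lemma \<open>family_sum_eq\<close> proves this by comparing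
  generating functions. The mean of \<open>\<Lambda>\<close> is \<open>\<mu>\<close>, the scaled critical density times \<open>L ^ d\<close>. Since
  \<open>a x / L powr \<delta>\<close> increases to \<open>1 / (c * norm x powr \<delta>)\<close>, which is square summable because \<open>\<delta> > d / 2\<close>,
  \<open>(\<mu> - \<Lambda>) / L powr \<delta>\<close> converges in mean square to the limit series. The additional Poisson noise has
  variance of order \<open>L ^ d\<close> and disappears after division by \<open>L powr \<delta>\<close>, again because \<open>\<delta> > d / 2\<close>.

  Finally the reweighting is harmless. The origin holds about \<open>n - \<mu>\<close> particles, which is of order \<open>L ^ d\<close>
  because the scaled critical density converges to the critical one, a Riemann sum argument
  (\<open>site_mean_riemann_sum\<close>). Fluctuations of order \<open>L powr \<delta>\<close> with \<open>\<delta> < d\<close> do not change the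
  polynomial weight. Larger fluctuations are exponentially unlikely on the scale \<open>L powr \<delta>\<close>, by a Chernoff bound
  (\<open>mixed_prob_mgf_le\<close>), which beats any power of \<open>L\<close> that the weight may contribute (\<open>tilt_bound\<close>).
  Convergence in distribution is obtained from Levy's continuity theorem. The almost sure convergence of the
  limit series along any exhausting sequence of finite domains follows from Kolmogorov's maximal inequality.\<close>

section \<open>Series of independent random variables\<close>

text \<open>Centred independent variables are orthogonal.\<close>

lemma (in prob_space) second_moment_sum_of_independent:
  fixes Y :: "'i \<Rightarrow> 'a \<Rightarrow> real"
  assumes indep: "indep_vars (\<lambda>_. borel) Y UNIV"
    and int: "\<And>x. integrable M (Y x)" and sq: "\<And>x. integrable M (\<lambda>\<omega>. (Y x \<omega>)\<^sup>2)"
    and centred: "\<And>x. expectation (Y x) = 0" and F: "finite F"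
  shows "integrable M (\<lambda>\<omega>. (\<Sum>x\<in>F. Y x \<omega>)\<^sup>2)"
    and "expectation (\<lambda>\<omega>. (\<Sum>x\<in>F. Y x \<omega>)\<^sup>2) = (\<Sum>x\<in>F. expectation (\<lambda>\<omega>. (Y x \<omega>)\<^sup>2))"
proof -
  have YY: "expectation (\<lambda>\<omega>. Y x \<omega> * Y y \<omega>) = (if y = x then expectation (\<lambda>\<omega>. (Y x \<omega>)\<^sup>2) else 0) \<and> integrable M (\<lambda>\<omega>. Y x \<omega> * Y y \<omega>)" for x y
  proof (cases "x = y")
    case False
    have "indep_var borel ((\<lambda>f. f x) \<circ> (\<lambda>\<omega>. restrict (\<lambda>i. Y i \<omega>) {x})) borel ((\<lambda>f. f y) \<circ> (\<lambda>\<omega>. restrict (\<lambda>i. Y i \<omega>) {y}))"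
      using False by (intro indep_var_compose[OF indep_var_restrict[OF indep]]) auto
    hence iv: "indep_var borel (Y x) borel (Y y)" by (simp add: o_def)
    show ?thesis using indep_var_lebesgue_integral[OF iv int int] indep_var_integrable[OF iv int int] centred False by simp
  qed (use sq[of y] in \<open>simp add: power2_eq_square\<close>)
  have e: "(\<lambda>\<omega>. (\<Sum>x\<in>F. Y x \<omega>)\<^sup>2) = (\<lambda>\<omega>. \<Sum>x\<in>F. \<Sum>y\<in>F. Y x \<omega> * Y y \<omega>)"
    by (simp add: power2_eq_square sum_product)
  show "integrable M (\<lambda>\<omega>. (\<Sum>x\<in>F. Y x \<omega>)\<^sup>2)"
    unfolding e by (intro Bochner_Integration.integrable_sum) (simp add: YY)
  show "expectation (\<lambda>\<omega>. (\<Sum>x\<in>F. Y x \<omega>)\<^sup>2) = (\<Sum>x\<in>F. expectation (\<lambda>\<omega>. (Y x \<omega>)\<^sup>2))"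
    unfolding e using F by (simp add: Bochner_Integration.integral_sum YY sum.delta)
qed

text \<open>The events \<open>E m\<close> that \<open>m\<close> is the first index at which the partial sum exceeds \<open>\<epsilon>\<close> are disjoint.
  On \<open>E m\<close> the remaining increment is independent of what has been seen and centred, so the second moment of
  the final sum over \<open>E m\<close> is at least that of the sum at time \<open>m\<close>. The partial sums are indexed by growing
  finite sets, so that the increments may be blocks of arbitrarily many variables.\<close>

lemma (in prob_space) kolmogorov_maximal_inequality:
  fixes Y :: "'i \<Rightarrow> 'a \<Rightarrow> real"
  assumes indep: "indep_vars (\<lambda>_. borel) Y UNIV"
    and int: "\<And>x. integrable M (Y x)" and sq: "\<And>x. integrable M (\<lambda>\<omega>. (Y x \<omega>)\<^sup>2)"
    and centred: "\<And>x. expectation (Y x) = 0"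
    and A: "\<And>m. finite (A m)" "incseq A" and "\<epsilon> > 0"
  shows "prob {\<omega>\<in>space M. \<exists>m\<le>N. \<epsilon> \<le> \<bar>\<Sum>x\<in>A m. Y x \<omega>\<bar>} \<le> (\<Sum>x\<in>A N. expectation (\<lambda>\<omega>. (Y x \<omega>)\<^sup>2)) / \<epsilon>\<^sup>2"
proof -
  have Ym[measurable]: "Y x \<in> borel_measurable M" for x using int by auto
  define X where "X m \<omega> = (\<Sum>x\<in>A m. Y x \<omega>)" for m \<omega>
  have Xm[measurable]: "X m \<in> borel_measurable M" for m unfolding X_def by measurable
  define E where "E m = {\<omega>\<in>space M. \<epsilon> \<le> \<bar>X m \<omega>\<bar> \<and> (\<forall>k<m. \<bar>X k \<omega>\<bar> < \<epsilon>)}" for m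
  have Em[measurable]: "E m \<in> sets M" for m unfolding E_def by measurable
  have disj: "disjoint_family_on E {..N}"
    unfolding disjoint_family_on_def E_def by (auto, metis linorder_neqE_nat not_le)
  have un: "{\<omega>\<in>space M. \<exists>m\<le>N. \<epsilon> \<le> \<bar>X m \<omega>\<bar>} = (\<Union>m\<in>{..N}. E m)"
  proof (intro set_eqI iffI)
    fix \<omega> assume w: "\<omega> \<in> {\<omega>\<in>space M. \<exists>m\<le>N. \<epsilon> \<le> \<bar>X m \<omega>\<bar>}"
    define m where "m = (LEAST m. \<epsilon> \<le> \<bar>X m \<omega>\<bar>)"
    from w obtain m' where m': "m' \<le> N" "\<epsilon> \<le> \<bar>X m' \<omega>\<bar>" by auto
    have "\<epsilon> \<le> \<bar>X m \<omega>\<bar>" unfolding m_def using m'(2) by (rule LeastI)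
    moreover have "m \<le> N" unfolding m_def using Least_le[of "\<lambda>m. \<epsilon> \<le> \<bar>X m \<omega>\<bar>" m'] m' by simp
    moreover have "\<bar>X k \<omega>\<bar> < \<epsilon>" if "k < m" for k
      using not_less_Least[of k "\<lambda>m. \<epsilon> \<le> \<bar>X m \<omega>\<bar>"] that unfolding m_def by force
    ultimately show "\<omega> \<in> (\<Union>m\<in>{..N}. E m)" using w by (auto simp: E_def)
  qed (auto simp: E_def)
  note second_moment = second_moment_sum_of_independent[OF indep int sq centred A(1), folded X_def]
  have key: "\<epsilon>\<^sup>2 * prob (E m) \<le> expectation (\<lambda>\<omega>. indicator (E m) \<omega> * (X N \<omega>)\<^sup>2)" if "m \<le> N" for m
  proof -
    have sub: "A m \<subseteq> A N" using A(2) that by (simp add: incseqD)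
    have XN: "X N \<omega> - X m \<omega> = (\<Sum>x\<in>A N - A m. Y x \<omega>)" for \<omega>
      unfolding X_def using sub A(1) by (simp add: sum_diff)
    define f where "f g = (\<Sum>x\<in>A m. g x) * (if \<epsilon> \<le> \<bar>\<Sum>x\<in>A m. g x\<bar> \<and> (\<forall>k<m. \<bar>\<Sum>x\<in>A k. g x\<bar> < \<epsilon>) then 1 else 0 :: real)"
      for g :: "'i \<Rightarrow> real"
    define h where "h g = (\<Sum>x\<in>A N - A m. g x)" for g :: "'i \<Rightarrow> real"
    have subk: "A k \<subseteq> A m" if "k < m" for k using A(2) that by (simp add: incseqD)
    define S where "S k g = (if k \<le> m then \<Sum>x\<in>A k. g x else 0)" for k and g :: "'i \<Rightarrow> real"
    have [measurable]: "S k \<in> borel_measurable (PiM (A m) (\<lambda>_. borel))" for k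
    proof (cases "k \<le> m")
      case True
      have "(\<lambda>g. \<Sum>x\<in>A k. id g x) \<in> borel_measurable (PiM (A m) (\<lambda>_. borel :: real measure))"
      proof (rule borel_measurable_sum)
        fix x assume "x \<in> A k"
        hence "x \<in> A m" using subk[of k] True by (auto simp: le_less)
        thus "(\<lambda>g. id g x) \<in> borel_measurable (PiM (A m) (\<lambda>_. borel :: real measure))" by simp
      qed
      thus ?thesis using True by (simp add: S_def[abs_def])
    qed (simp add: S_def[abs_def])
    have f_alt: "f = (\<lambda>g. S m g * (if \<epsilon> \<le> \<bar>S m g\<bar> \<and> (\<forall>k<m. \<bar>S k g\<bar> < \<epsilon>) then 1 else 0))"
      unfolding f_def S_def by auto
    have [measurable]: "f \<in> borel_measurable (PiM (A m) (\<lambda>_. borel))"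
      unfolding f_alt by measurable
    have [measurable]: "h \<in> borel_measurable (PiM (A N - A m) (\<lambda>_. borel))"
      unfolding h_def by measurable
    have iv: "indep_var borel (f \<circ> (\<lambda>\<omega>. restrict (\<lambda>i. Y i \<omega>) (A m))) borel (h \<circ> (\<lambda>\<omega>. restrict (\<lambda>i. Y i \<omega>) (A N - A m)))"
      by (rule indep_var_compose[OF indep_var_restrict[OF indep]]) auto
    have fe: "(f \<circ> (\<lambda>\<omega>. restrict (\<lambda>i. Y i \<omega>) (A m))) \<omega> = X m \<omega> * indicator (E m) \<omega>" if "\<omega> \<in> space M" for \<omega>
    proof -
      have "(\<Sum>x\<in>A k. restrict (\<lambda>i. Y i \<omega>) (A m) x) = X k \<omega>" if "k \<le> m" for k
        unfolding X_def using subk[of k] that by (intro sum.cong) (auto simp: le_less)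
      thus ?thesis using that unfolding f_def o_def by (auto simp: E_def indicator_def X_def[symmetric] simp del: restrict_apply)
    qed
    have he: "(h \<circ> (\<lambda>\<omega>. restrict (\<lambda>i. Y i \<omega>) (A N - A m))) = (\<lambda>\<omega>. X N \<omega> - X m \<omega>)"
      unfolding h_def o_def XN by (auto intro!: ext sum.cong)
    have intX: "integrable M (X k)" for k unfolding X_def by (intro Bochner_Integration.integrable_sum int)
    have i1: "integrable M (f \<circ> (\<lambda>\<omega>. restrict (\<lambda>i. Y i \<omega>) (A m)))"
      by (subst Bochner_Integration.integrable_cong[OF refl fe]) (auto intro: integrable_mult_indicator integrable_real_mult_indicator intX)
    have i2: "integrable M (h \<circ> (\<lambda>\<omega>. restrict (\<lambda>i. Y i \<omega>) (A N - A m)))"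
      unfolding he by (intro Bochner_Integration.integrable_diff intX)
    \<comment> \<open>the cross term vanishes, by independence of the past and the increment\<close>
    have cr_int: "integrable M (\<lambda>\<omega>. X m \<omega> * indicator (E m) \<omega> * (X N \<omega> - X m \<omega>))"
      using indep_var_integrable[OF iv i1 i2]
      by (rule Bochner_Integration.integrable_cong[THEN iffD1, OF refl, rotated]) (simp add: fe he del: o_apply)
    have E2: "expectation (h \<circ> (\<lambda>\<omega>. restrict (\<lambda>i. Y i \<omega>) (A N - A m))) = 0"
      unfolding he XN using int centred by (simp add: Bochner_Integration.integral_sum)
    have cr: "expectation (\<lambda>\<omega>. X m \<omega> * indicator (E m) \<omega> * (X N \<omega> - X m \<omega>)) = 0"
    proof -
      have "expectation (\<lambda>\<omega>. X m \<omega> * indicator (E m) \<omega> * (X N \<omega> - X m \<omega>)) =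
        expectation (\<lambda>\<omega>. (f \<circ> (\<lambda>\<omega>. restrict (\<lambda>i. Y i \<omega>) (A m))) \<omega> * (h \<circ> (\<lambda>\<omega>. restrict (\<lambda>i. Y i \<omega>) (A N - A m))) \<omega>)"
        by (rule Bochner_Integration.integral_cong[OF refl]) (simp add: fe he del: o_apply)
      also have "\<dots> = 0" using indep_var_lebesgue_integral[OF iv i1 i2] E2 by (simp del: o_apply)
      finally show ?thesis .
    qed
    have sqm: "integrable M (\<lambda>\<omega>. indicator (E m) \<omega> * (X k \<omega>)\<^sup>2)" for k
      using integrable_mult_indicator[OF Em second_moment(1), of m k] by simp
    have "\<epsilon>\<^sup>2 * prob (E m) = expectation (\<lambda>\<omega>. \<epsilon>\<^sup>2 * indicator (E m) \<omega>)" by simp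
    also have "\<dots> \<le> expectation (\<lambda>\<omega>. indicator (E m) \<omega> * (X m \<omega>)\<^sup>2)"
    proof (rule integral_mono)
      fix \<omega>
      show "\<epsilon>\<^sup>2 * indicator (E m) \<omega> \<le> indicator (E m) \<omega> * (X m \<omega>)\<^sup>2"
        using \<open>\<epsilon> > 0\<close> by (auto simp: indicator_def E_def abs_le_square_iff[symmetric])
      show "integrable M (\<lambda>\<omega>. \<epsilon>\<^sup>2 * indicator (E m) \<omega>)"
        by (intro Bochner_Integration.integrable_mult_right) (simp add: emeasure_eq_measure)
    qed (use sqm in auto)
    also have "\<dots> = expectation (\<lambda>\<omega>. indicator (E m) \<omega> * (X m \<omega>)\<^sup>2 + 2 * (X m \<omega> * indicator (E m) \<omega> * (X N \<omega> - X m \<omega>)))"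
      by (subst Bochner_Integration.integral_add) (use sqm cr_int cr in auto)
    also have "\<dots> \<le> expectation (\<lambda>\<omega>. indicator (E m) \<omega> * (X N \<omega>)\<^sup>2)"
    proof (rule integral_mono)
      fix \<omega>
      have "(X m \<omega>)\<^sup>2 + 2 * (X m \<omega> * (X N \<omega> - X m \<omega>)) \<le> (X N \<omega>)\<^sup>2"
        using zero_le_power2[of "X N \<omega> - X m \<omega>"] by (simp add: power2_eq_square algebra_simps)
      thus "indicator (E m) \<omega> * (X m \<omega>)\<^sup>2 + 2 * (X m \<omega> * indicator (E m) \<omega> * (X N \<omega> - X m \<omega>)) \<le> indicator (E m) \<omega> * (X N \<omega>)\<^sup>2"
        by (simp add: indicator_def)
    qed (use sqm cr_int in auto)
    finally show ?thesis .
  qed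
  have sqN: "integrable M (\<lambda>\<omega>. indicator (E m) \<omega> * (X N \<omega>)\<^sup>2)" for m
    using integrable_mult_indicator[OF Em second_moment(1), of m N] by simp
  have "prob (\<Union>m\<in>{..N}. E m) = (\<Sum>m\<le>N. prob (E m))"
    by (rule finite_measure_finite_Union) (use disj Em in auto)
  hence "\<epsilon>\<^sup>2 * prob (\<Union>m\<in>{..N}. E m) = (\<Sum>m\<le>N. \<epsilon>\<^sup>2 * prob (E m))"
    by (simp only: sum_distrib_left)
  also have "\<dots> \<le> (\<Sum>m\<le>N. expectation (\<lambda>\<omega>. indicator (E m) \<omega> * (X N \<omega>)\<^sup>2))"
    by (intro sum_mono key) auto
  also have "\<dots> = expectation (\<lambda>\<omega>. \<Sum>m\<le>N. indicator (E m) \<omega> * (X N \<omega>)\<^sup>2)"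
    by (subst Bochner_Integration.integral_sum) (use sqN in auto)
  also have "\<dots> \<le> expectation (\<lambda>\<omega>. (X N \<omega>)\<^sup>2)"
  proof (rule integral_mono)
    show "integrable M (\<lambda>\<omega>. \<Sum>m\<le>N. indicator (E m) \<omega> * (X N \<omega>)\<^sup>2)"
      by (rule Bochner_Integration.integrable_sum) (rule sqN)
    show "integrable M (\<lambda>\<omega>. (X N \<omega>)\<^sup>2)" by (rule second_moment(1))
    fix \<omega>
    have "(\<Sum>m\<le>N. indicator (E m) \<omega> :: real) = indicator (\<Union>m\<in>{..N}. E m) \<omega>"
      by (rule indicator_UN_disjoint[symmetric]) (use disj in auto)
    hence "(\<Sum>m\<le>N. indicator (E m) \<omega> * (X N \<omega>)\<^sup>2) = indicator (\<Union>m\<in>{..N}. E m) \<omega> * (X N \<omega>)\<^sup>2"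
      by (metis sum_distrib_right)
    also have "\<dots> \<le> (X N \<omega>)\<^sup>2" by (simp add: indicator_def)
    finally show "(\<Sum>m\<le>N. indicator (E m) \<omega> * (X N \<omega>)\<^sup>2) \<le> (X N \<omega>)\<^sup>2" .
  qed
  finally have "\<epsilon>\<^sup>2 * prob (\<Union>m\<in>{..N}. E m) \<le> (\<Sum>x\<in>A N. expectation (\<lambda>\<omega>. (Y x \<omega>)\<^sup>2))" unfolding second_moment(2) .
  thus ?thesis using un \<open>\<epsilon> > 0\<close> unfolding X_def by (simp add: pos_le_divide_eq mult.commute)
qed

text \<open>Applied to the sums that start at index \<open>K\<close>, the maximal inequality bounds the oscillation of the tail by the
  tail of the convergent series of variances; hence the partial sums are almost surely Cauchy.\<close>

lemma (in prob_space) AE_convergent_sum_of_independent: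
  fixes Y :: "'i \<Rightarrow> 'a \<Rightarrow> real"
  assumes indep: "indep_vars (\<lambda>_. borel) Y UNIV"
    and int: "\<And>x. integrable M (Y x)" and sq: "\<And>x. integrable M (\<lambda>\<omega>. (Y x \<omega>)\<^sup>2)"
    and centred: "\<And>x. expectation (Y x) = 0"
    and A: "\<And>m. finite (A m)" "incseq A"
    and bdd: "\<And>m. (\<Sum>x\<in>A m. expectation (\<lambda>\<omega>. (Y x \<omega>)\<^sup>2)) \<le> B"
  shows "AE \<omega> in M. convergent (\<lambda>m. \<Sum>x\<in>A m. Y x \<omega>)"
proof -
  have Ym[measurable]: "Y x \<in> borel_measurable M" for x using int by auto
  define X where "X m \<omega> = (\<Sum>x\<in>A m. Y x \<omega>)" for m \<omega>
  have Xm[measurable]: "X m \<in> borel_measurable M" for m unfolding X_def by measurable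
  define s where "s m = (\<Sum>x\<in>A m. expectation (\<lambda>\<omega>. (Y x \<omega>)\<^sup>2))" for m
  have s_mono: "s m \<le> s k" if "m \<le> k" for m k
    unfolding s_def using A that by (intro sum_mono2) (auto simp: incseqD)
  obtain l where l: "s \<longlonglongrightarrow> l" and sl: "\<And>m. s m \<le> l"
    using incseq_convergent[of s B] s_mono bdd by (auto simp: s_def incseq_def)
  have tail: "prob {\<omega>\<in>space M. \<exists>m\<ge>K. \<epsilon> \<le> \<bar>X m \<omega> - X K \<omega>\<bar>} \<le> (l - s K) / \<epsilon>\<^sup>2" if "\<epsilon> > 0" for K \<epsilon>
  proof -
    \<comment> \<open>for \<open>m < K\<close> the set is empty, hence contributes no exceedance\<close>
    define A' where "A' m = A m - A K" for m
    have XA: "(\<Sum>x\<in>A' m. Y x \<omega>) = (if K \<le> m then X m \<omega> - X K \<omega> else 0)" for m \<omega>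
    proof (cases "K \<le> m")
      case True
      hence "A K \<subseteq> A m" using A(2) by (simp add: incseqD)
      thus ?thesis using True A(1) by (simp add: A'_def X_def sum_diff)
    next
      case False
      hence "A m \<subseteq> A K" using A(2) by (simp add: incseqD)
      hence "A' m = {}" by (auto simp: A'_def)
      thus ?thesis using False by simp
    qed
    define F where "F N = {\<omega>\<in>space M. \<exists>m\<le>N. \<epsilon> \<le> \<bar>\<Sum>x\<in>A' m. Y x \<omega>\<bar>}" for N
    have Fm: "F N \<in> sets M" for N unfolding F_def by measurable
    have bd: "prob (F N) \<le> (l - s K) / \<epsilon>\<^sup>2" for N
    proof -
      have "prob (F N) \<le> (\<Sum>x\<in>A' N. expectation (\<lambda>\<omega>. (Y x \<omega>)\<^sup>2)) / \<epsilon>\<^sup>2"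
        unfolding F_def
        by (rule kolmogorov_maximal_inequality[OF indep int sq centred _ _ that])
           (use A in \<open>auto simp: A'_def incseq_def\<close>)
      also have "\<dots> \<le> (l - s K) / \<epsilon>\<^sup>2"
      proof (rule divide_right_mono)
        have "(\<Sum>x\<in>A' N. expectation (\<lambda>\<omega>. (Y x \<omega>)\<^sup>2)) \<le> (\<Sum>x\<in>A (max N K) - A K. expectation (\<lambda>\<omega>. (Y x \<omega>)\<^sup>2))"
          using A incseqD[OF A(2), of N "max N K"] by (intro sum_mono2) (auto simp: A'_def)
        also have "\<dots> = s (max N K) - s K"
          using A incseqD[OF A(2), of K "max N K"] by (simp add: sum_diff s_def)
        finally show "(\<Sum>x\<in>A' N. expectation (\<lambda>\<omega>. (Y x \<omega>)\<^sup>2)) \<le> l - s K" using sl[of "max N K"] by simp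
      qed simp
      finally show ?thesis .
    qed
    have "(\<lambda>N. prob (F N)) \<longlonglongrightarrow> prob (\<Union>N. F N)"
      by (rule finite_Lim_measure_incseq) (use Fm in \<open>auto simp: incseq_def F_def intro: order_trans\<close>)
    hence "prob (\<Union>N. F N) \<le> (l - s K) / \<epsilon>\<^sup>2"
      by (rule LIMSEQ_le_const2) (use bd in auto)
    also have "(\<Union>N. F N) = {\<omega>\<in>space M. \<exists>m\<ge>K. \<epsilon> \<le> \<bar>X m \<omega> - X K \<omega>\<bar>}"
      using that by (auto simp: F_def XA split: if_splits)
    finally show ?thesis .
  qed
  have "AE \<omega> in M. \<exists>K. \<forall>m\<ge>K. \<bar>X m \<omega> - X K \<omega>\<bar> < 1 / real (Suc j)" for j
  proof (rule AE_I')
    define N where "N = {\<omega>\<in>space M. \<forall>K. \<exists>m\<ge>K. 1 / real (Suc j) \<le> \<bar>X m \<omega> - X K \<omega>\<bar>}"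
    have Nm: "N \<in> sets M" unfolding N_def by measurable
    have "prob N \<le> (l - s K) / (1 / real (Suc j))\<^sup>2" for K
    proof -
      have "prob N \<le> prob {\<omega>\<in>space M. \<exists>m\<ge>K. 1 / real (Suc j) \<le> \<bar>X m \<omega> - X K \<omega>\<bar>}"
        by (rule finite_measure_mono) (auto simp: N_def)
      also have "\<dots> \<le> (l - s K) / (1 / real (Suc j))\<^sup>2" by (rule tail) simp
      finally show ?thesis .
    qed
    moreover have "(\<lambda>K. (l - s K) / (1 / real (Suc j))\<^sup>2) \<longlonglongrightarrow> (l - l) / (1 / real (Suc j))\<^sup>2"
      by (intro tendsto_intros l) simp
    ultimately have "prob N \<le> (l - l) / (1 / real (Suc j))\<^sup>2" by (metis (no_types, lifting) LIMSEQ_le_const)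
    hence "prob N \<le> 0" by simp
    hence "emeasure M N = 0" by (simp add: emeasure_eq_measure measure_le_0_iff)
    thus "N \<in> null_sets M" using Nm by (auto simp: null_sets_def)
    show "{\<omega>\<in>space M. \<not> (\<exists>K. \<forall>m\<ge>K. \<bar>X m \<omega> - X K \<omega>\<bar> < 1 / real (Suc j))} \<subseteq> N"
      by (auto simp: N_def not_less)
  qed
  hence "AE \<omega> in M. \<forall>j. \<exists>K. \<forall>m\<ge>K. \<bar>X m \<omega> - X K \<omega>\<bar> < 1 / real (Suc j)" by (simp add: AE_all_countable)
  thus ?thesis
  proof eventually_elim
    case (elim \<omega>)
    have "Cauchy (\<lambda>m. X m \<omega>)"
    proof (rule metric_CauchyI)
      fix e :: real assume "e > 0"
      then obtain j where j: "1 / real (Suc j) < e / 2"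
        using reals_Archimedean[of "e/2"] by (auto simp: inverse_eq_divide)
      obtain K where K: "\<And>m. m \<ge> K \<Longrightarrow> \<bar>X m \<omega> - X K \<omega>\<bar> < 1 / real (Suc j)" using elim by blast
      have "dist (X m \<omega>) (X n \<omega>) < e" if "m \<ge> K" "n \<ge> K" for m n
        using K[OF that(1)] K[OF that(2)] j unfolding dist_real_def by linarith
      thus "\<exists>K. \<forall>m\<ge>K. \<forall>n\<ge>K. dist (X m \<omega>) (X n \<omega>) < e" by blast
    qed
    thus ?case by (simp add: X_def Cauchy_convergent_iff)
  qed
qed

section \<open>Weighted series of Gamma variables\<close>

lemma iexp_diff_le: "norm (iexp s - iexp t) \<le> \<bar>s - t\<bar>"
proof -
  have "iexp s = iexp t * iexp (s - t)" by (simp add: exp_add[symmetric] algebra_simps)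
  hence "norm (iexp s - iexp t) = norm (iexp t * (iexp (s - t) - 1))"
    by (simp add: algebra_simps)
  also have "\<dots> = norm (iexp (s - t) - 1)" by (simp add: norm_mult)
  also have "\<dots> \<le> \<bar>s - t\<bar>" using iexp_approx1[of "s - t" 0] by simp
  finally show ?thesis .
qed

locale gamma_field = prob_space M for M :: "'a measure" +
  fixes \<theta> :: real and G :: "'i \<Rightarrow> 'a \<Rightarrow> real" and A :: "nat \<Rightarrow> 'i set"
  assumes \<theta>: "\<theta> > 0"
    and indep: "indep_vars (\<lambda>_. borel) G UNIV"
    and distr: "\<And>x. distributed M lborel (G x) (\<lambda>t. ennreal (gamma_density \<theta> t))"
    and A_finite: "\<And>m. finite (A m)" and A_incseq: "incseq A" and A_UNIV: "(\<Union>m. A m) = UNIV"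
begin

lemma G_measurable[measurable]: "G x \<in> borel_measurable M"
  using distributed_measurable[OF distr[of x]] by simp

lemma gamma_density_measurable[measurable]: "gamma_density \<theta> \<in> borel_measurable borel"
  unfolding gamma_density_def by measurable

lemma Gamma_\<theta>_pos: "Gamma \<theta> > 0" using \<theta> by (rule Gamma_real_pos)

lemma gamma_power_moment:
  "(\<integral>\<^sup>+\<omega>. ennreal (G x \<omega> ^ k) \<partial>M) = ennreal (Gamma (\<theta> + real k) / Gamma \<theta>)"
proof -
  have "(\<integral>\<^sup>+\<omega>. ennreal (G x \<omega> ^ k) \<partial>M) = (\<integral>\<^sup>+t. ennreal (gamma_density \<theta> t) * ennreal (t ^ k) \<partial>lborel)"
    by (rule distributed_nn_integral[OF distr, symmetric]) measurable
  also have "\<dots> = (\<integral>\<^sup>+t. ennreal (inverse (Gamma \<theta>)) * ennreal (indicator {0..} t * t powr (\<theta> + real k - 1) / exp t) \<partial>lborel)"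
  proof (rule nn_integral_cong_AE, rule AE_mp[OF AE_lborel_singleton[of 0]], intro AE_I2 impI)
    fix t :: real assume t: "t \<noteq> 0"
    show "ennreal (gamma_density \<theta> t) * ennreal (t ^ k) = ennreal (inverse (Gamma \<theta>)) * ennreal (indicator {0..} t * t powr (\<theta> + real k - 1) / exp t)"
    proof (cases "t > 0")
      case True
      have "t powr (\<theta> - 1) * t ^ k = t powr (\<theta> + real k - 1)"
        using True by (simp add: powr_realpow[symmetric] powr_add[symmetric] algebra_simps)
      thus ?thesis using True Gamma_\<theta>_pos
        by (simp add: gamma_density_def ennreal_mult'[symmetric] exp_minus field_simps)
    qed (use t in \<open>simp add: gamma_density_def\<close>)
  qed
  also have "\<dots> = ennreal (inverse (Gamma \<theta>)) * ennreal (Gamma (\<theta> + real k))"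
    using \<theta> by (subst nn_integral_cmult) (auto simp: Gamma_conv_nn_integral_real)
  also have "\<dots> = ennreal (Gamma (\<theta> + real k) / Gamma \<theta>)"
    using \<theta> Gamma_real_pos[of "\<theta> + real k"] Gamma_\<theta>_pos by (simp add: ennreal_mult'[symmetric] divide_inverse mult.commute)
  finally show ?thesis .
qed

lemma AE_G_nonneg: "AE \<omega> in M. 0 \<le> G x \<omega>"
proof -
  have "emeasure M (G x -` {..<0} \<inter> space M) = (\<integral>\<^sup>+t. ennreal (gamma_density \<theta> t) * indicator {..<0} t \<partial>lborel)"
    by (rule distributed_emeasure[OF distr]) simp
  also have "\<dots> = (\<integral>\<^sup>+t. 0 \<partial>(lborel :: real measure))"
    by (rule nn_integral_cong) (auto simp: gamma_density_def indicator_def)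
  finally have "emeasure M (G x -` {..<0} \<inter> space M) = 0" by simp
  thus ?thesis by (intro AE_I[of _ _ "G x -` {..<0} \<inter> space M"]) auto
qed

lemma
  shows integrable_G: "integrable M (G x)" and expectation_G: "expectation (G x) = \<theta>"
    and integrable_G2: "integrable M (\<lambda>\<omega>. (G x \<omega>)\<^sup>2)" and expectation_G2: "expectation (\<lambda>\<omega>. (G x \<omega>)\<^sup>2) = \<theta> * (\<theta> + 1)"
proof -
  have np: "\<theta> \<notin> \<int>\<^sub>\<le>\<^sub>0" "\<theta> + 1 \<notin> \<int>\<^sub>\<le>\<^sub>0" using \<theta> by (auto elim!: nonpos_Ints_cases)
  have 1: "Gamma (\<theta> + 1) / Gamma \<theta> = \<theta>" using Gamma_plus1[OF np(1)] Gamma_\<theta>_pos by simp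
  have 2: "Gamma (\<theta> + 2) / Gamma \<theta> = \<theta> * (\<theta> + 1)"
    using Gamma_plus1[OF np(2)] Gamma_plus1[OF np(1)] Gamma_\<theta>_pos by (simp add: add.assoc)
  have m1: "(\<integral>\<^sup>+\<omega>. ennreal (G x \<omega>) \<partial>M) = ennreal \<theta>" using gamma_power_moment[of x 1] 1 by simp
  have m2: "(\<integral>\<^sup>+\<omega>. ennreal ((G x \<omega>)\<^sup>2) \<partial>M) = ennreal (\<theta> * (\<theta> + 1))" using gamma_power_moment[of x 2] 2 by simp
  show "integrable M (G x)" by (rule integrableI_nonneg) (use AE_G_nonneg m1 in auto)
  show "integrable M (\<lambda>\<omega>. (G x \<omega>)\<^sup>2)" by (rule integrableI_nonneg) (use m2 in auto)
  show "expectation (G x) = \<theta>" by (subst integral_eq_nn_integral) (use AE_G_nonneg m1 \<theta> in auto)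
  show "expectation (\<lambda>\<omega>. (G x \<omega>)\<^sup>2) = \<theta> * (\<theta> + 1)" by (subst integral_eq_nn_integral) (use m2 \<theta> in auto)
qed

text \<open>The substitution \<open>t \<mapsto> t / (1 + u)\<close> reduces this to the Gamma integral. Negative \<open>u\<close> are
  included, since the Chernoff bound below needs exponential moments of the variables.\<close>

lemma gamma_laplace:
  assumes u: "u > -1"
  shows "(\<integral>\<^sup>+\<omega>. ennreal (exp (- u * G x \<omega>)) \<partial>M) = ennreal ((1 + u) powr (- \<theta>))"
proof -
  define f where "f t = ennreal (gamma_density \<theta> t) * ennreal (exp (- u * t))" for t
  have [measurable]: "f \<in> borel_measurable borel" unfolding f_def by measurable
  have "(\<integral>\<^sup>+\<omega>. ennreal (exp (- u * G x \<omega>)) \<partial>M) = (\<integral>\<^sup>+t. f t \<partial>lborel)"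
    unfolding f_def by (rule distributed_nn_integral[OF distr, symmetric]) measurable
  also have "\<dots> = ennreal \<bar>1 / (1 + u)\<bar> * (\<integral>\<^sup>+t. f (0 + 1 / (1 + u) * t) \<partial>lborel)"
    using u by (intro nn_integral_real_affine) auto
  also have "(\<integral>\<^sup>+t. f (0 + 1 / (1 + u) * t) \<partial>lborel) =
     (\<integral>\<^sup>+t. ennreal ((1 + u) powr (1 - \<theta>) / Gamma \<theta>) * ennreal (indicator {0..} t * t powr (\<theta> - 1) / exp t) \<partial>lborel)"
  proof (rule nn_integral_cong)
    fix t :: real
    show "f (0 + 1 / (1 + u) * t) = ennreal ((1 + u) powr (1 - \<theta>) / Gamma \<theta>) * ennreal (indicator {0..} t * t powr (\<theta> - 1) / exp t)"
    proof (cases "t \<ge> 0")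
      case True
      have e: "exp (- (t / (1 + u))) * exp (- (u * t / (1 + u))) = exp (- t)"
      proof -
        have "- (t / (1 + u)) + - (u * t / (1 + u)) = - ((1 + u) * t / (1 + u))"
          by (simp add: add_divide_distrib distrib_right)
        also have "\<dots> = - t" using u by simp
        finally show ?thesis by (simp add: exp_add[symmetric])
      qed
      have p: "(t / (1 + u)) powr (\<theta> - 1) = t powr (\<theta> - 1) * (1 + u) powr (1 - \<theta>)"
        using u True by (simp add: powr_divide powr_diff)
      have "gamma_density \<theta> (t / (1 + u)) * exp (- (u * t / (1 + u))) = t powr (\<theta> - 1) * (1 + u) powr (1 - \<theta>) * (exp (- (t / (1 + u))) * exp (- (u * t / (1 + u)))) / Gamma \<theta>"
        using True u by (simp add: gamma_density_def p)
      also have "\<dots> = (1 + u) powr (1 - \<theta>) / Gamma \<theta> * (t powr (\<theta> - 1) / exp t)"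
        unfolding e by (simp add: exp_minus field_simps)
      finally have "gamma_density \<theta> (t / (1 + u)) * exp (- (u * t / (1 + u))) = \<dots>" .
      thus ?thesis using True u Gamma_\<theta>_pos unfolding f_def by (simp add: ennreal_mult''[symmetric])
    qed (use u in \<open>simp add: f_def gamma_density_def zero_le_divide_iff\<close>)
  qed
  also have "\<dots> = ennreal ((1 + u) powr (1 - \<theta>) / Gamma \<theta>) * ennreal (Gamma \<theta>)"
    using \<theta> by (subst nn_integral_cmult) (auto simp: Gamma_conv_nn_integral_real)
  also have "ennreal \<bar>1 / (1 + u)\<bar> * (ennreal ((1 + u) powr (1 - \<theta>) / Gamma \<theta>) * ennreal (Gamma \<theta>)) = ennreal ((1 + u) powr (- \<theta>))"
  proof -
    have "1 / (1 + u) * ((1 + u) powr (1 - \<theta>) / Gamma \<theta> * Gamma \<theta>) = (1 + u) powr (- \<theta>)"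
      using u Gamma_\<theta>_pos by (simp add: powr_diff powr_minus divide_inverse)
    thus ?thesis using u Gamma_\<theta>_pos by (simp add: ennreal_mult'[symmetric] del: times_divide_eq_left times_divide_eq_right)
  qed
  finally show ?thesis .
qed

definition gamma_sum :: "('i \<Rightarrow> real) \<Rightarrow> nat \<Rightarrow> 'a \<Rightarrow> real" where
  "gamma_sum b m \<omega> = (\<Sum>x\<in>A m. (\<theta> - G x \<omega>) * b x)"

text \<open>The limit is taken along the fixed exhaustion \<open>A\<close>. For square summable \<open>b\<close> it exists almost surely, but
  in general the series does not converge absolutely, so it cannot be an unordered sum.\<close>

definition gamma_series :: "('i \<Rightarrow> real) \<Rightarrow> 'a \<Rightarrow> real" where
  "gamma_series b \<omega> = lim (\<lambda>m. gamma_sum b m \<omega>)"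

lemma gamma_sum_measurable[measurable]: "gamma_sum b m \<in> borel_measurable M"
  unfolding gamma_sum_def by measurable

lemma gamma_series_measurable[measurable]: "gamma_series b \<in> borel_measurable M"
  unfolding gamma_series_def by measurable

lemma gamma_term_moments:
  shows "integrable M (\<lambda>\<omega>. (\<theta> - G x \<omega>) * b)" and "expectation (\<lambda>\<omega>. (\<theta> - G x \<omega>) * b) = 0"
    and "integrable M (\<lambda>\<omega>. ((\<theta> - G x \<omega>) * b)\<^sup>2)" and "expectation (\<lambda>\<omega>. ((\<theta> - G x \<omega>) * b)\<^sup>2) = \<theta> * b\<^sup>2"
proof -
  show "integrable M (\<lambda>\<omega>. (\<theta> - G x \<omega>) * b)" "expectation (\<lambda>\<omega>. (\<theta> - G x \<omega>) * b) = 0"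
    using integrable_G[of x] by (auto simp: expectation_G prob_space)
  have e: "(\<lambda>\<omega>. ((\<theta> - G x \<omega>) * b)\<^sup>2) = (\<lambda>\<omega>. b\<^sup>2 * (\<theta>\<^sup>2 - 2 * \<theta> * G x \<omega> + (G x \<omega>)\<^sup>2))"
    by (simp add: power2_eq_square algebra_simps)
  show "integrable M (\<lambda>\<omega>. ((\<theta> - G x \<omega>) * b)\<^sup>2)" "expectation (\<lambda>\<omega>. ((\<theta> - G x \<omega>) * b)\<^sup>2) = \<theta> * b\<^sup>2"
    unfolding e using integrable_G[of x] integrable_G2[of x]
    by (simp_all add: expectation_G expectation_G2 prob_space) (simp add: power2_eq_square algebra_simps)
qed

lemma indep_vars_gamma_term: "indep_vars (\<lambda>_. borel) (\<lambda>x \<omega>. (\<theta> - G x \<omega>) * b x) UNIV"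
  using indep_vars_compose2[OF indep, of "\<lambda>x t. (\<theta> - t) * b x" "\<lambda>_. borel"] by simp

lemma sum_A_le_infsum:
  assumes "f summable_on UNIV" and "\<And>x. 0 \<le> (f x :: real)"
  shows "(\<Sum>x\<in>A m. f x) \<le> (\<Sum>\<^sub>\<infinity>x. f x)"
  by (rule finite_sum_le_infsum) (use assms A_finite in auto)

lemma sum_A_tendsto_infsum:
  fixes f :: "'i \<Rightarrow> real"
  assumes "f summable_on UNIV"
  shows "(\<lambda>m. \<Sum>x\<in>A m. f x) \<longlonglongrightarrow> (\<Sum>\<^sub>\<infinity>x. f x)"
proof -
  have "filterlim A (finite_subsets_at_top UNIV) sequentially"
  proof (rule filterlim_finite_subsets_at_top[THEN iffD2], intro allI impI)
    fix X :: "'i set" assume X: "finite X \<and> X \<subseteq> UNIV"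
    have "\<exists>N. \<forall>m\<ge>N. X \<subseteq> A m" using X[THEN conjunct1]
    proof (induction X)
      case (insert x X)
      then obtain N where N: "\<And>m. m \<ge> N \<Longrightarrow> X \<subseteq> A m" by blast
      obtain k where k: "x \<in> A k" using A_UNIV by blast
      have "insert x X \<subseteq> A m" if "m \<ge> max N k" for m
        using N[of m] k that incseqD[OF A_incseq, of k m] by auto
      thus ?case by blast
    qed simp
    thus "\<forall>\<^sub>F m in sequentially. finite (A m) \<and> X \<subseteq> A m \<and> A m \<subseteq> UNIV"
      using A_finite by (auto simp: eventually_sequentially)
  qed
  moreover have "(sum f \<longlongrightarrow> (\<Sum>\<^sub>\<infinity>x. f x)) (finite_subsets_at_top UNIV)"
    using has_sum_infsum[OF assms] by (simp add: has_sum_def)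
  ultimately show ?thesis by (rule filterlim_compose[rotated])
qed

lemma AE_gamma_sum_convergent:
  assumes "(\<lambda>x. (b x)\<^sup>2) summable_on UNIV"
  shows "AE \<omega> in M. convergent (\<lambda>m. gamma_sum b m \<omega>)"
  unfolding gamma_sum_def
proof (rule AE_convergent_sum_of_independent[where B="\<theta> * (\<Sum>\<^sub>\<infinity>x. (b x)\<^sup>2)"])
  show "(\<Sum>x\<in>A m. expectation (\<lambda>\<omega>. ((\<theta> - G x \<omega>) * b x)\<^sup>2)) \<le> \<theta> * (\<Sum>\<^sub>\<infinity>x. (b x)\<^sup>2)" for m
    using sum_A_le_infsum[OF assms] \<theta> by (simp add: gamma_term_moments sum_distrib_left[symmetric])
  show "indep_vars (\<lambda>_. borel) (\<lambda>x \<omega>. (\<theta> - G x \<omega>) * b x) UNIV" by (rule indep_vars_gamma_term)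
  show "integrable M (\<lambda>\<omega>. (\<theta> - G x \<omega>) * b x)" for x by (rule gamma_term_moments)
  show "integrable M (\<lambda>\<omega>. ((\<theta> - G x \<omega>) * b x)\<^sup>2)" for x by (rule gamma_term_moments)
  show "expectation (\<lambda>\<omega>. (\<theta> - G x \<omega>) * b x) = 0" for x by (rule gamma_term_moments)
qed (rule A_finite, rule A_incseq)

lemma AE_gamma_sum_tendsto:
  assumes "(\<lambda>x. (b x)\<^sup>2) summable_on UNIV"
  shows "AE \<omega> in M. (\<lambda>m. gamma_sum b m \<omega>) \<longlonglongrightarrow> gamma_series b \<omega>"
  using AE_gamma_sum_convergent[OF assms] by eventually_elim (simp add: gamma_series_def convergent_LIMSEQ_iff)

lemma gamma_sum_L2:
  shows "integrable M (\<lambda>\<omega>. (gamma_sum b m \<omega>)\<^sup>2)"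
    and "expectation (\<lambda>\<omega>. (gamma_sum b m \<omega>)\<^sup>2) = \<theta> * (\<Sum>x\<in>A m. (b x)\<^sup>2)"
proof -
  note second_moment = second_moment_sum_of_independent[OF indep_vars_gamma_term gamma_term_moments(1,3,2) A_finite, folded gamma_sum_def]
  show "integrable M (\<lambda>\<omega>. (gamma_sum b m \<omega>)\<^sup>2)" by (rule second_moment(1))
  show "expectation (\<lambda>\<omega>. (gamma_sum b m \<omega>)\<^sup>2) = \<theta> * (\<Sum>x\<in>A m. (b x)\<^sup>2)"
    unfolding second_moment(2) gamma_term_moments(4) sum_distrib_left ..
qed

text \<open>The finite partial sums differ by \<open>sqrt (\<theta> * (\<Sum>x. (b x - b' x)\<^sup>2))\<close> at most in the root mean square, uniformly in the
  number of terms, so that the bound passes to the limit by bounded convergence.\<close>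

lemma char_gamma_series_diff_le:
  assumes b: "(\<lambda>x. (b x)\<^sup>2) summable_on UNIV" and b': "(\<lambda>x. (b' x)\<^sup>2) summable_on UNIV"
    and d: "(\<lambda>x. (b x - b' x)\<^sup>2) summable_on UNIV"
  shows "norm ((CLINT \<omega>|M. iexp (t * gamma_series b \<omega>)) - (CLINT \<omega>|M. iexp (t * gamma_series b' \<omega>)))
     \<le> \<bar>t\<bar> * sqrt (\<theta> * (\<Sum>\<^sub>\<infinity>x. (b x - b' x)\<^sup>2))"
proof -
  have lim: "(\<lambda>m. CLINT \<omega>|M. iexp (t * gamma_sum b m \<omega>)) \<longlonglongrightarrow> (CLINT \<omega>|M. iexp (t * gamma_series b \<omega>))"
    if "(\<lambda>x. (b x)\<^sup>2) summable_on UNIV" for b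
  proof (rule integral_dominated_convergence[where w="\<lambda>_. 1"])
    show "AE \<omega> in M. (\<lambda>m. iexp (t * gamma_sum b m \<omega>)) \<longlonglongrightarrow> iexp (t * gamma_series b \<omega>)"
      using AE_gamma_sum_tendsto[OF that] by eventually_elim (intro tendsto_intros)
  qed auto
  have le: "norm ((CLINT \<omega>|M. iexp (t * gamma_sum b m \<omega>)) - (CLINT \<omega>|M. iexp (t * gamma_sum b' m \<omega>)))
     \<le> \<bar>t\<bar> * sqrt (\<theta> * (\<Sum>\<^sub>\<infinity>x. (b x - b' x)\<^sup>2))" for m
  proof -
    have dif: "gamma_sum b m \<omega> - gamma_sum b' m \<omega> = gamma_sum (\<lambda>x. b x - b' x) m \<omega>" for \<omega>
      by (simp add: gamma_sum_def sum_subtractf right_diff_distrib')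
    have i: "integrable M (\<lambda>\<omega>. iexp (t * gamma_sum b m \<omega>))" for b
      by (rule integrable_const_bound[of _ 1]) auto
    have int: "integrable M (gamma_sum (\<lambda>x. b x - b' x) m)"
      unfolding gamma_sum_def by (intro Bochner_Integration.integrable_sum gamma_term_moments)
    have "norm ((CLINT \<omega>|M. iexp (t * gamma_sum b m \<omega>)) - (CLINT \<omega>|M. iexp (t * gamma_sum b' m \<omega>)))
      = norm (CLINT \<omega>|M. iexp (t * gamma_sum b m \<omega>) - iexp (t * gamma_sum b' m \<omega>))"
      using i by (simp add: Bochner_Integration.integral_diff)
    also have "\<dots> \<le> (LINT \<omega>|M. norm (iexp (t * gamma_sum b m \<omega>) - iexp (t * gamma_sum b' m \<omega>)))"
      by (rule integral_norm_bound)
    also have "\<dots> \<le> (LINT \<omega>|M. \<bar>t\<bar> * \<bar>gamma_sum (\<lambda>x. b x - b' x) m \<omega>\<bar>)"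
    proof (rule integral_mono)
      show "norm (iexp (t * gamma_sum b m \<omega>) - iexp (t * gamma_sum b' m \<omega>)) \<le> \<bar>t\<bar> * \<bar>gamma_sum (\<lambda>x. b x - b' x) m \<omega>\<bar>" for \<omega>
        using iexp_diff_le[of "t * gamma_sum b m \<omega>" "t * gamma_sum b' m \<omega>"]
        unfolding dif[symmetric] by (simp add: right_diff_distrib'[symmetric] abs_mult)
      show "integrable M (\<lambda>\<omega>. norm (iexp (t * gamma_sum b m \<omega>) - iexp (t * gamma_sum b' m \<omega>)))"
        using i by (intro integrable_norm Bochner_Integration.integrable_diff)
      show "integrable M (\<lambda>\<omega>. \<bar>t\<bar> * \<bar>gamma_sum (\<lambda>x. b x - b' x) m \<omega>\<bar>)" using int by auto
    qed
    also have "\<dots> = \<bar>t\<bar> * expectation (\<lambda>\<omega>. \<bar>gamma_sum (\<lambda>x. b x - b' x) m \<omega>\<bar>)" by simp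
    also have "expectation (\<lambda>\<omega>. \<bar>gamma_sum (\<lambda>x. b x - b' x) m \<omega>\<bar>) \<le> sqrt (\<theta> * (\<Sum>\<^sub>\<infinity>x. (b x - b' x)\<^sup>2))"
    proof (rule real_le_rsqrt)
      have "(expectation (\<lambda>\<omega>. \<bar>gamma_sum (\<lambda>x. b x - b' x) m \<omega>\<bar>))\<^sup>2 \<le> expectation (\<lambda>\<omega>. \<bar>gamma_sum (\<lambda>x. b x - b' x) m \<omega>\<bar>\<^sup>2)"
        using variance_positive[of "\<lambda>\<omega>. \<bar>gamma_sum (\<lambda>x. b x - b' x) m \<omega>\<bar>"] int gamma_sum_L2(1)
        by (subst (asm) variance_eq) (auto simp: power2_abs)
      also have "\<dots> = \<theta> * (\<Sum>x\<in>A m. (b x - b' x)\<^sup>2)" by (simp add: gamma_sum_L2)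
      also have "\<dots> \<le> \<theta> * (\<Sum>\<^sub>\<infinity>x. (b x - b' x)\<^sup>2)"
        using \<theta> sum_A_le_infsum[OF d] by simp
      finally show "(expectation (\<lambda>\<omega>. \<bar>gamma_sum (\<lambda>x. b x - b' x) m \<omega>\<bar>))\<^sup>2 \<le> \<dots>" .
    qed
    finally show ?thesis by (simp add: mult_left_mono)
  qed
  show ?thesis
    by (rule LIMSEQ_le_const2[OF tendsto_norm[OF tendsto_diff[OF lim[OF b] lim[OF b']]]]) (use le in auto)
qed

text \<open>Each factor is \<open>exp (\<theta> * (b x - ln (1 + b x)))\<close>, and \<open>b - ln (1 + b)\<close> is at most \<open>2 * b\<^sup>2\<close> for
  \<open>\<bar>b\<bar> \<le> 1/2\<close>. Fatou's lemma carries the bound from the partial sums to the series.\<close>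

lemma gamma_series_mgf_le:
  assumes b: "(\<lambda>x. (b x)\<^sup>2) summable_on UNIV" and half: "\<And>x. \<bar>b x\<bar> \<le> 1 / 2"
  shows "(\<integral>\<^sup>+\<omega>. ennreal (exp (gamma_series b \<omega>)) \<partial>M) \<le> ennreal (exp (2 * \<theta> * (\<Sum>\<^sub>\<infinity>x. (b x)\<^sup>2)))"
proof -
  have fin: "(\<integral>\<^sup>+\<omega>. ennreal (exp (gamma_sum b m \<omega>)) \<partial>M) \<le> ennreal (exp (2 * \<theta> * (\<Sum>\<^sub>\<infinity>x. (b x)\<^sup>2)))" for m
  proof -
    have "(\<integral>\<^sup>+\<omega>. ennreal (exp (gamma_sum b m \<omega>)) \<partial>M) = (\<integral>\<^sup>+\<omega>. (\<Prod>x\<in>A m. ennreal (exp ((\<theta> - G x \<omega>) * b x))) \<partial>M)"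
      by (simp add: gamma_sum_def exp_sum[OF A_finite] prod_ennreal)
    also have "\<dots> = (\<Prod>x\<in>A m. \<integral>\<^sup>+\<omega>. ennreal (exp ((\<theta> - G x \<omega>) * b x)) \<partial>M)"
    proof (rule indep_vars_nn_integral[OF A_finite])
      show "indep_vars (\<lambda>_. borel) (\<lambda>x \<omega>. ennreal (exp ((\<theta> - G x \<omega>) * b x))) (A m)"
        by (rule indep_vars_compose2[OF indep_vars_subset[OF indep], of _ "\<lambda>x t. ennreal (exp ((\<theta> - t) * b x))" "\<lambda>_. borel"]) auto
    qed simp
    also have "\<dots> \<le> (\<Prod>x\<in>A m. ennreal (exp (2 * \<theta> * (b x)\<^sup>2)))"
    proof (rule prod_mono_ennreal)
      fix x
      have bx: "b x > -1" "\<bar>b x\<bar> \<le> 1/2" using half[of x] by auto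
      have "(\<integral>\<^sup>+\<omega>. ennreal (exp ((\<theta> - G x \<omega>) * b x)) \<partial>M) = (\<integral>\<^sup>+\<omega>. ennreal (exp (\<theta> * b x)) * ennreal (exp (- b x * G x \<omega>)) \<partial>M)"
        by (intro nn_integral_cong) (simp add: ennreal_mult'[symmetric] exp_add[symmetric] algebra_simps)
      also have "\<dots> = ennreal (exp (\<theta> * b x)) * ennreal ((1 + b x) powr (-\<theta>))"
        using gamma_laplace[OF bx(1)] by (subst nn_integral_cmult) auto
      also have "\<dots> = ennreal (exp (\<theta> * (b x - ln (1 + b x))))"
        using bx by (simp add: ennreal_mult'[symmetric] powr_def exp_add[symmetric] algebra_simps)
      also have "\<dots> \<le> ennreal (exp (2 * \<theta> * (b x)\<^sup>2))"
      proof -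
        have "b x - ln (1 + b x) \<le> 2 * (b x)\<^sup>2"
          using abs_ln_one_plus_x_minus_x_bound[OF bx(2)] bx(2) by (auto simp: abs_if split: if_splits)
        hence "\<theta> * (b x - ln (1 + b x)) \<le> \<theta> * (2 * (b x)\<^sup>2)" using \<theta> by (intro mult_left_mono) auto
        thus ?thesis by (intro ennreal_leI) (simp add: mult_ac)
      qed
      finally show "(\<integral>\<^sup>+\<omega>. ennreal (exp ((\<theta> - G x \<omega>) * b x)) \<partial>M) \<le> \<dots>" .
    qed
    also have "\<dots> = ennreal (exp (2 * \<theta> * (\<Sum>x\<in>A m. (b x)\<^sup>2)))"
      by (simp add: prod_ennreal exp_sum[OF A_finite, symmetric] sum_distrib_left)
    also have "\<dots> \<le> ennreal (exp (2 * \<theta> * (\<Sum>\<^sub>\<infinity>x. (b x)\<^sup>2)))"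
      using sum_A_le_infsum[OF b] \<theta> by (intro ennreal_leI) simp
    finally show ?thesis .
  qed
  have "(\<integral>\<^sup>+\<omega>. ennreal (exp (gamma_series b \<omega>)) \<partial>M) = (\<integral>\<^sup>+\<omega>. liminf (\<lambda>m. ennreal (exp (gamma_sum b m \<omega>))) \<partial>M)"
  proof (rule nn_integral_cong_AE)
    show "AE \<omega> in M. ennreal (exp (gamma_series b \<omega>)) = liminf (\<lambda>m. ennreal (exp (gamma_sum b m \<omega>)))"
      using AE_gamma_sum_tendsto[OF b]
    proof eventually_elim
      case (elim \<omega>)
      have "(\<lambda>m. ennreal (exp (gamma_sum b m \<omega>))) \<longlonglongrightarrow> ennreal (exp (gamma_series b \<omega>))"
        using elim by (intro tendsto_ennrealI tendsto_intros)
      thus ?case by (intro lim_imp_Liminf[symmetric]) auto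
    qed
  qed
  also have "\<dots> \<le> liminf (\<lambda>m. \<integral>\<^sup>+\<omega>. ennreal (exp (gamma_sum b m \<omega>)) \<partial>M)"
    by (rule nn_integral_liminf) measurable
  also have "\<dots> \<le> liminf (\<lambda>m::nat. ennreal (exp (2 * \<theta> * (\<Sum>\<^sub>\<infinity>x. (b x)\<^sup>2))))"
    by (intro Liminf_mono always_eventually allI fin)
  finally show ?thesis by (simp add: Liminf_const)
qed

text \<open>For nonnegative summable \<open>a\<close> this is the sum of the \<open>a x * G x\<close>, written through its centred version so that convergence comes from square
  summability. The truncation at \<open>0\<close> changes it on a null set only and makes it nonnegative everywhere, as a
  Poisson mean has to be.\<close>

definition gamma_total :: "('i \<Rightarrow> real) \<Rightarrow> 'a \<Rightarrow> real" where
  "gamma_total a \<omega> = max 0 (\<theta> * (\<Sum>\<^sub>\<infinity>x. a x) - gamma_series a \<omega>)"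

lemma gamma_total_measurable[measurable]: "gamma_total a \<in> borel_measurable M"
  unfolding gamma_total_def by measurable

lemma gamma_total_nonneg: "0 \<le> gamma_total a \<omega>" by (simp add: gamma_total_def)

lemma AE_gamma_total:
  assumes a: "\<And>x. 0 \<le> a x" "a summable_on UNIV" "(\<lambda>x. (a x)\<^sup>2) summable_on UNIV"
  shows "AE \<omega> in M. gamma_total a \<omega> = \<theta> * (\<Sum>\<^sub>\<infinity>x. a x) - gamma_series a \<omega> \<and>
    (\<lambda>m. \<Sum>x\<in>A m. a x * G x \<omega>) \<longlonglongrightarrow> gamma_total a \<omega>"
proof -
  have "AE \<omega> in M. \<forall>m. \<forall>x\<in>A m. 0 \<le> G x \<omega>"
    unfolding AE_all_countable by (intro allI AE_finite_allI A_finite AE_G_nonneg)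
  with AE_gamma_sum_tendsto[OF a(3)] show ?thesis
  proof eventually_elim
    case (elim \<omega>)
    have "(\<lambda>m. \<theta> * (\<Sum>x\<in>A m. a x) - gamma_sum a m \<omega>) \<longlonglongrightarrow> \<theta> * (\<Sum>\<^sub>\<infinity>x. a x) - gamma_series a \<omega>"
      by (intro tendsto_intros sum_A_tendsto_infsum a elim)
    also have "(\<lambda>m. \<theta> * (\<Sum>x\<in>A m. a x) - gamma_sum a m \<omega>) = (\<lambda>m. \<Sum>x\<in>A m. a x * G x \<omega>)"
      by (simp add: gamma_sum_def sum_distrib_left sum_subtractf[symmetric] algebra_simps)
    finally have l: "(\<lambda>m. \<Sum>x\<in>A m. a x * G x \<omega>) \<longlonglongrightarrow> \<theta> * (\<Sum>\<^sub>\<infinity>x. a x) - gamma_series a \<omega>" .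
    hence "0 \<le> \<theta> * (\<Sum>\<^sub>\<infinity>x. a x) - gamma_series a \<omega>"
      by (rule LIMSEQ_le_const) (use elim a in \<open>auto intro!: sum_nonneg\<close>)
    thus ?case using l by (simp add: gamma_total_def)
  qed
qed

lemma gamma_total_laplace:
  assumes a: "\<And>x. 0 \<le> a x" "a summable_on UNIV" "(\<lambda>x. (a x)\<^sup>2) summable_on UNIV" and u: "u \<ge> 0"
  shows "(\<lambda>m. ennreal (\<Prod>x\<in>A m. (1 + u * a x) powr (- \<theta>))) \<longlonglongrightarrow> (\<integral>\<^sup>+\<omega>. ennreal (exp (- u * gamma_total a \<omega>)) \<partial>M)"
proof -
  have eq: "ennreal (\<Prod>x\<in>A m. (1 + u * a x) powr (- \<theta>)) = (\<integral>\<^sup>+\<omega>. ennreal (exp (- u * (\<Sum>x\<in>A m. a x * G x \<omega>))) \<partial>M)" for m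
  proof -
    have "(\<integral>\<^sup>+\<omega>. ennreal (exp (- u * (\<Sum>x\<in>A m. a x * G x \<omega>))) \<partial>M) = (\<integral>\<^sup>+\<omega>. (\<Prod>x\<in>A m. ennreal (exp (- (u * a x) * G x \<omega>))) \<partial>M)"
      by (simp add: exp_sum[OF A_finite, symmetric] prod_ennreal sum_distrib_left sum_negf[symmetric] mult.assoc)
    also have "\<dots> = (\<Prod>x\<in>A m. \<integral>\<^sup>+\<omega>. ennreal (exp (- (u * a x) * G x \<omega>)) \<partial>M)"
    proof (rule indep_vars_nn_integral[OF A_finite])
      show "indep_vars (\<lambda>_. borel) (\<lambda>x \<omega>. ennreal (exp (- (u * a x) * G x \<omega>))) (A m)"
        by (rule indep_vars_compose2[OF indep_vars_subset[OF indep], of _ "\<lambda>x t. ennreal (exp (- (u * a x) * t))" "\<lambda>_. borel"]) auto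
    qed simp
    also have "\<dots> = (\<Prod>x\<in>A m. ennreal ((1 + u * a x) powr (- \<theta>)))"
    proof (intro prod.cong refl gamma_laplace)
      show "- 1 < u * a x" for x using mult_nonneg_nonneg[OF u a(1)[of x]] by linarith
    qed
    finally show ?thesis by (simp add: prod_ennreal)
  qed
  show ?thesis unfolding eq
  proof (rule nn_integral_dominated_convergence[where w="\<lambda>_. 1"])
    have "AE \<omega> in M. \<forall>m. \<forall>x\<in>A m. 0 \<le> G x \<omega>"
      unfolding AE_all_countable by (intro allI AE_finite_allI A_finite AE_G_nonneg)
    thus "AE \<omega> in M. ennreal (exp (- u * (\<Sum>x\<in>A m. a x * G x \<omega>))) \<le> 1" for m
    proof eventually_elim
      case (elim \<omega>)
      have "0 \<le> u * (\<Sum>x\<in>A m. a x * G x \<omega>)" using elim u a by (intro mult_nonneg_nonneg sum_nonneg) auto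
      thus ?case by (simp add: ennreal_le_1)
    qed
    show "AE \<omega> in M. (\<lambda>m. ennreal (exp (- u * (\<Sum>x\<in>A m. a x * G x \<omega>)))) \<longlonglongrightarrow> ennreal (exp (- u * gamma_total a \<omega>))"
      using AE_gamma_total[OF a]
    proof eventually_elim
      case (elim \<omega>)
      show ?case by (intro tendsto_ennrealI tendsto_intros) (use elim in blast)
    qed
  qed (auto simp: emeasure_space_1)
qed

lemma gamma_total_mean_le:
  assumes a: "\<And>x. 0 \<le> a x" "a summable_on UNIV" "(\<lambda>x. (a x)\<^sup>2) summable_on UNIV"
  shows "(\<integral>\<^sup>+\<omega>. ennreal (gamma_total a \<omega>) \<partial>M) \<le> ennreal (\<theta> * (\<Sum>\<^sub>\<infinity>x. a x))"
proof -
  have fin: "(\<integral>\<^sup>+\<omega>. ennreal (\<Sum>x\<in>A m. a x * G x \<omega>) \<partial>M) \<le> ennreal (\<theta> * (\<Sum>\<^sub>\<infinity>x. a x))" for m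
  proof -
    have pos: "AE \<omega> in M. \<forall>x\<in>A m. 0 \<le> G x \<omega>" by (intro AE_finite_allI A_finite AE_G_nonneg)
    have int: "integrable M (\<lambda>\<omega>. \<Sum>x\<in>A m. a x * G x \<omega>)"
      by (intro Bochner_Integration.integrable_sum integrable_mult_right integrable_G)
    have "(\<integral>\<^sup>+\<omega>. ennreal (\<Sum>x\<in>A m. a x * G x \<omega>) \<partial>M) = ennreal (expectation (\<lambda>\<omega>. \<Sum>x\<in>A m. a x * G x \<omega>))"
    proof (rule nn_integral_eq_integral[OF int])
      show "AE \<omega> in M. 0 \<le> (\<Sum>x\<in>A m. a x * G x \<omega>)" using pos by eventually_elim (auto intro!: sum_nonneg mult_nonneg_nonneg a)
    qed
    also have "expectation (\<lambda>\<omega>. \<Sum>x\<in>A m. a x * G x \<omega>) = \<theta> * (\<Sum>x\<in>A m. a x)"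
      by (simp add: Bochner_Integration.integral_sum integrable_G expectation_G sum_distrib_left mult.commute)
    also have "ennreal \<dots> \<le> ennreal (\<theta> * (\<Sum>\<^sub>\<infinity>x. a x))"
      using sum_A_le_infsum[OF a(2,1)] \<theta> by (intro ennreal_leI) simp
    finally show ?thesis .
  qed
  have "(\<integral>\<^sup>+\<omega>. ennreal (gamma_total a \<omega>) \<partial>M) = (\<integral>\<^sup>+\<omega>. liminf (\<lambda>m. ennreal (\<Sum>x\<in>A m. a x * G x \<omega>)) \<partial>M)"
  proof (rule nn_integral_cong_AE)
    show "AE \<omega> in M. ennreal (gamma_total a \<omega>) = liminf (\<lambda>m. ennreal (\<Sum>x\<in>A m. a x * G x \<omega>))"
      using AE_gamma_total[OF a]
    proof eventually_elim
      case (elim \<omega>)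
      have "(\<lambda>m. ennreal (\<Sum>x\<in>A m. a x * G x \<omega>)) \<longlonglongrightarrow> ennreal (gamma_total a \<omega>)"
        using elim by (intro tendsto_ennrealI) blast
      thus ?case by (intro lim_imp_Liminf[symmetric]) auto
    qed
  qed
  also have "\<dots> \<le> liminf (\<lambda>m. \<integral>\<^sup>+\<omega>. ennreal (\<Sum>x\<in>A m. a x * G x \<omega>) \<partial>M)"
    by (rule nn_integral_liminf) measurable
  also have "\<dots> \<le> liminf (\<lambda>m::nat. ennreal (\<theta> * (\<Sum>\<^sub>\<infinity>x. a x)))"
    by (intro Liminf_mono always_eventually allI fin)
  finally show ?thesis by (simp add: Liminf_const)
qed

end

section \<open>Lattice sums and integrals\<close>

text \<open>The definitions of the model use unordered real sums, whereas interchanging sums and integrals is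
  easiest for nonnegative extended integrals over counting measures. The next two lemmas translate between them.\<close>

lemma has_sum_of_nn_integral:
  fixes f :: "'i \<Rightarrow> real"
  assumes f: "\<And>x. x \<in> S \<Longrightarrow> 0 \<le> f x" and r: "0 \<le> r" and eq: "(\<integral>\<^sup>+x. ennreal (f x) \<partial>count_space S) = ennreal r"
  shows "(f has_sum r) S"
proof -
  have i: "has_bochner_integral (count_space S) f r"
    apply (rule has_bochner_integral_nn_integral)
       apply simp
      apply (simp add: AE_count_space f)
     apply (rule r)
    apply (rule eq)
    done
  have s: "Infinite_Set_Sum.abs_summable_on f S" and fr: "infsetsum f S = r"
    using i unfolding Infinite_Set_Sum.abs_summable_on_def infsetsum_def by (simp_all add: has_bochner_integral_iff)
  have "infsum f S = r" using infsetsum_infsum[OF s] fr by simp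
  moreover have "f summable_on S"
    by (rule abs_summable_summable) (rule s[folded abs_summable_equivalent])
  ultimately show ?thesis by (metis has_sum_infsum)
qed

lemma nn_integral_of_has_sum:
  fixes f :: "'i \<Rightarrow> real"
  assumes f: "\<And>x. x \<in> S \<Longrightarrow> 0 \<le> f x" and s: "(f has_sum r) S"
  shows "(\<integral>\<^sup>+x. ennreal (f x) \<partial>count_space S) = ennreal r"
proof -
  have r: "r \<ge> 0" using has_sum_nonneg[OF s] f by blast
  have "f summable_on S" using s by (auto simp: summable_on_def)
  moreover have "(\<lambda>x. norm (f x)) summable_on S \<longleftrightarrow> f summable_on S"
    by (rule summable_on_cong) (use f in auto)
  ultimately have "Infinite_Set_Sum.abs_summable_on f S"
    using abs_summable_equivalent[THEN iffD1] by metis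
  hence i: "integrable (count_space S) f" by (simp add: Infinite_Set_Sum.abs_summable_on_def)
  have "(\<integral>\<^sup>+x. ennreal (f x) \<partial>count_space S) = ennreal (LINT x|count_space S. f x)"
    by (rule nn_integral_eq_integral[OF i]) (use f in \<open>auto simp: AE_count_space\<close>)
  also have "(LINT x|count_space S. f x) = infsum f S"
    using infsetsum_infsum[of f S] \<open>Infinite_Set_Sum.abs_summable_on f S\<close> by (simp add: infsetsum_def)
  finally show ?thesis using s by (simp add: infsumI)
qed

text \<open>An integrable majorant for \<open>1 / (exp (c * u powr p) - 1)\<close>: the first power is the singularity at the origin, and
  the second one, which is all that remains of the exponential decay, suffices at infinity since \<open>2 * p\<close>
  exceeds the dimension. At distances \<open>u \<ge> 1\<close>, hence at all nonzero lattice points, it equals \<open>u powr (- (2 * p))\<close>, so that the same integral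
  also controls the square sum of \<open>norm x powr (- p)\<close>.\<close>

definition decay :: "real \<Rightarrow> real \<Rightarrow> real" where
  "decay p u = min (u powr (- p)) (u powr (- (2 * p)))"

lemma decay_nonneg: "0 \<le> decay p u" by (simp add: decay_def)

lemma decay_measurable[measurable]: "decay p \<in> borel_measurable borel"
  unfolding decay_def by measurable

lemma decay_antimono: "0 < p \<Longrightarrow> 0 < u \<Longrightarrow> u \<le> v \<Longrightarrow> decay p v \<le> decay p u"
  unfolding decay_def by (intro min.mono powr_mono2') auto

lemma decay_scale:
  assumes "0 < p" "1 \<le> K" "0 < u"
  shows "decay p (u / K) \<le> K powr (2 * p) * decay p u"
proof -
  have q: "(u / K) powr (- q) = K powr q * u powr (- q)" for q
    using assms by (subst powr_divide) (simp_all add: powr_minus[of K] divide_inverse mult.commute)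
  have "(u / K) powr (- p) = K powr p * u powr (- p)"
    by (rule q)
  also have "\<dots> \<le> K powr (2 * p) * u powr (- p)"
    using assms by (intro mult_right_mono powr_mono) auto
  finally have 1: "(u / K) powr (- p) \<le> K powr (2 * p) * u powr (- p)" .
  have 2: "(u / K) powr (- (2 * p)) = K powr (2 * p) * u powr (- (2 * p))"
    by (rule q)
  show ?thesis unfolding decay_def using 1 2 by (simp add: min_mult_distrib_left)
qed

lemma decay_powr:
  assumes "0 < u" "0 < r"
  shows "decay p u powr r = decay (p * r) u"
proof -
  have m: "min a b powr r = min (a powr r) (b powr r)" if "0 \<le> a" "0 \<le> b" for a b :: real
    using that assms by (cases "a \<le> b") (simp_all add: min_absorb1 min_absorb2 powr_mono2)
  show ?thesis unfolding decay_def by (subst m) (auto simp: powr_powr mult_ac)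
qed

text \<open>The value at \<open>0\<close> is set to \<open>\<infinity>\<close>, which makes the function decreasing in \<open>\<bar>t\<bar>\<close> without exception,
  as needed in the product bound below.\<close>

lemma nn_integral_decay_line:
  assumes "0 < p" "p < 1" "1 < 2 * p"
  shows "(\<integral>\<^sup>+t. (if t = 0 then \<infinity> else ennreal (decay p \<bar>t\<bar>)) \<partial>(lborel :: real measure)) < \<infinity>"
proof -
  define k where "k t = ennreal (indicator {0..1} t * t powr (- p)) + ennreal (indicator {1..} t * t powr (- (2 * p)))" for t :: real
  have [measurable]: "k \<in> borel_measurable borel" unfolding k_def by measurable
  have "(\<integral>\<^sup>+t. ennreal (indicator {0..1} t * t powr (- p)) \<partial>lborel) = ennreal (1 powr (- p + 1) / (- p + 1))"
    by (rule nn_integral_has_integral_lebesgue[OF _ has_integral_powr_from_0]) (use assms in auto)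
  moreover have "(\<integral>\<^sup>+t. ennreal (indicator {1..} t * t powr (- (2 * p))) \<partial>lborel) = ennreal (- (1 powr (- (2 * p) + 1)) / (- (2 * p) + 1))"
    by (rule nn_integral_has_integral_lebesgue[OF _ has_integral_powr_to_inf]) (use assms in auto)
  ultimately have kfin: "(\<integral>\<^sup>+t. k t \<partial>lborel) < \<infinity>"
    unfolding k_def by (subst nn_integral_add) auto
  have kk: "(\<integral>\<^sup>+t. k (- t) \<partial>lborel) = (\<integral>\<^sup>+t. k t \<partial>lborel)"
    using nn_integral_real_affine[of k "-1" 0] by simp
  have "(\<integral>\<^sup>+t. (if t = 0 then \<infinity> else ennreal (decay p \<bar>t\<bar>)) \<partial>(lborel :: real measure)) \<le> (\<integral>\<^sup>+t. k t + k (- t) \<partial>(lborel :: real measure))"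
  proof (rule nn_integral_mono_AE, rule AE_mp[OF AE_lborel_singleton[of 0]], intro AE_I2 impI)
    fix t :: real assume t: "t \<noteq> 0"
    have pos: "ennreal (decay p s) \<le> k s" if "s > 0" for s
    proof -
      have "decay p s \<le> indicator {0..1} s * s powr (- p) + indicator {1..} s * s powr (- (2 * p))"
        using that by (cases "s \<le> 1") (auto simp: decay_def indicator_def)
      thus ?thesis unfolding k_def by (simp add: ennreal_plus[symmetric] ennreal_leI del: ennreal_plus)
    qed
    show "(if t = 0 then \<infinity> else ennreal (decay p \<bar>t\<bar>)) \<le> k t + k (- t)"
    proof (cases "t > 0")
      case True
      thus ?thesis using pos[of t] by (simp add: add_increasing2)
    next
      case False
      thus ?thesis using pos[of "- t"] t by (simp add: add_increasing)
    qed
  qed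
  also have "\<dots> = (\<integral>\<^sup>+t. k t \<partial>lborel) + (\<integral>\<^sup>+t. k (- t) \<partial>lborel)"
    by (rule nn_integral_add) measurable
  also have "\<dots> < \<infinity>" using kfin kk by simp
  finally show ?thesis .
qed

text \<open>Since \<open>decay\<close> is decreasing and \<open>norm y\<close> dominates every coordinate, \<open>decay \<delta> (norm y)\<close> is at most the product
  over the \<open>d\<close> coordinates of \<open>decay (\<delta> / d) \<bar>y \<bullet> b\<bar>\<close>. The integral therefore factorises into integrals over the line,
  with an exponent \<open>\<delta> / d\<close> between \<open>1/2\<close> and \<open>1\<close>.\<close>

lemma nn_integral_decay_norm:
  assumes "real CARD('d) / 2 < \<delta>" "\<delta> < real CARD('d::finite)"
  shows "(\<integral>\<^sup>+y. ennreal (decay \<delta> (norm y)) \<partial>(lborel :: (real^'d) measure)) < \<infinity>"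
proof -
  define d where "d = real CARD('d)"
  have d: "d > 0" unfolding d_def by simp
  define p where "p = \<delta> * (1 / d)"
  have p: "0 < p" "p < 1" "1 < 2 * p" using assms d by (auto simp: p_def d_def[symmetric] field_simps)
  define f where "f t = (if t = 0 then \<infinity> else ennreal (decay p \<bar>t\<bar>))" for t :: real
  have [measurable]: "f \<in> borel_measurable borel" unfolding f_def by measurable
  have "(\<integral>\<^sup>+y. ennreal (decay \<delta> (norm y)) \<partial>(lborel :: (real^'d) measure)) \<le> (\<integral>\<^sup>+y. (\<Prod>b\<in>Basis. f (y \<bullet> b)) \<partial>(lborel :: (real^'d) measure))"
  proof (rule nn_integral_mono)
    fix y :: "real^'d"
    show "ennreal (decay \<delta> (norm y)) \<le> (\<Prod>b\<in>Basis. f (y \<bullet> b))"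
    proof (cases "y = 0")
      case True thus ?thesis by (simp add: decay_def)
    next
      case False
      have "decay \<delta> (norm y) = decay p (norm y) ^ DIM(real^'d)"
      proof -
        have "decay p (norm y) = decay \<delta> (norm y) powr (1 / d)"
          using False d by (simp add: decay_powr p_def)
        moreover have "(decay \<delta> (norm y) powr (1 / d)) ^ DIM(real^'d) = decay \<delta> (norm y)"
          using False d unfolding d_def
          by (subst powr_realpow[symmetric]) (auto simp: decay_def powr_powr min_def)
        ultimately show ?thesis by simp
      qed
      hence "ennreal (decay \<delta> (norm y)) = (\<Prod>b\<in>(Basis::(real^'d) set). ennreal (decay p (norm y)))"
        by (simp add: ennreal_power decay_nonneg)
      also have "\<dots> \<le> (\<Prod>b\<in>Basis. f (y \<bullet> b))"
      proof (rule prod_mono_ennreal)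
        fix b :: "real^'d" assume b: "b \<in> Basis"
        show "ennreal (decay p (norm y)) \<le> f (y \<bullet> b)"
          unfolding f_def using Basis_le_norm[OF b, of y] decay_antimono[OF p(1), of "\<bar>y \<bullet> b\<bar>" "norm y"]
          by (auto intro!: ennreal_leI)
      qed
      finally show ?thesis .
    qed
  qed
  also have "\<dots> = (\<Prod>b\<in>(Basis::(real^'d) set). \<integral>\<^sup>+t. f t \<partial>lborel)"
    by (rule nn_integral_lborel_prod) auto
  also have "\<dots> < \<infinity>"
    using nn_integral_decay_line[OF p] by (simp add: f_def[symmetric] power_less_top_ennreal)
  finally show ?thesis .
qed

definition cell :: "real ^ 'd \<Rightarrow> int ^ 'd" where "cell y = (\<chi> i. \<lfloor>y $ i\<rfloor>)"

lemma cell_eq_iff: "cell y = x \<longleftrightarrow> (\<forall>i. of_int (x $ i) \<le> y $ i \<and> y $ i < of_int (x $ i) + 1)"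
  by (auto simp: cell_def vec_eq_iff floor_eq_iff)

lemma cell_measurable[measurable]: "(\<lambda>y. cell (L *\<^sub>R y)) \<in> measurable borel (count_space (UNIV :: (int ^ 'd) set))"
proof (rule measurable_count_space_eq_countable[THEN iffD2], safe)
  show "(\<lambda>y. cell (L *\<^sub>R y)) -` {x} \<inter> space borel \<in> sets (borel :: (real^'d) measure)" for x
  proof -
    have [measurable]: "(\<lambda>y. y $ i) \<in> borel_measurable (borel :: (real^'d) measure)" for i
      by (intro borel_measurable_continuous_onI continuous_intros)
    have "{y\<in>space (borel :: (real^'d) measure). \<forall>i. of_int (x $ i) \<le> L * y $ i \<and> L * y $ i < of_int (x $ i) + 1} \<in> sets borel"
      by measurable
    thus ?thesis by (simp add: cell_eq_iff vimage_def)
  qed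
qed auto

lemma emeasure_cell:
  fixes x :: "int ^ 'd"
  assumes "L > 0"
  shows "emeasure lborel {y::real^'d. cell (L *\<^sub>R y) = x} = ennreal (1 / L ^ CARD('d))"
proof (rule antisym)
  define l :: "real^'d" where "l = (\<chi> i. of_int (x $ i) / L)"
  define u :: "real^'d" where "u = (\<chi> i. (of_int (x $ i) + 1) / L)"
  have lu: "u - l = (\<chi> i. 1 / L)" unfolding l_def u_def by (simp add: vec_eq_iff diff_divide_distrib[symmetric])
  have b: "(u - l) \<bullet> b = 1 / L" if "b \<in> Basis" for b :: "real^'d"
    using that unfolding lu by (auto simp: Basis_vec_def inner_axis)
  hence b': "l \<bullet> b \<le> u \<bullet> b" if "b \<in> Basis" for b :: "real^'d"
  proof -
    have "u \<bullet> b - l \<bullet> b = 1 / L" using b[OF that] by (simp add: inner_diff_left)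
    moreover have "0 < 1 / L" using assms by simp
    ultimately show ?thesis by linarith
  qed
  have [measurable]: "{y::real^'d. cell (L *\<^sub>R y) = x} \<in> sets borel"
    using measurable_sets[OF cell_measurable[of L], of "{x}"] by (simp add: vimage_def)
  have le: "l $ i \<le> y $ i \<longleftrightarrow> of_int (x $ i) \<le> L * y $ i" "l $ i < y $ i \<longleftrightarrow> of_int (x $ i) < L * y $ i"
    "y $ i \<le> u $ i \<longleftrightarrow> L * y $ i \<le> of_int (x $ i) + 1" "y $ i < u $ i \<longleftrightarrow> L * y $ i < of_int (x $ i) + 1" for y i
    using assms by (simp_all add: l_def u_def pos_divide_le_eq pos_le_divide_eq pos_divide_less_eq pos_less_divide_eq mult.commute)
  have p: "(\<Prod>b\<in>(Basis::(real^'d) set). (u - l) \<bullet> b) = 1 / L ^ CARD('d)" by (simp add: b power_one_over)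
  have "emeasure lborel {y::real^'d. cell (L *\<^sub>R y) = x} \<le> emeasure lborel (cbox l u)"
    by (intro emeasure_mono) (auto simp: cell_eq_iff mem_box_cart le less_imp_le)
  thus "emeasure lborel {y::real^'d. cell (L *\<^sub>R y) = x} \<le> ennreal (1 / L ^ CARD('d))"
    using b' p by simp
  have "emeasure lborel (box l u) \<le> emeasure lborel {y::real^'d. cell (L *\<^sub>R y) = x}"
    by (intro emeasure_mono) (auto simp: cell_eq_iff mem_box_cart le less_imp_le)
  thus "ennreal (1 / L ^ CARD('d)) \<le> emeasure lborel {y::real^'d. cell (L *\<^sub>R y) = x}"
    using b' p by simp
qed

text \<open>The preimages of the lattice points are half-open cubes of side \<open>1 / L\<close>, so a lattice sum is the integral of a
  step function.\<close>

lemma nn_integral_cell: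
  fixes F :: "int ^ 'd \<Rightarrow> ennreal"
  assumes "L > 0"
  shows "(\<integral>\<^sup>+y. F (cell (L *\<^sub>R y)) \<partial>(lborel :: (real^'d) measure)) = ennreal (1 / L ^ CARD('d)) * (\<integral>\<^sup>+x. F x \<partial>count_space UNIV)"
proof -
  have [measurable]: "{y::real^'d. cell (L *\<^sub>R y) = x} \<in> sets borel" for x
    using measurable_sets[OF cell_measurable[of L], of "{x}"] by (simp add: vimage_def)
  have "(\<integral>\<^sup>+y. F (cell (L *\<^sub>R y)) \<partial>(lborel :: (real^'d) measure)) = (\<integral>\<^sup>+y. (\<integral>\<^sup>+x. F x * indicator {y. cell (L *\<^sub>R y) = x} y \<partial>count_space UNIV) \<partial>(lborel :: (real^'d) measure))"
  proof (rule nn_integral_cong)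
    fix y :: "real^'d"
    have "(\<integral>\<^sup>+x. F x * indicator {y. cell (L *\<^sub>R y) = x} y \<partial>count_space UNIV) = (\<Sum>x\<in>{cell (L *\<^sub>R y)}. F x * indicator {y. cell (L *\<^sub>R y) = x} y)"
      by (rule nn_integral_count_space') auto
    thus "F (cell (L *\<^sub>R y)) = (\<integral>\<^sup>+x. F x * indicator {y. cell (L *\<^sub>R y) = x} y \<partial>count_space UNIV)" by simp
  qed
  also have "\<dots> = (\<integral>\<^sup>+x. (\<integral>\<^sup>+y. F x * indicator {y. cell (L *\<^sub>R y) = x} y \<partial>(lborel :: (real^'d) measure)) \<partial>count_space UNIV)"
    by (rule nn_integral_count_space_nn_integral) auto
  also have "\<dots> = (\<integral>\<^sup>+x. F x * ennreal (1 / L ^ CARD('d)) \<partial>count_space UNIV)"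
    by (intro nn_integral_cong) (simp add: nn_integral_cmult_indicator emeasure_cell[OF assms])
  finally show ?thesis by (simp add: nn_integral_multc mult.commute)
qed

lemma lattice_point_0_iff: "lattice_point x = 0 \<longleftrightarrow> x = 0"
  by (simp add: lattice_point_def vec_eq_iff)

lemma norm_lattice_point_ge_1:
  assumes "x \<noteq> 0" shows "1 \<le> norm (lattice_point x)"
proof -
  obtain i where "x $ i \<noteq> 0" using assms by (auto simp: vec_eq_iff)
  hence "1 \<le> \<bar>lattice_point x $ i\<bar>" by (simp add: lattice_point_def)
  also have "\<dots> \<le> norm (lattice_point x)" by (rule component_le_norm_cart)
  finally show ?thesis .
qed

text \<open>Rounding moves a coordinate by less than \<open>1\<close>, and a nonzero lattice point has norm at least \<open>1\<close>; so rounding to a nonzero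
  point shrinks the norm by a bounded factor only. This yields majorants for the step functions.\<close>

lemma norm_cell_ge:
  fixes y :: "real ^ 'd"
  assumes "cell y \<noteq> 0"
  shows "norm y / (2 * real CARD('d)) \<le> norm (lattice_point (cell y))"
proof -
  have "norm y \<le> (\<Sum>i\<in>UNIV. \<bar>y $ i\<bar>)" by (rule norm_le_l1_cart)
  also have "\<dots> \<le> (\<Sum>i\<in>(UNIV::'d set). 2 * norm (lattice_point (cell y)))"
  proof (rule sum_mono)
    fix i
    have "\<bar>y $ i\<bar> \<le> \<bar>lattice_point (cell y) $ i\<bar> + 1" unfolding lattice_point_def cell_def by simp linarith
    also have "\<bar>lattice_point (cell y) $ i\<bar> \<le> norm (lattice_point (cell y))" by (rule component_le_norm_cart)
    finally show "\<bar>y $ i\<bar> \<le> 2 * norm (lattice_point (cell y))"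
      using norm_lattice_point_ge_1[OF assms] by simp
  qed
  finally show ?thesis by (simp add: field_simps)
qed

lemma norm_cell_diff_le: "norm (lattice_point (cell y) - y) \<le> real CARD('d)" for y :: "real ^ 'd"
proof -
  have "norm (lattice_point (cell y) - y) \<le> (\<Sum>i\<in>UNIV. \<bar>(lattice_point (cell y) - y) $ i\<bar>)" by (rule norm_le_l1_cart)
  also have "\<dots> \<le> (\<Sum>i\<in>(UNIV::'d set). 1)"
    by (rule sum_mono) (simp add: lattice_point_def cell_def, linarith)
  finally show ?thesis by simp
qed

lemma decay_cell_le:
  fixes y :: "real ^ 'd"
  assumes "L > 0" "\<delta> > 0" "cell (L *\<^sub>R y) \<noteq> 0"
  shows "decay \<delta> (norm (lattice_point (cell (L *\<^sub>R y))) / L) \<le> (2 * real CARD('d)) powr (2 * \<delta>) * decay \<delta> (norm y)"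
proof -
  have c0: "cell (0 :: real^'d) = 0" by (simp add: cell_def vec_eq_iff)
  have K: "1 \<le> 2 * real CARD('d)" using zero_less_card_finite[where 'a='d] by linarith
  have y: "y \<noteq> 0" using assms c0 by auto
  have "norm y / (2 * real CARD('d)) \<le> norm (lattice_point (cell (L *\<^sub>R y))) / L"
    using norm_cell_ge[OF assms(3)] assms(1) by (simp add: field_simps)
  hence "decay \<delta> (norm (lattice_point (cell (L *\<^sub>R y))) / L) \<le> decay \<delta> (norm y / (2 * real CARD('d)))"
    using y K by (intro decay_antimono assms) auto
  also have "\<dots> \<le> (2 * real CARD('d)) powr (2 * \<delta>) * decay \<delta> (norm y)"
    using y K by (intro decay_scale assms) auto
  finally show ?thesis .
qed

lemma nn_integral_decay_lattice:
  assumes "L > 0" "real CARD('d) / 2 < \<delta>" "\<delta> < real CARD('d)"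
  shows "(\<integral>\<^sup>+x. (if x = 0 then 0 else ennreal (decay \<delta> (norm (lattice_point (x :: int^'d)) / L))) \<partial>count_space UNIV) < \<infinity>" (is "?I < _")
proof -
  have "0 \<le> real CARD('d) / 2" by simp
  hence \<delta>: "\<delta> > 0" using assms(2) by linarith
  have "ennreal (1 / L ^ CARD('d)) * ?I = (\<integral>\<^sup>+y. (if cell (L *\<^sub>R y) = 0 then 0 else ennreal (decay \<delta> (norm (lattice_point (cell (L *\<^sub>R y))) / L))) \<partial>(lborel :: (real^'d) measure))"
    by (rule nn_integral_cell[OF assms(1), symmetric])
  also have "\<dots> \<le> (\<integral>\<^sup>+y. ennreal ((2 * real CARD('d)) powr (2 * \<delta>)) * ennreal (decay \<delta> (norm y)) \<partial>(lborel :: (real^'d) measure))"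
    by (intro nn_integral_mono) (auto simp: ennreal_mult'[symmetric] decay_nonneg intro!: ennreal_leI decay_cell_le assms \<delta>)
  also have "\<dots> = ennreal ((2 * real CARD('d)) powr (2 * \<delta>)) * (\<integral>\<^sup>+y. ennreal (decay \<delta> (norm y)) \<partial>(lborel :: (real^'d) measure))"
    by (rule nn_integral_cmult) measurable
  also have "\<dots> < \<infinity>" using nn_integral_decay_norm[OF assms(2,3)] by (simp add: ennreal_mult_less_top)
  finally show ?thesis using assms(1) by (auto simp: ennreal_mult_less_top)
qed

lemma summable_inverse_square_weights:
  assumes "real CARD('d) / 2 < \<delta>" "\<delta> < real CARD('d)"
  shows "(\<lambda>x::int^'d. (if x = 0 then 0 else norm (lattice_point x) powr (- \<delta>))\<^sup>2) summable_on UNIV"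
proof -
  define f where "f x = (if x = 0 then 0 else norm (lattice_point x) powr (- \<delta>))\<^sup>2" for x :: "int^'d"
  have "0 \<le> real CARD('d) / 2" by simp
  hence \<delta>: "\<delta> > 0" using assms(1) by linarith
  have "(\<integral>\<^sup>+x. ennreal (f x) \<partial>count_space UNIV) = (\<integral>\<^sup>+x. (if x = 0 then 0 else ennreal (decay \<delta> (norm (lattice_point (x :: int^'d)) / 1))) \<partial>count_space UNIV)"
  proof (rule nn_integral_cong)
    fix x :: "int^'d"
    have "decay \<delta> (norm (lattice_point x)) = norm (lattice_point x) powr (- \<delta> * 2)" if "x \<noteq> 0"
      using norm_lattice_point_ge_1[OF that] \<delta> unfolding decay_def
      by (subst min_absorb2) (auto intro!: powr_mono simp: mult.commute)
    thus "ennreal (f x) = (if x = 0 then 0 else ennreal (decay \<delta> (norm (lattice_point x) / 1)))"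
      by (simp add: f_def power2_eq_square powr_add[symmetric] mult.commute)
  qed
  also have "\<dots> < \<infinity>" by (rule nn_integral_decay_lattice) (use assms in auto)
  finally obtain r where "0 \<le> r" "(\<integral>\<^sup>+x. ennreal (f x) \<partial>count_space UNIV) = ennreal r"
    by (cases "\<integral>\<^sup>+x. ennreal (f x) \<partial>count_space UNIV" rule: ennreal_cases) auto
  hence "(f has_sum r) UNIV" by (intro has_sum_of_nn_integral) (auto simp: f_def)
  thus ?thesis by (auto simp: f_def[abs_def] summable_on_def)
qed

section \<open>Critical densities\<close>

text \<open>The Bose-Einstein mean occupation at energy \<open>c * u powr p\<close>. The singularity at \<open>u = 0\<close> is replaced by
  \<open>0\<close>, so that sums over all sites leave out the origin.\<close>

definition bose :: "real \<Rightarrow> real \<Rightarrow> real \<Rightarrow> real" where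
  "bose c p u = (if u = 0 then 0 else 1 / (exp (c * u powr p) - 1))"

lemma bose_measurable[measurable]: "bose c p \<in> borel_measurable borel"
  unfolding bose_def by measurable

lemma bose_nonneg:
  assumes "c > 0" shows "0 \<le> bose c p u"
  using assms unfolding bose_def by auto

lemma bose_le:
  assumes "c > 0" "u > 0"
  shows "bose c p u \<le> 1 / c * u powr (- p)"
proof -
  have v: "0 < c * u powr p" using assms by simp
  have "c * u powr p \<le> exp (c * u powr p) - 1" using exp_ge_add_one_self[of "c * u powr p"] by linarith
  hence "1 / (exp (c * u powr p) - 1) \<le> 1 / (c * u powr p)" using v by (intro divide_left_mono mult_pos_pos) (use assms in auto)
  also have "\<dots> = 1 / c * u powr (- p)" by (simp add: powr_minus divide_inverse)
  finally show ?thesis using assms by (simp add: bose_def)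
qed

lemma bose_le_decay:
  assumes "c > 0" "u > 0"
  shows "bose c p u \<le> (1 / c + 2 / c\<^sup>2) * decay p u"
proof -
  define v where "v = c * u powr p"
  have v: "0 < v" using assms by (simp add: v_def)
  have "v\<^sup>2 / 2 \<le> exp v - 1" using exp_lower_Taylor_quadratic[of v] v by linarith
  hence "1 / (exp v - 1) \<le> 1 / (v\<^sup>2 / 2)" using v by (intro divide_left_mono mult_pos_pos) simp_all
  also have "1 / (v\<^sup>2 / 2) = 2 / c\<^sup>2 * u powr (- (2 * p))"
  proof -
    have "(u powr p)\<^sup>2 = u powr (p + p)" by (simp only: power2_eq_square powr_add)
    hence "(u powr p)\<^sup>2 = u powr (2 * p)" by (metis mult_2)
    thus ?thesis by (simp add: v_def power_mult_distrib powr_minus_divide)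
  qed
  finally have 1: "bose c p u \<le> 2 / c\<^sup>2 * u powr (- (2 * p))" using assms by (simp add: bose_def v_def)
  have 2: "bose c p u \<le> 1 / c * u powr (- p)" by (rule bose_le[OF assms])
  have "0 \<le> 1 / c * u powr (- (2 * p))" "0 \<le> 2 / c\<^sup>2 * u powr (- p)" using assms by simp_all
  with 1 2 have "bose c p u \<le> (1 / c + 2 / c\<^sup>2) * u powr (- (2 * p))" "bose c p u \<le> (1 / c + 2 / c\<^sup>2) * u powr (- p)"
    unfolding distrib_right by linarith+
  thus ?thesis unfolding decay_def by (cases "u powr (- p) \<le> u powr (- (2 * p))") (simp_all only: min_def if_True if_False)
qed

lemma has_sum_exp_geometric:
  assumes "v > (0::real)"
  shows "((\<lambda>j. exp (- real j * v)) has_sum 1 / (exp v - 1)) {1..}"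
proof -
  have "(\<lambda>j. exp (- v) * exp (- v) ^ j) sums (exp (- v) * (1 / (1 - exp (- v))))"
    using assms by (intro sums_mult geometric_sums) auto
  also have "exp (- v) * (1 / (1 - exp (- v))) = 1 / (exp v - 1)"
  proof -
    have "inverse E * (1 / (1 - inverse E)) = 1 / (E - 1)" if "E > 1" for E :: real
      using that by (simp add: field_simps)
    from this[of "exp v"] show ?thesis using assms by (simp add: exp_minus)
  qed
  also have "(\<lambda>j. exp (- v) * exp (- v) ^ j) = (\<lambda>j. exp (- real (Suc j) * v))"
  proof
    fix j
    have "exp (- v) * exp (- v) ^ j = exp (- v) ^ Suc j" by simp
    also have "\<dots> = exp (of_nat (Suc j) * (- v))" by (rule exp_of_nat_mult[symmetric])
    also have "of_nat (Suc j) * (- v) = - real (Suc j) * v" by (simp only: mult_minus_left mult_minus_right)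
    finally show "exp (- v) * exp (- v) ^ j = exp (- real (Suc j) * v)" .
  qed
  finally have s: "(\<lambda>j. exp (- real (Suc j) * v)) sums (1 / (exp v - 1))" .
  have "((\<lambda>j. exp (- real (Suc j) * v)) has_sum (1 / (exp v - 1))) UNIV"
    by (rule sums_nonneg_imp_has_sum[OF s]) simp
  moreover have "{1..} = range Suc" by (auto simp: image_iff Suc_le_eq gr0_conv_Suc)
  ultimately show ?thesis using has_sum_reindex[of Suc UNIV "\<lambda>j. exp (- real j * v)"]
    by (simp only: o_def inj_Suc)
qed

text \<open>Summing the geometric series in \<open>j\<close> under the integral gives both critical densities in closed form: \<open>N\<close> will be
  the Lebesgue measure for the limiting one, and the counting measure on the nonzero sites for the one at finite \<open>L\<close>.\<close>

lemma has_sum_integral_exp_geometric: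
  fixes v :: "'b \<Rightarrow> real"
  assumes [measurable]: "v \<in> borel_measurable N" and v: "AE y in N. v y > 0" and I: "0 \<le> I" "\<theta> > 0"
    and eq: "(\<integral>\<^sup>+y. ennreal (1 / (exp (v y) - 1)) \<partial>N) = ennreal I"
  shows "((\<lambda>j. \<theta> * (LINT y|N. exp (- real j * v y))) has_sum (\<theta> * I)) {1..}"
    and "\<And>j. j \<ge> 1 \<Longrightarrow> integrable N (\<lambda>y. exp (- real j * v y))"
proof -
  have tot: "(\<integral>\<^sup>+j. (\<integral>\<^sup>+y. ennreal (exp (- real j * v y)) \<partial>N) \<partial>count_space {1..}) = ennreal I"
  proof -
    have "(\<integral>\<^sup>+j. (\<integral>\<^sup>+y. ennreal (exp (- real j * v y)) \<partial>N) \<partial>count_space {1..}) =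
       (\<integral>\<^sup>+y. (\<integral>\<^sup>+j. ennreal (exp (- real j * v y)) \<partial>count_space {1..}) \<partial>N)"
      by (rule nn_integral_count_space_nn_integral[symmetric]) auto
    also have "\<dots> = (\<integral>\<^sup>+y. ennreal (1 / (exp (v y) - 1)) \<partial>N)"
    proof (rule nn_integral_cong_AE)
      show "AE y in N. (\<integral>\<^sup>+j. ennreal (exp (- real j * v y)) \<partial>count_space {1..}) = ennreal (1 / (exp (v y) - 1))"
        using v by eventually_elim (rule nn_integral_of_has_sum[OF _ has_sum_exp_geometric], simp)
    qed
    finally show ?thesis using eq by simp
  qed
  have fin: "(\<integral>\<^sup>+y. ennreal (exp (- real j * v y)) \<partial>N) < \<infinity>" if "j \<ge> 1" for j
  proof -
    have "(\<integral>\<^sup>+y. ennreal (exp (- real j * v y)) \<partial>N) \<le> (\<integral>\<^sup>+y. ennreal (1 / (exp (v y) - 1)) \<partial>N)"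
    proof (rule nn_integral_mono_AE)
      show "AE y in N. ennreal (exp (- real j * v y)) \<le> ennreal (1 / (exp (v y) - 1))"
        using v
      proof eventually_elim
        case (elim y)
        have "(\<Sum>j\<in>{j}. exp (- real j * v y)) \<le> 1 / (exp (v y) - 1)"
          using has_sum_mono_neutral[OF has_sum_finite[of "{j}" "\<lambda>j. exp (- real j * v y)"] has_sum_exp_geometric[OF elim]] that by auto
        thus ?case by (intro ennreal_leI) simp
      qed
    qed
    thus ?thesis using eq by (simp add: le_less_trans)
  qed
  show int: "integrable N (\<lambda>y. exp (- real j * v y))" if "j \<ge> 1" for j
    by (rule integrableI_nonneg) (use fin[OF that] in auto)
  show "((\<lambda>j. \<theta> * (LINT y|N. exp (- real j * v y))) has_sum (\<theta> * I)) {1..}"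
  proof (intro has_sum_cmult_right has_sum_of_nn_integral)
    have "(\<integral>\<^sup>+j. ennreal (LINT y|N. exp (- real j * v y)) \<partial>count_space {1..}) = (\<integral>\<^sup>+j. (\<integral>\<^sup>+y. ennreal (exp (- real j * v y)) \<partial>N) \<partial>count_space {1..})"
      by (rule nn_integral_cong, rule nn_integral_eq_integral[symmetric], rule int) simp_all
    thus "(\<integral>\<^sup>+j. ennreal (LINT y|N. exp (- real j * v y)) \<partial>count_space {1..}) = ennreal I" using tot by simp
  qed (use I in \<open>auto intro: integral_nonneg_AE\<close>)
qed

lemma integrable_decay_bose_norm:
  assumes "real CARD('d) / 2 < \<delta>" "\<delta> < real CARD('d::finite)" "c > 0"
  shows "integrable lborel (\<lambda>y::real^'d. decay \<delta> (norm y))" and "integrable lborel (\<lambda>y::real^'d. bose c \<delta> (norm y))"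
proof -
  show d: "integrable lborel (\<lambda>y::real^'d. decay \<delta> (norm y))"
    by (rule integrableI_nonneg) (use nn_integral_decay_norm[OF assms(1,2)] in \<open>auto simp: decay_nonneg\<close>)
  show "integrable lborel (\<lambda>y::real^'d. bose c \<delta> (norm y))"
  proof (rule Bochner_Integration.integrable_bound)
    show "integrable lborel (\<lambda>y::real^'d. (1 / c + 2 / c\<^sup>2) * decay \<delta> (norm y))" using d by simp
    have "norm (bose c \<delta> (norm y)) \<le> norm ((1 / c + 2 / c\<^sup>2) * decay \<delta> (norm y))" for y :: "real^'d"
    proof (cases "y = 0")
      case False
      thus ?thesis using bose_le_decay[OF assms(3), of "norm y" \<delta>] bose_nonneg[OF assms(3)] by simp
    qed (simp add: bose_def)
    thus "AE y in (lborel :: (real^'d) measure). norm (bose c \<delta> (norm y)) \<le> norm ((1 / c + 2 / c\<^sup>2) * decay \<delta> (norm y))" by simp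
  qed measurable
qed

lemma critical_density_eq:
  fixes V :: "real ^ 'd \<Rightarrow> real"
  assumes "real CARD('d) / 2 < \<delta>" "\<delta> < real CARD('d)" "c > 0" "\<theta> > 0"
    and V: "\<And>x. V x = c * norm x powr \<delta>"
  shows "critical_density (\<lambda>_. \<theta>) V = \<theta> * (LINT y|lborel. bose c \<delta> (norm (y::real^'d)))"
proof -
  have V': "V = (\<lambda>x. c * norm x powr \<delta>)" using V by auto
  have "((\<lambda>j. \<theta> * (LINT y|lborel. exp (- real j * V y))) has_sum (\<theta> * (LINT y|lborel. bose c \<delta> (norm (y::real^'d))))) {1..}"
  proof (rule has_sum_integral_exp_geometric)
    show "V \<in> borel_measurable lborel" unfolding V' by measurable
    show "AE y in lborel. V y > 0"
      by (rule AE_mp[OF AE_lborel_singleton[of 0]]) (use assms in auto)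
    show "0 \<le> (LINT y|lborel. bose c \<delta> (norm (y::real^'d)))" by (intro integral_nonneg_AE) (simp add: bose_nonneg assms)
    have "(\<integral>\<^sup>+y. ennreal (1 / (exp (V y) - 1)) \<partial>lborel) = (\<integral>\<^sup>+y. ennreal (bose c \<delta> (norm y)) \<partial>(lborel :: (real^'d) measure))"
    proof (rule nn_integral_cong_AE)
      show "AE y in lborel. ennreal (1 / (exp (V y) - 1)) = ennreal (bose c \<delta> (norm y))"
        by (rule AE_mp[OF AE_lborel_singleton[of 0]]) (auto simp: V bose_def)
    qed
    also have "\<dots> = ennreal (LINT y|lborel. bose c \<delta> (norm (y::real^'d)))"
      by (rule nn_integral_eq_integral[OF integrable_decay_bose_norm(2)[OF assms(1-3)]]) (simp add: bose_nonneg assms)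
    finally show "(\<integral>\<^sup>+y. ennreal (1 / (exp (V y) - 1)) \<partial>lborel) = \<dots>" .
  qed (use assms in auto)
  thus ?thesis unfolding critical_density_def by (rule infsumI)
qed

definition site_mean :: "real \<Rightarrow> real \<Rightarrow> real \<Rightarrow> int ^ 'd \<Rightarrow> real" where
  "site_mean c p L x = bose c p (norm (lattice_point x) / L)"

lemma site_mean_0: "site_mean c p L 0 = 0"
  by (simp add: site_mean_def bose_def lattice_point_0_iff)

lemma site_mean_nonneg: "c > 0 \<Longrightarrow> 0 \<le> site_mean c p L x"
  by (simp add: site_mean_def bose_nonneg)

lemma site_mean_le:
  assumes "c > 0" "L > 0" "x \<noteq> 0"
  shows "site_mean c p L x \<le> L powr p / c * norm (lattice_point x) powr (- p)"
proof -
  have n: "norm (lattice_point x) > 0" using assms(3) by (simp add: lattice_point_0_iff)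
  have "site_mean c p L x \<le> 1 / c * (norm (lattice_point x) / L) powr (- p)"
    unfolding site_mean_def using n assms by (intro bose_le) auto
  also have "(norm (lattice_point x) / L) powr (- p) = L powr p * norm (lattice_point x) powr (- p)"
    using n assms by (subst powr_divide) (simp_all add: powr_minus[of L] divide_inverse mult.commute)
  finally show ?thesis by simp
qed

lemma summable_site_mean:
  assumes "real CARD('d) / 2 < \<delta>" "\<delta> < real CARD('d)" "c > 0" "L > 0"
  shows "site_mean c \<delta> L summable_on (UNIV :: (int^'d) set)"
proof -
  have "(\<integral>\<^sup>+x. ennreal (site_mean c \<delta> L x) \<partial>count_space (UNIV :: (int^'d) set)) \<le>
    (\<integral>\<^sup>+x. ennreal (1 / c + 2 / c\<^sup>2) * (if x = 0 then 0 else ennreal (decay \<delta> (norm (lattice_point (x :: int^'d)) / L))) \<partial>count_space UNIV)"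
  proof (rule nn_integral_mono)
    fix x :: "int^'d"
    show "ennreal (site_mean c \<delta> L x) \<le> ennreal (1 / c + 2 / c\<^sup>2) * (if x = 0 then 0 else ennreal (decay \<delta> (norm (lattice_point x) / L)))"
    proof (cases "x = 0")
      case False
      hence "site_mean c \<delta> L x \<le> (1 / c + 2 / c\<^sup>2) * decay \<delta> (norm (lattice_point x) / L)"
        unfolding site_mean_def using assms by (intro bose_le_decay) (auto simp: lattice_point_0_iff)
      hence "ennreal (site_mean c \<delta> L x) \<le> ennreal ((1 / c + 2 / c\<^sup>2) * decay \<delta> (norm (lattice_point x) / L))"
        by (rule ennreal_leI)
      also have "\<dots> = ennreal (1 / c + 2 / c\<^sup>2) * ennreal (decay \<delta> (norm (lattice_point x) / L))"
        using assms by (intro ennreal_mult) (auto simp: decay_nonneg)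
      finally show ?thesis using False by simp
    qed (simp add: site_mean_0)
  qed
  also have "\<dots> = ennreal (1 / c + 2 / c\<^sup>2) * (\<integral>\<^sup>+x. (if x = 0 then 0 else ennreal (decay \<delta> (norm (lattice_point (x :: int^'d)) / L))) \<partial>count_space UNIV)"
    by (rule nn_integral_cmult) simp
  also have "\<dots> < \<infinity>" using nn_integral_decay_lattice[OF assms(4,1,2)] by (simp add: ennreal_mult_less_top)
  finally obtain r where "0 \<le> r" "(\<integral>\<^sup>+x. ennreal (site_mean c \<delta> L x) \<partial>count_space (UNIV :: (int^'d) set)) = ennreal r"
    by (cases "\<integral>\<^sup>+x. ennreal (site_mean c \<delta> L x) \<partial>count_space (UNIV :: (int^'d) set)" rule: ennreal_cases) auto
  hence "(site_mean c \<delta> L has_sum r) (UNIV :: (int^'d) set)" by (intro has_sum_of_nn_integral) (auto simp: site_mean_nonneg assms)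
  thus ?thesis by (auto simp: summable_on_def)
qed

lemma critical_density_scaled_eq:
  fixes V :: "real ^ 'd \<Rightarrow> real"
  assumes "real CARD('d) / 2 < \<delta>" "\<delta> < real CARD('d)" "c > 0" "\<theta> > 0" "L > 0"
    and V: "\<And>x. V x = c * norm x powr \<delta>"
  shows "critical_density_scaled (\<lambda>_. \<theta>) V L * L ^ CARD('d) = \<theta> * (\<Sum>\<^sub>\<infinity>x::int^'d. site_mean c \<delta> L x)"
proof -
  define N where "N = count_space (UNIV - {0} :: (int^'d) set)"
  define v where "v x = V (lattice_point x /\<^sub>R L)" for x :: "int^'d"
  define I where "I = (\<Sum>\<^sub>\<infinity>x::int^'d. site_mean c \<delta> L x)"
  have v: "v x = c * (norm (lattice_point x) / L) powr \<delta>" for x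
    using assms(5) by (simp add: v_def V divide_inverse mult.commute)
  have vpos: "v x > 0" if "x \<noteq> 0" for x using that assms by (simp add: v lattice_point_0_iff)
  have sm: "site_mean c \<delta> L x = 1 / (exp (v x) - 1)" if "x \<noteq> 0" for x
    using that assms(5) by (simp add: site_mean_def bose_def v lattice_point_0_iff)
  have I0: "I \<ge> 0" unfolding I_def by (intro infsum_nonneg site_mean_nonneg assms)
  have eq: "(\<integral>\<^sup>+x. ennreal (1 / (exp (v x) - 1)) \<partial>N) = ennreal I"
  proof -
    have "(\<integral>\<^sup>+x. ennreal (1 / (exp (v x) - 1)) \<partial>N) = (\<integral>\<^sup>+x. ennreal (site_mean c \<delta> L x) \<partial>N)"
      unfolding N_def by (intro nn_integral_cong) (simp add: sm)
    also have "\<dots> = (\<integral>\<^sup>+x. ennreal (site_mean c \<delta> L x) \<partial>count_space (UNIV :: (int^'d) set))"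
      unfolding N_def by (rule nn_integral_count_space_eq) (auto simp: site_mean_0)
    also have "\<dots> = ennreal I" unfolding I_def
      by (rule nn_integral_of_has_sum) (use summable_site_mean[OF assms(1,2,3,5)] in \<open>auto simp: site_mean_nonneg assms(3)\<close>)
    finally show ?thesis .
  qed
  have AEv: "AE x in N. v x > 0" unfolding N_def by (simp add: AE_count_space vpos)
  have vm: "v \<in> borel_measurable N" unfolding N_def by simp
  note * = has_sum_integral_exp_geometric[OF vm AEv I0 assms(4) eq]
  have inner: "(\<Sum>\<^sub>\<infinity>x\<in>UNIV - {0}. \<theta> * exp (- real j * v x)) = \<theta> * (LINT x|N. exp (- real j * v x))" if "j \<ge> 1" for j
  proof -
    have "Infinite_Set_Sum.abs_summable_on (\<lambda>x. exp (- real j * v x)) (UNIV - {0})"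
      using *(2)[OF that] by (simp add: N_def Infinite_Set_Sum.abs_summable_on_def)
    from infsetsum_infsum[OF this] have "(\<Sum>\<^sub>\<infinity>x\<in>UNIV - {0}. exp (- real j * v x)) = (LINT x|N. exp (- real j * v x))"
      by (simp add: infsetsum_def N_def)
    thus ?thesis by (simp add: infsum_cmult_right')
  qed
  have "(\<Sum>\<^sub>\<infinity>j\<in>{1..}. \<Sum>\<^sub>\<infinity>x\<in>UNIV - {0}. \<theta> * exp (- real j * v x)) = (\<Sum>\<^sub>\<infinity>j\<in>{1..}. \<theta> * (LINT x|N. exp (- real j * v x)))"
    by (intro infsum_cong) (use inner in auto)
  also have "\<dots> = \<theta> * I" using *(1) by (rule infsumI)
  finally show ?thesis using assms(5) unfolding critical_density_scaled_def v_def I_def by simp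
qed

text \<open>The lattice sum is the integral of a step function which converges pointwise away from \<open>0\<close> and is dominated by a multiple
  of \<open>decay \<delta> (norm y)\<close>. Leaving out the cell of the origin is what makes the domination possible.\<close>

lemma site_mean_riemann_sum:
  fixes L :: "nat \<Rightarrow> real"
  assumes \<delta>: "real CARD('d) / 2 < \<delta>" "\<delta> < real CARD('d)" "c > 0" and L: "\<And>k. L k > 0" "filterlim L at_top sequentially"
  shows "(\<lambda>k. (\<Sum>\<^sub>\<infinity>x::int^'d. site_mean c \<delta> (L k) x) / L k ^ CARD('d)) \<longlonglongrightarrow> (LINT y|lborel. bose c \<delta> (norm (y::real^'d)))"
proof -
  have "0 \<le> real CARD('d) / 2" by simp
  hence \<delta>0: "\<delta> > 0" using \<delta>(1) by linarith
  define f where "f k y = site_mean c \<delta> (L k) (cell (L k *\<^sub>R y))" for k and y :: "real^'d"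
  have fm[measurable]: "f k \<in> borel_measurable borel" for k
    unfolding f_def by (rule measurable_compose[OF cell_measurable]) simp
  have eq: "(\<Sum>\<^sub>\<infinity>x::int^'d. site_mean c \<delta> (L k) x) / L k ^ CARD('d) = (LINT y|lborel. f k y)" for k
  proof -
    have "(\<integral>\<^sup>+y. ennreal (f k y) \<partial>lborel) = ennreal (1 / L k ^ CARD('d)) * (\<integral>\<^sup>+x. ennreal (site_mean c \<delta> (L k) x) \<partial>count_space (UNIV :: (int^'d) set))"
      unfolding f_def by (rule nn_integral_cell[OF L(1)])
    also have "(\<integral>\<^sup>+x. ennreal (site_mean c \<delta> (L k) x) \<partial>count_space (UNIV :: (int^'d) set)) = ennreal (\<Sum>\<^sub>\<infinity>x::int^'d. site_mean c \<delta> (L k) x)"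
      by (rule nn_integral_of_has_sum) (use summable_site_mean[OF \<delta> L(1)] in \<open>auto simp: site_mean_nonneg \<delta>(3)\<close>)
    also have "ennreal (1 / L k ^ CARD('d)) * \<dots> = ennreal ((\<Sum>\<^sub>\<infinity>x::int^'d. site_mean c \<delta> (L k) x) / L k ^ CARD('d))"
      using L(1)[of k] by (subst ennreal_mult[symmetric]) (auto intro!: infsum_nonneg site_mean_nonneg \<delta>)
    finally have "(\<integral>\<^sup>+y. ennreal (f k y) \<partial>lborel) = \<dots>" .
    moreover have "0 \<le> (\<Sum>\<^sub>\<infinity>x::int^'d. site_mean c \<delta> (L k) x) / L k ^ CARD('d)"
      using L(1)[of k] by (intro divide_nonneg_pos infsum_nonneg site_mean_nonneg \<delta>) auto
    ultimately show ?thesis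
      by (subst integral_eq_nn_integral) (simp_all add: site_mean_nonneg \<delta> f_def)
  qed
  have c0: "cell (0 :: real^'d) = 0" by (simp add: cell_def vec_eq_iff)
  show ?thesis unfolding eq
  proof (rule integral_dominated_convergence)
    define C where "C = (1 / c + 2 / c\<^sup>2) * (2 * real CARD('d)) powr (2 * \<delta>)"
    show "integrable lborel (\<lambda>y::real^'d. C * decay \<delta> (norm y))"
      by (intro integrable_mult_right integrable_decay_bose_norm(1)[OF \<delta>])
    show "AE y in lborel. norm (f k y) \<le> C * decay \<delta> (norm y)" for k
    proof (rule AE_I2)
      fix y :: "real^'d"
      show "norm (f k y) \<le> C * decay \<delta> (norm y)"
      proof (cases "cell (L k *\<^sub>R y) = 0")
        case True
        thus ?thesis using \<delta>(3) by (simp add: f_def site_mean_0 C_def decay_nonneg)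
      next
        case False
        have "f k y \<le> (1 / c + 2 / c\<^sup>2) * decay \<delta> (norm (lattice_point (cell (L k *\<^sub>R y))) / L k)"
          unfolding f_def site_mean_def using False L(1)[of k] by (intro bose_le_decay \<delta>) (simp add: lattice_point_0_iff)
        also have "\<dots> \<le> (1 / c + 2 / c\<^sup>2) * ((2 * real CARD('d)) powr (2 * \<delta>) * decay \<delta> (norm y))"
          using False \<delta>(3) by (intro mult_left_mono decay_cell_le L \<delta>0) auto
        finally have "f k y \<le> C * decay \<delta> (norm y)" by (simp add: C_def mult.assoc)
        moreover have "0 \<le> f k y" unfolding f_def by (rule site_mean_nonneg[OF \<delta>(3)])
        ultimately show ?thesis by simp
      qed
    qed
    show "AE y in lborel. (\<lambda>k. f k y) \<longlonglongrightarrow> bose c \<delta> (norm y)"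
    proof (rule AE_mp[OF AE_lborel_singleton[of 0]], intro AE_I2 impI)
      fix y :: "real^'d" assume y: "y \<noteq> 0"
      have "(\<lambda>k. norm (lattice_point (cell (L k *\<^sub>R y))) / L k) \<longlonglongrightarrow> norm y"
      proof (rule LIM_zero_cancel, rule Lim_null_comparison[OF always_eventually], rule allI)
        fix k
        have "\<bar>norm (lattice_point (cell (L k *\<^sub>R y))) - norm (L k *\<^sub>R y)\<bar> \<le> norm (lattice_point (cell (L k *\<^sub>R y)) - L k *\<^sub>R y)"
          by (rule norm_triangle_ineq3)
        also have "\<dots> \<le> real CARD('d)" by (rule norm_cell_diff_le)
        finally have "\<bar>norm (lattice_point (cell (L k *\<^sub>R y))) - norm (L k *\<^sub>R y)\<bar> / L k \<le> real CARD('d) / L k"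
          using L(1)[of k] by (intro divide_right_mono) auto
        moreover have "norm (lattice_point (cell (L k *\<^sub>R y))) / L k - norm y = (norm (lattice_point (cell (L k *\<^sub>R y))) - norm (L k *\<^sub>R y)) / L k"
          using L(1)[of k] by (simp add: diff_divide_distrib)
        ultimately show "norm (norm (lattice_point (cell (L k *\<^sub>R y))) / L k - norm y) \<le> real CARD('d) / L k"
          using L(1)[of k] by (simp add: abs_divide)
      next
        show "(\<lambda>k. real CARD('d) / L k) \<longlonglongrightarrow> 0" by (rule tendsto_divide_0[OF tendsto_const filterlim_at_top_imp_at_infinity[OF L(2)]])
      qed
      moreover have "isCont (bose c \<delta>) (norm y)"
      proof -
        have "isCont (\<lambda>u. 1 / (exp (c * u powr \<delta>) - 1)) (norm y)"
          using y \<delta>(3) by (intro continuous_intros) auto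
        moreover have "\<forall>\<^sub>F u in nhds (norm y). bose c \<delta> u = 1 / (exp (c * u powr \<delta>) - 1)"
          using y by (intro eventually_mono[OF t1_space_nhds[of "norm y" 0]]) (auto simp: bose_def)
        ultimately show ?thesis by (simp add: isCont_cong)
      qed
      ultimately show "(\<lambda>k. f k y) \<longlonglongrightarrow> bose c \<delta> (norm y)"
        unfolding f_def site_mean_def by (rule isCont_tendsto_compose[rotated])
    qed
  qed auto
qed

section \<open>Sums over finitely supported families\<close>

text \<open>Families of partitions and multisets of parts are both functions that take a default value \<open>e\<close> outside a
  finite set, with a multiplicative weight. One product formula serves for both. Infinite support gets weight \<open>0\<close>,
  so that sums may range over all functions.\<close>

definition finsupp_weight :: "'b \<Rightarrow> ('i \<Rightarrow> 'b \<Rightarrow> ennreal) \<Rightarrow> ('i \<Rightarrow> 'b) \<Rightarrow> ennreal" where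
  "finsupp_weight e g p = (if finite {x. p x \<noteq> e} then \<Prod>x | p x \<noteq> e. g x (p x) else 0)"

lemma finsupp_weight_upd:
  assumes "g x e = 1" "p x = e"
  shows "finsupp_weight e g (p(x := b)) = g x b * finsupp_weight e g p"
proof (cases "b = e")
  case True
  thus ?thesis using assms by (metis fun_upd_triv mult_1)
next
  case False
  have "{y. (p(x := b)) y \<noteq> e} = insert x {y. p y \<noteq> e}" using False by auto
  moreover have "(\<Prod>y | p y \<noteq> e. g y ((p(x := b)) y)) = (\<Prod>y | p y \<noteq> e. g y (p y))"
    by (rule prod.cong) (use assms in auto)
  ultimately show ?thesis using assms unfolding finsupp_weight_def by simp
qed

text \<open>Expanding the product of sums, by adding one index at a time.\<close>

lemma nn_integral_finsupp_weight_finite: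
  assumes g: "\<And>x. g x e = 1" and F: "finite F"
  shows "(\<integral>\<^sup>+p. finsupp_weight e g p * indicator {p. {x. p x \<noteq> e} \<subseteq> F} p \<partial>count_space UNIV) = (\<Prod>x\<in>F. \<integral>\<^sup>+b. g x b \<partial>count_space UNIV)"
  using F
proof (induction F)
  case empty
  have S: "{p. {x. p x \<noteq> e} \<subseteq> {}} = {\<lambda>_. e}" by auto
  have "(\<integral>\<^sup>+p. finsupp_weight e g p * indicator {\<lambda>_. e} p \<partial>count_space UNIV) = (\<Sum>p\<in>{\<lambda>_. e}. finsupp_weight e g p * indicator {\<lambda>_. e} p)"
    by (rule nn_integral_count_space') auto
  moreover have "finsupp_weight e g (\<lambda>_. e) = 1" by (simp add: finsupp_weight_def)
  ultimately show ?case unfolding S by simp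
next
  case (insert x F)
  define P where "P F = {p::'a \<Rightarrow> 'b. {x. p x \<noteq> e} \<subseteq> F}" for F
  have bij: "bij_betw (\<lambda>(b, p). p(x := b)) (UNIV \<times> P F) (P (insert x F))"
  proof (rule bij_betwI[where g="\<lambda>q. (q x, q(x := e))"])
    show "(\<lambda>(b, p). p(x := b)) \<in> UNIV \<times> P F \<rightarrow> P (insert x F)" by (auto simp: P_def)
    show "(\<lambda>q. (q x, q(x := e))) \<in> P (insert x F) \<rightarrow> UNIV \<times> P F" by (auto simp: P_def split: if_splits)
    fix bp :: "'b \<times> ('a \<Rightarrow> 'b)" assume "bp \<in> UNIV \<times> P F"
    thus "((case bp of (b, p) \<Rightarrow> p(x := b)) x, (case bp of (b, p) \<Rightarrow> p(x := b))(x := e)) = bp"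
      using insert(2) by (auto simp: P_def fun_eq_iff)
  next
    fix q assume "q \<in> P (insert x F)"
    show "(case (q x, q(x := e)) of (b, p) \<Rightarrow> p(x := b)) = q" by simp
  qed
  have px: "p x = e" if "p \<in> P F" for p using that insert(2) by (auto simp: P_def)
  have "(\<integral>\<^sup>+q. finsupp_weight e g q * indicator (P (insert x F)) q \<partial>count_space UNIV) = (\<integral>\<^sup>+q. finsupp_weight e g q \<partial>count_space (P (insert x F)))"
    by (simp add: nn_integral_count_space_indicator)
  also have "\<dots> = (\<integral>\<^sup>+bp. finsupp_weight e g (case bp of (b, p) \<Rightarrow> p(x := b)) \<partial>count_space (UNIV \<times> P F))"
    by (rule nn_integral_bij_count_space[OF bij, symmetric])
  also have "\<dots> = (\<integral>\<^sup>+bp. (case bp of (b, p) \<Rightarrow> g x b * (finsupp_weight e g p * indicator (P F) p)) \<partial>count_space UNIV)"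
    by (subst nn_integral_count_space_indicator)
       (auto simp: indicator_def intro!: nn_integral_cong finsupp_weight_upd[where e=e] g px)
  also have "\<dots> = (\<integral>\<^sup>+b. (\<integral>\<^sup>+p. g x b * (finsupp_weight e g p * indicator (P F) p) \<partial>count_space UNIV) \<partial>count_space UNIV)"
    by (subst nn_integral_fst_count_space[symmetric]) simp
  also have "\<dots> = (\<integral>\<^sup>+b. g x b \<partial>count_space UNIV) * (\<integral>\<^sup>+p. finsupp_weight e g p * indicator (P F) p \<partial>count_space UNIV)"
    by (simp add: nn_integral_cmult nn_integral_multc)
  also have "\<dots> = (\<Prod>x\<in>insert x F. \<integral>\<^sup>+b. g x b \<partial>count_space UNIV)"
    using insert by (simp add: P_def)
  finally show ?case by (simp add: P_def)
qed

lemma nn_integral_finsupp_weight: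
  assumes g: "\<And>x. g x e = 1" and A: "\<And>m. finite (A m)" "incseq A" "(\<Union>m. A m) = UNIV"
  shows "(\<lambda>m. \<Prod>x\<in>A m. \<integral>\<^sup>+b. g x b \<partial>count_space UNIV) \<longlonglongrightarrow> (\<integral>\<^sup>+p. finsupp_weight e g p \<partial>count_space UNIV)"
proof -
  define f where "f m p = finsupp_weight e g p * indicator {p. {x. p x \<noteq> e} \<subseteq> A m} p" for m p
  have "(\<lambda>m. \<integral>\<^sup>+p. f m p \<partial>count_space UNIV) \<longlonglongrightarrow> (\<integral>\<^sup>+p. finsupp_weight e g p \<partial>count_space UNIV)"
  proof (rule nn_integral_LIMSEQ)
    show "incseq f"
    proof (intro incseq_SucI le_funI)
      fix m p
      have "A m \<subseteq> A (Suc m)" using A(2) by (simp add: incseq_Suc_iff)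
      thus "f m p \<le> f (Suc m) p" unfolding f_def by (auto simp: indicator_def)
    qed
    fix p
    show "(\<lambda>m. f m p) \<longlonglongrightarrow> finsupp_weight e g p"
    proof (cases "finite {x. p x \<noteq> e}")
      case True
      have "\<exists>m. {x. p x \<noteq> e} \<subseteq> A m" using True
      proof (induction rule: finite_induct)
        case (insert a F)
        then obtain m where m: "F \<subseteq> A m" by blast
        obtain k where k: "a \<in> A k" using A(3) by blast
        have "A m \<subseteq> A (max m k)" "A k \<subseteq> A (max m k)" using A(2) by (auto simp: incseq_def)
        thus ?case using m k by blast
      qed auto
      then obtain M where M: "{x. p x \<noteq> e} \<subseteq> A M" by blast
      have "\<forall>\<^sub>F m in sequentially. f m p = finsupp_weight e g p"
      proof (rule eventually_sequentiallyI[of M])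
        fix m assume "M \<le> m"
        hence "{x. p x \<noteq> e} \<subseteq> A m" using M A(2) by (meson incseq_def order_trans)
        thus "f m p = finsupp_weight e g p" by (simp add: f_def)
      qed
      thus ?thesis by (rule tendsto_eventually)
    next
      case False
      thus ?thesis by (simp add: f_def finsupp_weight_def)
    qed
  qed simp
  thus ?thesis unfolding f_def using nn_integral_finsupp_weight_finite[where g=g and e=e, OF g A(1)] by simp
qed

definition mset_size :: "nat multiset \<Rightarrow> nat" where "mset_size ms = (\<Sum>j\<in>set_mset ms. j * count ms j)"

definition site_weight :: "real \<Rightarrow> real \<Rightarrow> nat multiset \<Rightarrow> ennreal" where
  "site_weight \<theta> s ms = (if 0 \<in># ms then 0 else ennreal (\<Prod>j\<in>set_mset ms. 1 / fact (count ms j) * (\<theta> / real j * s ^ j) ^ count ms j))"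

lemma ln_partial_sums:
  assumes "0 \<le> s" "s < (1::real)"
  shows "(\<lambda>m. \<Sum>j\<in>{1..m}. s ^ j / real j) \<longlonglongrightarrow> - ln (1 - s)"
proof -
  have "(\<lambda>n. - ((- (- s)) ^ n) / of_nat n) sums ln (1 + (- s))" by (rule ln_series') (use assms in auto)
  hence "(\<lambda>n. - (- (s ^ n) / real n)) sums - ln (1 - s)" by (intro sums_minus) simp
  hence "(\<lambda>n. s ^ n / real n) sums - ln (1 - s)" by simp
  hence "(\<lambda>m. \<Sum>j\<le>m. s ^ j / real j) \<longlonglongrightarrow> - ln (1 - s)" by (simp add: sums_def_le)
  moreover have "(\<Sum>j\<le>m. s ^ j / real j) = (\<Sum>j\<in>{1..m}. s ^ j / real j)" for m
    by (rule sum.mono_neutral_right) (auto simp: not_le Suc_le_eq)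
  ultimately show ?thesis by simp
qed

text \<open>A multiset of positive parts is a finitely supported choice of multiplicities, so the product formula gives
  \<open>exp (\<Sum>j. \<theta> / j * s ^ j)\<close>, and the exponent is the logarithmic series.\<close>

lemma nn_integral_site_weight:
  assumes "0 \<le> s" "s < 1" "\<theta> > 0"
  shows "(\<integral>\<^sup>+ms. site_weight \<theta> s ms \<partial>count_space UNIV) = ennreal ((1 - s) powr (- \<theta>))"
proof -
  define t where "t j = \<theta> / real j * s ^ j" for j
  have t: "0 \<le> t j" for j using assms by (simp add: t_def)
  \<comment> \<open>the index \<open>0\<close> is not a part: its only admissible multiplicity is \<open>0\<close>\<close>
  define g where "g j c = (if j = 0 then if c = 0 then 1 else 0 else ennreal (1 / fact c * t j ^ c))" for j c :: nat
  have bij: "bij_betw count (UNIV :: nat multiset set) {f. finite {j. f j \<noteq> 0}}"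
  proof (rule bij_betwI[where g=Abs_multiset])
    show "count \<in> (UNIV :: nat multiset set) \<rightarrow> {f. finite {j. f j \<noteq> 0}}"
    proof (rule Pi_I)
      fix M :: "nat multiset" assume "M \<in> UNIV"
      have "{j. count M j \<noteq> 0} = set_mset M" by auto
      thus "count M \<in> {f. finite {j. f j \<noteq> 0}}" by simp
    qed
    show "count (Abs_multiset f) = f" if "f \<in> {f. finite {j. f j \<noteq> 0}}" for f :: "nat \<Rightarrow> nat"
      using that by (intro Abs_multiset_inverse) simp
  qed (simp_all add: count_inverse)
  have cw: "site_weight \<theta> s ms = finsupp_weight 0 g (count ms)" for ms
  proof -
    have S: "{j. count ms j \<noteq> 0} = set_mset ms" by auto
    show ?thesis
    proof (cases "0 \<in># ms")
      case True
      hence "(\<Prod>j\<in>set_mset ms. g j (count ms j)) = 0" by (intro prod_zero) (auto simp: g_def count_eq_zero_iff intro!: bexI[of _ 0])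
      thus ?thesis using True by (simp add: site_weight_def finsupp_weight_def S)
    next
      case False
      have "ennreal (\<Prod>j\<in>set_mset ms. 1 / fact (count ms j) * t j ^ count ms j) = (\<Prod>j\<in>set_mset ms. ennreal (1 / fact (count ms j) * t j ^ count ms j))"
        by (rule prod_ennreal[symmetric]) (simp add: t)
      also have "\<dots> = (\<Prod>j\<in>set_mset ms. g j (count ms j))"
        by (rule prod.cong) (use False in \<open>auto simp: g_def\<close>)
      finally show ?thesis using False by (simp add: site_weight_def finsupp_weight_def S t_def)
    qed
  qed
  have "(\<integral>\<^sup>+ms. site_weight \<theta> s ms \<partial>count_space UNIV) = (\<integral>\<^sup>+f. finsupp_weight 0 g f \<partial>count_space {f. finite {j. f j \<noteq> 0}})"
    unfolding cw by (rule nn_integral_bij_count_space[OF bij])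
  also have "\<dots> = (\<integral>\<^sup>+f. finsupp_weight 0 g f \<partial>count_space UNIV)"
    by (rule nn_integral_count_space_eq) (auto simp: finsupp_weight_def)
  finally have eq: "(\<integral>\<^sup>+ms. site_weight \<theta> s ms \<partial>count_space UNIV) = (\<integral>\<^sup>+f. finsupp_weight 0 g f \<partial>count_space UNIV)" .
  have gj: "(\<integral>\<^sup>+c. g j c \<partial>count_space UNIV) = (if j = 0 then 1 else ennreal (exp (t j)))" for j
  proof (cases "j = 0")
    case True
    have "(\<integral>\<^sup>+c. g j c \<partial>count_space UNIV) = (\<Sum>c\<in>{0}. g j c)"
      by (rule nn_integral_count_space') (use True in \<open>auto simp: g_def\<close>)
    thus ?thesis using True by (simp add: g_def)
  next
    case False
    have "(\<lambda>c. 1 / fact c * t j ^ c) sums exp (t j)" using exp_converges[of "t j"] by (simp add: inverse_eq_divide)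
    hence e: "(\<Sum>c. ennreal (1 / fact c * t j ^ c)) = ennreal (exp (t j))"
      by (rule suminf_ennreal_eq[rotated]) (use t in simp)
    have "g j = (\<lambda>c. ennreal (1 / fact c * t j ^ c))" using False by (intro ext) (simp only: g_def if_False)
    thus ?thesis using False e by (simp only: nn_integral_count_space_nat if_False)
  qed
  have "(\<lambda>m. \<Prod>j\<in>{..m}. \<integral>\<^sup>+c. g j c \<partial>count_space UNIV) \<longlonglongrightarrow> (\<integral>\<^sup>+f. finsupp_weight 0 g f \<partial>count_space UNIV)"
  proof (rule nn_integral_finsupp_weight[where g=g and e=0 and A="\<lambda>m. {..m}"])
    show "g j 0 = 1" for j by (simp add: g_def)
    show "incseq (\<lambda>m. {..m} :: nat set)" by (rule incseq_SucI) (rule atMost_subset_iff[THEN iffD2], simp)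
    show "(\<Union>m. {..m}) = (UNIV :: nat set)" by blast
  qed simp
  moreover have PE: "(\<lambda>m. \<Prod>j\<in>{..m}. \<integral>\<^sup>+c. g j c \<partial>count_space UNIV) = (\<lambda>m. ennreal (exp (\<theta> * (\<Sum>j\<in>{1..m}. s ^ j / real j))))"
  proof
    fix m
    define F where "F j = (\<integral>\<^sup>+c. g j c \<partial>count_space UNIV)" for j
    have F0: "F 0 = 1" unfolding F_def gj by simp
    have FS: "F (Suc j) = ennreal (exp (\<theta> * (s ^ Suc j / real (Suc j))))" for j
      unfolding F_def gj t_def by simp
    have "(\<Prod>j\<in>{..m}. F j) = ennreal (exp (\<theta> * (\<Sum>j\<in>{1..m}. s ^ j / real j)))"
    proof (induction m)
      case (Suc m)
      have "(\<Prod>j\<in>{..Suc m}. F j) = ennreal (exp (\<theta> * (\<Sum>j\<in>{1..m}. s ^ j / real j))) * ennreal (exp (\<theta> * (s ^ Suc m / real (Suc m))))"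
        by (simp only: prod.atMost_Suc Suc.IH FS)
      moreover have "\<dots> = ennreal (exp (\<theta> * (\<Sum>j\<in>{1..m}. s ^ j / real j) + \<theta> * (s ^ Suc m / real (Suc m))))"
        unfolding exp_add by (rule ennreal_mult[symmetric]) simp_all
      moreover have "\<theta> * (\<Sum>j\<in>{1..m}. s ^ j / real j) + \<theta> * (s ^ Suc m / real (Suc m)) = \<theta> * (\<Sum>j\<in>{1..Suc m}. s ^ j / real j)"
        by (simp add: distrib_left)
      ultimately show ?case by simp
    qed (simp add: F0)
    thus "(\<Prod>j\<in>{..m}. \<integral>\<^sup>+c. g j c \<partial>count_space UNIV) = ennreal (exp (\<theta> * (\<Sum>j\<in>{1..m}. s ^ j / real j)))"
      unfolding F_def .
  qed
  ultimately have L1: "(\<lambda>m. ennreal (exp (\<theta> * (\<Sum>j\<in>{1..m}. s ^ j / real j)))) \<longlonglongrightarrow> (\<integral>\<^sup>+f. finsupp_weight 0 g f \<partial>count_space UNIV)"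
    by (simp only:)
  have L2: "(\<lambda>m. ennreal (exp (\<theta> * (\<Sum>j\<in>{1..m}. s ^ j / real j)))) \<longlonglongrightarrow> ennreal (exp (\<theta> * - ln (1 - s)))"
    by (intro tendsto_ennrealI tendsto_exp tendsto_mult_left ln_partial_sums assms(1,2))
  have "(\<integral>\<^sup>+f. finsupp_weight 0 g f \<partial>count_space UNIV) = ennreal (exp (\<theta> * - ln (1 - s)))"
    by (rule LIMSEQ_unique[OF L1 L2])
  thus ?thesis using eq assms by (simp add: powr_def)
qed

lemma site_weight_mult_power:
  assumes "0 \<le> s" "0 \<le> z" "\<theta> > 0"
  shows "site_weight \<theta> s ms * ennreal (z ^ mset_size ms) = site_weight \<theta> (s * z) ms"
proof (cases "0 \<in># ms")
  case False
  define f where "f j = 1 / fact (count ms j) * (\<theta> / real j * s ^ j) ^ count ms j" for j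
  have z: "z ^ mset_size ms = (\<Prod>j\<in>set_mset ms. z ^ (j * count ms j))"
    unfolding mset_size_def by (rule power_sum)
  have f: "f j * z ^ (j * count ms j) = 1 / fact (count ms j) * (\<theta> / real j * (s * z) ^ j) ^ count ms j" for j
  proof -
    have 1: "\<theta> / real j * (s * z) ^ j = \<theta> / real j * s ^ j * z ^ j" by (simp add: power_mult_distrib)
    have 2: "(\<theta> / real j * s ^ j * z ^ j) ^ count ms j = (\<theta> / real j * s ^ j) ^ count ms j * (z ^ j) ^ count ms j"
      by (rule power_mult_distrib)
    show ?thesis unfolding f_def 1 2 power_mult by (rule mult.assoc)
  qed
  have "(\<Prod>j\<in>set_mset ms. f j) * z ^ mset_size ms = (\<Prod>j\<in>set_mset ms. 1 / fact (count ms j) * (\<theta> / real j * (s * z) ^ j) ^ count ms j)"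
    unfolding z prod.distrib[symmetric] f ..
  moreover have "ennreal (\<Prod>j\<in>set_mset ms. f j) * ennreal (z ^ mset_size ms) = ennreal ((\<Prod>j\<in>set_mset ms. f j) * z ^ mset_size ms)"
    using assms by (intro ennreal_mult''[symmetric]) simp
  ultimately show ?thesis using False unfolding site_weight_def f_def by simp
qed (simp add: site_weight_def)

lemma ennreal_power_series_coeffs:
  fixes f :: "nat \<Rightarrow> ennreal"
  assumes f: "\<forall>u. 0 < u \<and> u < 1 \<longrightarrow> (\<Sum>k. f k * ennreal (u ^ k)) < \<infinity>"
  obtains r where "\<forall>k. f k = ennreal (r k) \<and> 0 \<le> r k"
    and "\<forall>u. 0 < u \<and> u < 1 \<longrightarrow> summable (\<lambda>k. r k * u ^ k) \<and> (\<Sum>k. f k * ennreal (u ^ k)) = ennreal (\<Sum>k. r k * u ^ k)"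
proof -
  have fk: "f k < \<infinity>" for k
  proof -
    have "f k * ennreal ((1/2) ^ k) \<le> (\<Sum>k. f k * ennreal ((1/2) ^ k))"
      using sum_le_suminf[of "\<lambda>k. f k * ennreal ((1/2) ^ k)" "{k}"] by simp
    also have "\<dots> < \<infinity>" using f[rule_format, of "1/2"] by simp
    finally show ?thesis by (auto simp: ennreal_mult_less_top)
  qed
  define r where "r k = enn2real (f k)" for k
  have fr: "f k = ennreal (r k)" "0 \<le> r k" for k
    using ennreal_enn2real[of "f k"] fk[of k] unfolding r_def by (simp_all add: enn2real_nonneg)
  have "summable (\<lambda>k. r k * u ^ k) \<and> (\<Sum>k. f k * ennreal (u ^ k)) = ennreal (\<Sum>k. r k * u ^ k)" if u: "0 < u" "u < 1" for u
  proof -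
    have e: "f k * ennreal (u ^ k) = ennreal (r k * u ^ k)" for k
      unfolding fr(1)[of k] using u fr(2)[of k] by (intro ennreal_mult[symmetric]) simp_all
    have nn: "0 \<le> r k * u ^ k" for k using fr(2)[of k] u by simp
    have "(\<Sum>k. f k * ennreal (u ^ k)) < \<infinity>" using f u by blast
    hence "(\<Sum>k. ennreal (r k * u ^ k)) < top" unfolding e by simp
    hence s: "summable (\<lambda>k. r k * u ^ k)" by (intro summable_suminf_not_top[OF nn]) simp
    show ?thesis unfolding e using suminf_ennreal2[OF nn s] s by simp
  qed
  with fr show ?thesis by (intro that[of r]) simp_all
qed

text \<open>The identity theorem for power series, assuming equality only to the right of \<open>0\<close>: if \<open>k\<close> is the first index at
  which the coefficients differ, then after division by \<open>u ^ k\<close> the difference series is continuous at \<open>0\<close> and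
  vanishes for small positive \<open>u\<close>, hence so does its value at \<open>0\<close>.\<close>

lemma nonneg_power_series_unique:
  fixes a b :: "nat \<Rightarrow> ennreal"
  assumes eq: "\<And>u. 0 < u \<Longrightarrow> u < 1 \<Longrightarrow> (\<Sum>k. a k * ennreal (u ^ k)) = (\<Sum>k. b k * ennreal (u ^ k))"
    and fin: "\<And>u. 0 < u \<Longrightarrow> u < 1 \<Longrightarrow> (\<Sum>k. b k * ennreal (u ^ k)) < \<infinity>"
  shows "a = b"
proof -
  have "\<forall>u. 0 < u \<and> u < 1 \<longrightarrow> (\<Sum>k. b k * ennreal (u ^ k)) < \<infinity>" using fin by blast
  from ennreal_power_series_coeffs[OF this] obtain r where r1: "\<forall>k. b k = ennreal (r k) \<and> 0 \<le> r k"
    and r2: "\<forall>u. 0 < u \<and> u < 1 \<longrightarrow> summable (\<lambda>k. r k * u ^ k) \<and> (\<Sum>k. b k * ennreal (u ^ k)) = ennreal (\<Sum>k. r k * u ^ k)" .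
  have "\<forall>u. 0 < u \<and> u < 1 \<longrightarrow> (\<Sum>k. a k * ennreal (u ^ k)) < \<infinity>"
  proof (intro allI impI)
    fix u :: real assume u: "0 < u \<and> u < 1"
    show "(\<Sum>k. a k * ennreal (u ^ k)) < \<infinity>" unfolding eq[OF u[THEN conjunct1] u[THEN conjunct2]] using u by (intro fin) simp_all
  qed
  from ennreal_power_series_coeffs[OF this] obtain q where q1: "\<forall>k. a k = ennreal (q k) \<and> 0 \<le> q k"
    and q2: "\<forall>u. 0 < u \<and> u < 1 \<longrightarrow> summable (\<lambda>k. q k * u ^ k) \<and> (\<Sum>k. a k * ennreal (u ^ k)) = ennreal (\<Sum>k. q k * u ^ k)" .
  have r: "b k = ennreal (r k)" "0 \<le> r k" for k using r1 by simp_all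
  have q: "a k = ennreal (q k)" "0 \<le> q k" for k using q1 by simp_all
  have r3: "summable (\<lambda>k. r k * u ^ k)" "(\<Sum>k. b k * ennreal (u ^ k)) = ennreal (\<Sum>k. r k * u ^ k)" if "0 < u" "u < 1" for u
    using r2[rule_format, of u] that by (simp_all only: simp_thms)
  have q3: "summable (\<lambda>k. q k * u ^ k)" "(\<Sum>k. a k * ennreal (u ^ k)) = ennreal (\<Sum>k. q k * u ^ k)" if "0 < u" "u < 1" for u
    using q2[rule_format, of u] that by (simp_all only: simp_thms)
  define d where "d k = q k - r k" for k
  have d: "summable (\<lambda>k. d k * u ^ k)" "(\<Sum>k. d k * u ^ k) = 0" if "0 < u" "u < 1" for u
  proof -
    have s: "(\<lambda>k. d k * u ^ k) = (\<lambda>k. q k * u ^ k - r k * u ^ k)" by (simp add: d_def left_diff_distrib)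
    have "0 \<le> (\<Sum>k. q k * u ^ k)" by (intro suminf_nonneg q3[OF that] mult_nonneg_nonneg q) (use that in simp)
    moreover have "0 \<le> (\<Sum>k. r k * u ^ k)" by (intro suminf_nonneg r3[OF that] mult_nonneg_nonneg r) (use that in simp)
    moreover have "ennreal (\<Sum>k. q k * u ^ k) = ennreal (\<Sum>k. r k * u ^ k)"
      unfolding q3(2)[OF that, symmetric] r3(2)[OF that, symmetric] by (rule eq[OF that])
    ultimately have e: "(\<Sum>k. q k * u ^ k) = (\<Sum>k. r k * u ^ k)" by simp
    show "(\<Sum>k. d k * u ^ k) = 0" unfolding s suminf_diff[OF q3(1)[OF that] r3(1)[OF that], symmetric] e by simp
    show "summable (\<lambda>k. d k * u ^ k)" unfolding s by (rule summable_diff[OF q3(1)[OF that] r3(1)[OF that]])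
  qed
  have "d k = 0" for k
  proof (induction k rule: less_induct)
    case (less k)
    define h where "h u = (\<Sum>j. d (j + k) * u ^ j)" for u :: real
    have sh: "summable (\<lambda>j. d (j + k) * u ^ j)" if "0 < u" "u < 1" for u
    proof -
      have "summable (\<lambda>j. d (j + k) * u ^ (j + k))" using d(1)[OF that] by (rule summable_ignore_initial_segment)
      hence "summable (\<lambda>j. d (j + k) * u ^ j * u ^ k)" by (simp add: power_add mult.assoc)
      from summable_mult2[OF this, of "1 / u ^ k"] show ?thesis using that by simp
    qed
    have h0: "h u = 0" if "0 < u" "u < 1" for u
    proof -
      have 1: "0 = (\<Sum>j. d (j + k) * u ^ (j + k)) + (\<Sum>j<k. d j * u ^ j)"
        using suminf_split_initial_segment[OF d(1)[OF that], of k] unfolding d(2)[OF that] .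
      have 2: "(\<Sum>j<k. d j * u ^ j) = 0" by (rule sum.neutral) (simp add: less)
      have eq3: "u ^ k * (d (j + k) * u ^ j) = d (j + k) * u ^ (j + k)" for j by (simp add: power_add)
      have "(\<lambda>j. d (j + k) * u ^ j) sums h u" using summable_sums[OF sh[OF that]] by (simp only: h_def)
      from sums_mult[OF this, of "u ^ k"] have "(\<lambda>j. d (j + k) * u ^ (j + k)) sums (u ^ k * h u)" by (simp only: eq3)
      from sums_unique[OF this] 1 2 have "u ^ k * h u = 0" by linarith
      thus ?thesis using that by simp
    qed
    have h_eq: "h = (\<lambda>u. \<Sum>j. d (j + k) * u ^ j)" by (rule ext) (rule h_def)
    have "isCont h 0" unfolding h_eq by (rule isCont_powser[OF sh[of "1/2"]]) auto
    hence "(h \<longlongrightarrow> h 0) (at_right 0)" by (simp add: isCont_def filterlim_at_split)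
    moreover have "(h \<longlongrightarrow> 0) (at_right 0)"
      by (rule tendsto_eventually) (auto simp: eventually_at_right_field intro!: exI[of _ 1] h0)
    ultimately have "h 0 = 0" using tendsto_unique[of "at_right (0::real)" h] by simp
    thus "d k = 0" unfolding h_eq by (simp add: powser_zero)
  qed
  thus ?thesis by (intro ext) (simp add: d_def q(1) r(1))
qed

section \<open>Joint law of the origin and the other sites\<close>

definition rest_size :: "'i \<Rightarrow> ('i \<Rightarrow> nat multiset) \<Rightarrow> nat" where
  "rest_size o0 p = (\<Sum>x\<in>{x. p x \<noteq> {#}} - {o0}. mset_size (p x))"

definition valid_family :: "('i \<Rightarrow> nat multiset) \<Rightarrow> bool" where
  "valid_family p \<longleftrightarrow> finite {x. p x \<noteq> {#}} \<and> (\<forall>x. 0 \<notin># p x)"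

definition family_weight :: "real \<Rightarrow> ('i \<Rightarrow> real) \<Rightarrow> ('i \<Rightarrow> nat multiset) \<Rightarrow> real" where
  "family_weight \<theta> q p = (\<Prod>x | p x \<noteq> {#}. \<Prod>j\<in>set_mset (p x). 1 / fact (count (p x) j) * (\<theta> / real j * q x ^ j) ^ count (p x) j)"

lemma family_weight_nonneg:
  assumes "\<And>x. 0 \<le> q x" "\<theta> > 0" shows "0 \<le> family_weight \<theta> q p"
  unfolding family_weight_def using assms by (intro prod_nonneg ballI mult_nonneg_nonneg zero_le_power) auto

lemma finsupp_weight_site_weight:
  assumes q: "\<And>x. 0 \<le> q x" and "0 \<le> u" "0 \<le> z" "\<theta> > 0"
  shows "finsupp_weight {#} (\<lambda>x. site_weight \<theta> (q x * (if x = o0 then u else z))) p =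
    (if valid_family p then ennreal (family_weight \<theta> q p) else 0) * ennreal (z ^ rest_size o0 p) * ennreal (u ^ mset_size (p o0))"
proof (cases "valid_family p")
  case False
  have "finsupp_weight {#} (\<lambda>x. site_weight \<theta> (q x * (if x = o0 then u else z))) p = 0"
  proof (cases "finite {x. p x \<noteq> {#}}")
    case True
    with False obtain x where x: "0 \<in># p x" by (auto simp: valid_family_def)
    hence "x \<in> {x. p x \<noteq> {#}}" by auto
    moreover have "site_weight \<theta> (q x * (if x = o0 then u else z)) (p x) = 0" using x by (simp add: site_weight_def)
    ultimately have "(\<Prod>x | p x \<noteq> {#}. site_weight \<theta> (q x * (if x = o0 then u else z)) (p x)) = 0"
      by (intro prod_zero[OF True]) blast
    thus ?thesis unfolding finsupp_weight_def by simp
  next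
    case inf: False
    thus ?thesis unfolding finsupp_weight_def by simp
  qed
  thus ?thesis using False by simp
next
  case True
  define S where "S = {x. p x \<noteq> {#}}"
  have fin: "finite S" and np: "0 \<notin># p x" for x using True by (auto simp: valid_family_def S_def)
  define zz where "zz x = (if x = o0 then u else z)" for x
  have zz: "0 \<le> zz x" for x using assms by (simp add: zz_def)
  define f where "f x = (\<Prod>j\<in>set_mset (p x). 1 / fact (count (p x) j) * (\<theta> / real j * q x ^ j) ^ count (p x) j)" for x
  have f: "0 \<le> f x" for x unfolding f_def using assms by (intro prod_nonneg ballI mult_nonneg_nonneg zero_le_power) auto
  have sw: "site_weight \<theta> (q x * zz x) (p x) = ennreal (f x * zz x ^ mset_size (p x))" for x
  proof -
    have "site_weight \<theta> (q x * zz x) (p x) = site_weight \<theta> (q x) (p x) * ennreal (zz x ^ mset_size (p x))"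
      by (rule site_weight_mult_power[symmetric]) (use q zz assms in auto)
    also have "site_weight \<theta> (q x) (p x) = ennreal (f x)" using np by (simp add: site_weight_def f_def)
    also have "ennreal (f x) * ennreal (zz x ^ mset_size (p x)) = ennreal (f x * zz x ^ mset_size (p x))"
      by (rule ennreal_mult[symmetric]) (use f zz in auto)
    finally show ?thesis .
  qed
  have e1: "finsupp_weight {#} (\<lambda>x. site_weight \<theta> (q x * zz x)) p = (\<Prod>x\<in>S. ennreal (f x * zz x ^ mset_size (p x)))"
    unfolding finsupp_weight_def S_def[symmetric] sw using fin by simp
  have e2: "(\<Prod>x\<in>S. ennreal (f x * zz x ^ mset_size (p x))) = ennreal (\<Prod>x\<in>S. f x * zz x ^ mset_size (p x))"
    by (rule prod_ennreal) (use f zz in auto)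
  have e3: "(\<Prod>x\<in>S. f x * zz x ^ mset_size (p x)) = (\<Prod>x\<in>S. f x) * (\<Prod>x\<in>S. zz x ^ mset_size (p x))"
    by (rule prod.distrib)
  have e4: "(\<Prod>x\<in>S. zz x ^ mset_size (p x)) = z ^ rest_size o0 p * u ^ mset_size (p o0)"
  proof -
    have r: "(\<Prod>x\<in>S - {o0}. zz x ^ mset_size (p x)) = z ^ rest_size o0 p"
    proof -
      have "(\<Prod>x\<in>S - {o0}. zz x ^ mset_size (p x)) = (\<Prod>x\<in>S - {o0}. z ^ mset_size (p x))"
        by (rule prod.cong) (auto simp: zz_def)
      thus ?thesis unfolding rest_size_def S_def by (simp only: power_sum)
    qed
    show ?thesis
    proof (cases "o0 \<in> S")
      case True
      have "(\<Prod>x\<in>S. zz x ^ mset_size (p x)) = zz o0 ^ mset_size (p o0) * (\<Prod>x\<in>S - {o0}. zz x ^ mset_size (p x))"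
        by (rule prod.remove[OF fin True])
      thus ?thesis unfolding r by (simp add: zz_def)
    next
      case False
      hence "mset_size (p o0) = 0" "S - {o0} = S" by (auto simp: S_def mset_size_def)
      thus ?thesis using r by simp
    qed
  qed
  have e5: "ennreal ((\<Prod>x\<in>S. f x) * (z ^ rest_size o0 p * u ^ mset_size (p o0))) = ennreal (\<Prod>x\<in>S. f x) * ennreal (z ^ rest_size o0 p) * ennreal (u ^ mset_size (p o0))"
    using assms f by (simp add: ennreal_mult prod_nonneg mult.assoc)
  have e6: "(\<Prod>x\<in>S. f x) = family_weight \<theta> q p" by (simp add: family_weight_def f_def S_def)
  have "finsupp_weight {#} (\<lambda>x. site_weight \<theta> (q x * zz x)) p = ennreal (family_weight \<theta> q p) * ennreal (z ^ rest_size o0 p) * ennreal (u ^ mset_size (p o0))"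
    unfolding e1 e2 e3 e4 e5 unfolding e6 ..
  thus ?thesis using True by (simp only: zz_def if_True)
qed

definition family_sum :: "real \<Rightarrow> ('i \<Rightarrow> real) \<Rightarrow> 'i \<Rightarrow> nat \<Rightarrow> nat \<Rightarrow> ennreal" where
  "family_sum \<theta> q o0 k m = (\<integral>\<^sup>+p. (if valid_family p \<and> mset_size (p o0) = k \<and> rest_size o0 p = m then ennreal (family_weight \<theta> q p) else 0) \<partial>count_space UNIV)"

text \<open>Marking the particles at \<open>o0\<close> by \<open>u\<close> and all others by \<open>z\<close> multiplies \<open>q x\<close> by the marker, so the product formula
  applies to the marked weights; collecting equal powers gives the double series.\<close>

lemma family_sum_generating_function:
  assumes q: "\<And>x. 0 \<le> q x" and uz: "0 \<le> u" "0 \<le> z" and \<theta>: "\<theta> > 0"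
    and lt: "\<And>x. q x * (if x = o0 then u else z) < 1"
    and A: "\<And>m. finite (A m)" "incseq A" "(\<Union>m. A m) = UNIV"
  shows "(\<lambda>m. \<Prod>x\<in>A m. ennreal ((1 - q x * (if x = o0 then u else z)) powr (- \<theta>)))
    \<longlonglongrightarrow> (\<Sum>k. (\<Sum>m. family_sum \<theta> q o0 k m * ennreal (z ^ m)) * ennreal (u ^ k))"
proof -
  define g where "g x = site_weight \<theta> (q x * (if x = o0 then u else z))" for x
  define F where "F p = (if valid_family p then ennreal (family_weight \<theta> q p) else 0)" for p :: "'a \<Rightarrow> nat multiset"
  define ind where "ind k m p = (if mset_size (p o0) = k \<and> rest_size o0 p = m then 1 else 0 :: ennreal)" for k m and p :: "'a \<Rightarrow> nat multiset"
  have g1: "g x {#} = 1" for x by (simp add: g_def site_weight_def)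
  have gi: "(\<integral>\<^sup>+b. g x b \<partial>count_space UNIV) = ennreal ((1 - q x * (if x = o0 then u else z)) powr (- \<theta>))" for x
    unfolding g_def by (rule nn_integral_site_weight) (use lt[of x] q uz \<theta> in auto)
  have lim: "(\<lambda>m. \<Prod>x\<in>A m. \<integral>\<^sup>+b. g x b \<partial>count_space UNIV) \<longlonglongrightarrow> (\<integral>\<^sup>+p. finsupp_weight {#} g p \<partial>count_space UNIV)"
    by (rule nn_integral_finsupp_weight[where g=g and e="{#}", OF g1 A])
  have fs: "family_sum \<theta> q o0 k m = (\<integral>\<^sup>+p. F p * ind k m p \<partial>count_space UNIV)" for k m
    unfolding family_sum_def F_def ind_def by (rule nn_integral_cong) simp
  have pt: "finsupp_weight {#} g p = (\<Sum>k. \<Sum>m. F p * ind k m p * ennreal (z ^ m) * ennreal (u ^ k))" for p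
  proof -
    have inner: "(\<Sum>m. F p * ind k m p * ennreal (z ^ m) * ennreal (u ^ k)) = (if mset_size (p o0) = k then F p * ennreal (z ^ rest_size o0 p) * ennreal (u ^ k) else 0)" for k
    proof -
      have "(\<Sum>m. F p * ind k m p * ennreal (z ^ m) * ennreal (u ^ k)) = (\<Sum>m\<in>{rest_size o0 p}. F p * ind k m p * ennreal (z ^ m) * ennreal (u ^ k))"
        by (rule suminf_finite) (auto simp: ind_def)
      thus ?thesis by (simp add: ind_def)
    qed
    have "(\<Sum>k. \<Sum>m. F p * ind k m p * ennreal (z ^ m) * ennreal (u ^ k)) = (\<Sum>k\<in>{mset_size (p o0)}. if mset_size (p o0) = k then F p * ennreal (z ^ rest_size o0 p) * ennreal (u ^ k) else 0)"
      unfolding inner by (rule suminf_finite) auto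
    hence "(\<Sum>k. \<Sum>m. F p * ind k m p * ennreal (z ^ m) * ennreal (u ^ k)) = F p * ennreal (z ^ rest_size o0 p) * ennreal (u ^ mset_size (p o0))" by simp
    thus ?thesis unfolding g_def F_def finsupp_weight_site_weight[OF q uz \<theta>] by (rule sym)
  qed
  have "(\<integral>\<^sup>+p. finsupp_weight {#} g p \<partial>count_space UNIV) = (\<Sum>k. \<integral>\<^sup>+p. (\<Sum>m. F p * ind k m p * ennreal (z ^ m) * ennreal (u ^ k)) \<partial>count_space UNIV)"
    unfolding pt by (rule nn_integral_suminf) simp
  also have "\<dots> = (\<Sum>k. \<Sum>m. \<integral>\<^sup>+p. F p * ind k m p * ennreal (z ^ m) * ennreal (u ^ k) \<partial>count_space UNIV)"
    by (intro suminf_cong nn_integral_suminf) simp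
  also have "\<dots> = (\<Sum>k. (\<Sum>m. family_sum \<theta> q o0 k m * ennreal (z ^ m)) * ennreal (u ^ k))"
    unfolding fs by (simp add: nn_integral_multc)
  finally have fin: "(\<integral>\<^sup>+p. finsupp_weight {#} g p \<partial>count_space UNIV) = (\<Sum>k. (\<Sum>m. family_sum \<theta> q o0 k m * ennreal (z ^ m)) * ennreal (u ^ k))" .
  show ?thesis using lim unfolding gi fin .
qed

text \<open>The coefficients of \<open>(1 - u) powr (- \<theta>)\<close>, that is the unnormalised negative binomial weights.\<close>

definition negbin :: "real \<Rightarrow> nat \<Rightarrow> real" where "negbin \<theta> k = pochhammer \<theta> k / fact k"

lemma negbin_pos: "\<theta> > 0 \<Longrightarrow> negbin \<theta> k > 0"
  unfolding negbin_def by (intro divide_pos_pos pochhammer_pos) simp_all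

lemma negbin_sums:
  assumes "0 \<le> u" "u < 1"
  shows "(\<lambda>k. negbin \<theta> k * u ^ k) sums ((1 - u) powr (- \<theta>))"
proof -
  have e: "((- \<theta>) gchoose k) * (- u) ^ k = negbin \<theta> k * u ^ k" for k
  proof -
    have "(- u) ^ k = (- 1) ^ k * u ^ k" by (metis mult_minus1 power_mult_distrib)
    moreover have "(- 1 :: real) ^ k * (- 1) ^ k = 1" by (metis minus_one_mult_self)
    ultimately show ?thesis unfolding negbin_def gbinomial_pochhammer by simp
  qed
  have "(\<lambda>k. ((- \<theta>) gchoose k) * (- u) ^ k) sums (1 + (- u)) powr (- \<theta>)"
    by (rule Generalised_Binomial_Theorem.gen_binomial_real) (use assms in simp)
  thus ?thesis unfolding e by simp
qed

context gamma_field
begin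

text \<open>The probability of the value \<open>m\<close> for a Poisson variable with random mean \<open>gamma_total a\<close>. It is extended-valued here
  because it is compared with sums of weights; its real version is \<open>mixed_prob\<close>.\<close>

definition mixed_poisson :: "('i \<Rightarrow> real) \<Rightarrow> nat \<Rightarrow> ennreal" where
  "mixed_poisson a m = (\<integral>\<^sup>+\<omega>. ennreal (exp (- gamma_total a \<omega>) * gamma_total a \<omega> ^ m / fact m) \<partial>M)"

lemma mixed_poisson_generating_function:
  assumes "0 \<le> z"
  shows "(\<Sum>m. mixed_poisson a m * ennreal (z ^ m)) = (\<integral>\<^sup>+\<omega>. ennreal (exp (gamma_total a \<omega> * (z - 1))) \<partial>M)"
proof -
  define t where "t m \<omega> = ennreal (exp (- gamma_total a \<omega>) * gamma_total a \<omega> ^ m / fact m)" for m \<omega>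
  have [measurable]: "t m \<in> borel_measurable M" for m unfolding t_def by measurable
  have "(\<Sum>m. mixed_poisson a m * ennreal (z ^ m)) = (\<Sum>m. \<integral>\<^sup>+\<omega>. t m \<omega> * ennreal (z ^ m) \<partial>M)"
    unfolding mixed_poisson_def t_def[symmetric] by (simp add: nn_integral_multc)
  also have "\<dots> = (\<integral>\<^sup>+\<omega>. (\<Sum>m. t m \<omega> * ennreal (z ^ m)) \<partial>M)"
    by (rule nn_integral_suminf[symmetric]) measurable
  also have "\<dots> = (\<integral>\<^sup>+\<omega>. ennreal (exp (gamma_total a \<omega> * (z - 1))) \<partial>M)"
  proof (rule nn_integral_cong)
    fix \<omega>
    define y where "y = gamma_total a \<omega>"
    have y: "0 \<le> y" by (simp add: y_def gamma_total_nonneg)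
    have "(\<lambda>m. (y * z) ^ m /\<^sub>R fact m) sums exp (y * z)" by (rule exp_converges)
    from sums_mult[OF this, of "exp (- y)"] have s: "(\<lambda>m. exp (- y) * ((y * z) ^ m /\<^sub>R fact m)) sums (exp (- y) * exp (y * z))" .
    have e1: "exp (- y) * exp (y * z) = exp (y * (z - 1))" unfolding exp_add[symmetric] by (simp add: algebra_simps)
    have e2: "t m \<omega> * ennreal (z ^ m) = ennreal (exp (- y) * ((y * z) ^ m /\<^sub>R fact m))" for m
    proof -
      have "t m \<omega> * ennreal (z ^ m) = ennreal (exp (- y) * y ^ m / fact m * z ^ m)"
        unfolding t_def y_def[symmetric] using y assms by (intro ennreal_mult[symmetric]) simp_all
      also have "exp (- y) * y ^ m / fact m * z ^ m = exp (- y) * ((y * z) ^ m /\<^sub>R fact m)"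
        by (simp add: power_mult_distrib inverse_eq_divide)
      finally show ?thesis .
    qed
    show "(\<Sum>m. t m \<omega> * ennreal (z ^ m)) = ennreal (exp (gamma_total a \<omega> * (z - 1)))"
      unfolding e2 y_def[symmetric] e1[symmetric]
      by (rule suminf_ennreal_eq[OF _ s]) (use y assms in simp)
  qed
  finally show ?thesis .
qed

text \<open>Away from \<open>o0\<close> the generating function is the product of the factors \<open>(1 - q x * z) powr (- \<theta>)\<close>. Each of them equals
  \<open>(1 + (1 - z) * a x) powr (- \<theta>)\<close>, a Laplace transform of \<open>a x * G x\<close> at \<open>1 - z\<close>, times the constant
  \<open>(1 + a x) powr \<theta>\<close>. The constants multiply to \<open>C\<close>, and the Laplace transforms to the generating function of the mixed
  Poisson law. Uniqueness of power series, first in \<open>u\<close> and then in \<open>z\<close>, identifies the coefficients.\<close>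

lemma family_sum_eq:
  assumes q: "q o0 = 1" "\<And>x. x \<noteq> o0 \<Longrightarrow> 0 < q x \<and> q x < 1"
    and a: "\<And>x. a x = (if x = o0 then 0 else q x / (1 - q x))" and sa: "a summable_on UNIV" "(\<lambda>x. (a x)\<^sup>2) summable_on UNIV"
  obtains C where "C > 0" and "\<And>k m. family_sum \<theta> q o0 k m = ennreal (C * negbin \<theta> k) * mixed_poisson a m"
proof -
  have a0: "0 \<le> a x" for x using q(2)[of x] by (cases "x = o0") (auto simp: a intro!: divide_nonneg_pos)
  have q0: "0 \<le> q x" for x using q(1) q(2)[of x] by (cases "x = o0") auto
  \<comment> \<open>since \<open>1 + a x = 1 / (1 - q x)\<close>, these are the partition functions at \<open>z = 1\<close> of finite domains without the origin\<close>
  define Nm where "Nm m = (\<Prod>x\<in>A m. (1 + a x) powr \<theta>)" for m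
  have Nm1: "1 \<le> Nm m" for m
    unfolding Nm_def using a0 \<theta> by (intro prod_ge_1) (auto intro!: ge_one_powr_ge_zero)
  have Nm_mono: "incseq Nm"
  proof (rule incseq_SucI)
    fix m
    show "Nm m \<le> Nm (Suc m)" unfolding Nm_def
      by (rule prod_mono2) (use A_finite incseq_SucD[OF A_incseq] a0 \<theta> in \<open>auto intro!: ge_one_powr_ge_zero\<close>)
  qed
  have Nm_le: "Nm m \<le> exp (\<theta> * (\<Sum>\<^sub>\<infinity>x. a x))" for m
  proof -
    have "Nm m \<le> (\<Prod>x\<in>A m. exp (\<theta> * a x))" unfolding Nm_def
    proof (rule prod_mono, safe)
      fix x
      have "(1 + a x) powr \<theta> \<le> exp (a x) powr \<theta>" using a0[of x] \<theta> by (intro powr_mono2) (auto simp: exp_ge_add_one_self)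
      also have "exp (a x) powr \<theta> = exp (\<theta> * a x)" by (simp add: powr_def)
      finally show "(1 + a x) powr \<theta> \<le> exp (\<theta> * a x)" .
    qed simp
    also have "\<dots> = exp (\<theta> * (\<Sum>x\<in>A m. a x))" by (simp add: exp_sum[OF A_finite, symmetric] sum_distrib_left)
    also have "\<dots> \<le> exp (\<theta> * (\<Sum>\<^sub>\<infinity>x. a x))" using \<theta> sum_A_le_infsum[OF sa(1) a0] by simp
    finally show ?thesis .
  qed
  obtain C where C: "Nm \<longlonglongrightarrow> C" using incseq_convergent[OF Nm_mono] Nm_le by blast
  have C1: "1 \<le> C" by (rule LIMSEQ_le_const[OF C]) (use Nm1 in auto)
  define B where "B z = (\<integral>\<^sup>+\<omega>. ennreal (exp (gamma_total a \<omega> * (z - 1))) \<partial>M)" for z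
  have B_fin: "B z < \<infinity>" if "z < 1" for z
  proof -
    have "B z \<le> (\<integral>\<^sup>+\<omega>. 1 \<partial>M)" unfolding B_def
    proof (rule nn_integral_mono)
      fix \<omega>
      have "gamma_total a \<omega> * (z - 1) \<le> 0" using that gamma_total_nonneg[of a \<omega>] by (intro mult_nonneg_nonpos) auto
      thus "ennreal (exp (gamma_total a \<omega> * (z - 1))) \<le> 1" by (simp add: ennreal_le_1)
    qed
    also have "\<dots> = 1" by (simp add: emeasure_space_1)
    finally show ?thesis by (rule le_less_trans) simp
  qed
  have key: "(\<Sum>k. (\<Sum>m. family_sum \<theta> q o0 k m * ennreal (z ^ m)) * ennreal (u ^ k)) = ennreal ((1 - u) powr (- \<theta>)) * (B z * ennreal C)"
    if u: "0 < u" "u < 1" and z: "0 < z" "z < 1" for u z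
  proof (rule LIMSEQ_unique)
    show "(\<lambda>m. \<Prod>x\<in>A m. ennreal ((1 - q x * (if x = o0 then u else z)) powr (- \<theta>)))
      \<longlonglongrightarrow> (\<Sum>k. (\<Sum>m. family_sum \<theta> q o0 k m * ennreal (z ^ m)) * ennreal (u ^ k))"
    proof (rule family_sum_generating_function[OF q0 _ _ \<theta> _ A_finite A_incseq A_UNIV])
      show "q x * (if x = o0 then u else z) < 1" for x
      proof (cases "x = o0")
        case False
        have "q x * z < 1 * 1" using q(2)[OF False] z by (intro mult_strict_mono) auto
        thus ?thesis using False by simp
      qed (use u q(1) in simp)
    qed (use u z in auto)
    have f: "(1 - q x * (if x = o0 then u else z)) powr (- \<theta>) = (if x = o0 then (1 - u) powr (- \<theta>) else 1) * ((1 + (1 - z) * a x) powr (- \<theta>) * (1 + a x) powr \<theta>)" for x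
    proof (cases "x = o0")
      case False
      define Q where "Q = q x"
      have Q: "0 < Q" "Q < 1" using q(2)[OF False] by (auto simp: Q_def)
      have ax: "a x = Q / (1 - Q)" unfolding a Q_def using False by (rule if_not_P)
      have r: "Q / (1 - Q) * (1 - Q) = Q" using Q by (intro nonzero_eq_divide_eq[THEN iffD1, OF _ refl]) linarith
      have "(1 + Q / (1 - Q)) * (1 - Q) = 1" unfolding distrib_right r by simp
      hence e: "1 + a x = inverse (1 - Q)" unfolding ax by (metis inverse_unique mult.commute)
      have r1: "(1 + (1 - z) * (Q / (1 - Q))) * (1 - Q) = 1 * (1 - Q) + (1 - z) * (Q / (1 - Q) * (1 - Q))"
        unfolding distrib_right by (simp only: mult.assoc)
      have r2: "1 * (1 - Q) + (1 - z) * Q = 1 - Q * z" by (simp add: algebra_simps)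
      have e2: "1 - Q * z = (1 + (1 - z) * a x) * (1 - Q)" unfolding ax r1 r r2 ..
      have "(1 + a x) powr \<theta> = (1 - Q) powr (- \<theta>)" unfolding e powr_minus by (rule inverse_powr)
      moreover have "(1 - Q * z) powr (- \<theta>) = (1 + (1 - z) * a x) powr (- \<theta>) * (1 - Q) powr (- \<theta>)"
        unfolding e2 by (rule powr_mult)
      ultimately show ?thesis using False by (simp only: Q_def if_False mult_1)
    qed (simp add: a q(1))
    obtain m0 where m0: "o0 \<in> A m0" using A_UNIV by blast
    have "\<forall>\<^sub>F m in sequentially. (\<Prod>x\<in>A m. ennreal ((1 - q x * (if x = o0 then u else z)) powr (- \<theta>)))
        = ennreal ((1 - u) powr (- \<theta>)) * (ennreal (\<Prod>x\<in>A m. (1 + (1 - z) * a x) powr (- \<theta>)) * ennreal (Nm m))"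
    proof (rule eventually_sequentiallyI[of m0])
      fix m assume "m0 \<le> m"
      hence o: "o0 \<in> A m" using m0 incseqD[OF A_incseq] by blast
      have "(\<Prod>x\<in>A m. ennreal ((1 - q x * (if x = o0 then u else z)) powr (- \<theta>))) = ennreal (\<Prod>x\<in>A m. (1 - q x * (if x = o0 then u else z)) powr (- \<theta>))"
        by (rule prod_ennreal) simp
      also have "(\<Prod>x\<in>A m. (1 - q x * (if x = o0 then u else z)) powr (- \<theta>)) = (1 - u) powr (- \<theta>) * ((\<Prod>x\<in>A m. (1 + (1 - z) * a x) powr (- \<theta>)) * Nm m)"
        unfolding f prod.distrib Nm_def using o by (simp add: prod.delta[OF A_finite])
      also have "ennreal \<dots> = ennreal ((1 - u) powr (- \<theta>)) * (ennreal (\<Prod>x\<in>A m. (1 + (1 - z) * a x) powr (- \<theta>)) * ennreal (Nm m))"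
        using Nm1[of m] by (simp add: ennreal_mult prod_nonneg)
      finally show "(\<Prod>x\<in>A m. ennreal ((1 - q x * (if x = o0 then u else z)) powr (- \<theta>))) = \<dots>" .
    qed
    moreover have "(\<lambda>m. ennreal ((1 - u) powr (- \<theta>)) * (ennreal (\<Prod>x\<in>A m. (1 + (1 - z) * a x) powr (- \<theta>)) * ennreal (Nm m)))
      \<longlonglongrightarrow> ennreal ((1 - u) powr (- \<theta>)) * (B z * ennreal C)"
    proof (intro ennreal_tendsto_cmult tendsto_mult_ennreal tendsto_ennrealI C)
      have "(\<integral>\<^sup>+\<omega>. ennreal (exp (- (1 - z) * gamma_total a \<omega>)) \<partial>M) = B z"
        unfolding B_def by (intro nn_integral_cong) (simp add: algebra_simps)
      thus "(\<lambda>m. ennreal (\<Prod>x\<in>A m. (1 + (1 - z) * a x) powr (- \<theta>))) \<longlonglongrightarrow> B z"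
        using gamma_total_laplace[OF a0 sa, of "1 - z"] z by simp
    qed (use B_fin[of z] z C1 in auto)
    ultimately show "(\<lambda>m. \<Prod>x\<in>A m. ennreal ((1 - q x * (if x = o0 then u else z)) powr (- \<theta>))) \<longlonglongrightarrow> ennreal ((1 - u) powr (- \<theta>)) * (B z * ennreal C)"
      by (simp only: tendsto_cong)
  qed
  have nb: "(\<Sum>k. ennreal (negbin \<theta> k) * ennreal (u ^ k)) = ennreal ((1 - u) powr (- \<theta>))" if "0 < u" "u < 1" for u
  proof -
    have "ennreal (negbin \<theta> k) * ennreal (u ^ k) = ennreal (negbin \<theta> k * u ^ k)" for k
      using negbin_pos[OF \<theta>, of k] that by (intro ennreal_mult[symmetric]) auto
    moreover have "(\<Sum>k. ennreal (negbin \<theta> k * u ^ k)) = ennreal ((1 - u) powr (- \<theta>))"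
    proof (rule suminf_ennreal_eq)
      show "0 \<le> negbin \<theta> k * u ^ k" for k using negbin_pos[OF \<theta>, of k] that by simp
      show "(\<lambda>k. negbin \<theta> k * u ^ k) sums ((1 - u) powr (- \<theta>))" by (rule negbin_sums) (use that in simp_all)
    qed
    ultimately show ?thesis by (simp only:)
  qed
  have Bgf: "(\<Sum>m. mixed_poisson a m * ennreal (z ^ m)) = B z" if "0 < z" for z
    unfolding B_def by (rule mixed_poisson_generating_function) (use that in simp)
  have step1: "(\<Sum>m. family_sum \<theta> q o0 k m * ennreal (z ^ m)) = ennreal (negbin \<theta> k) * (B z * ennreal C)" if z: "0 < z" "z < 1" for z k
  proof -
    have "(\<lambda>k. \<Sum>m. family_sum \<theta> q o0 k m * ennreal (z ^ m)) = (\<lambda>k. ennreal (negbin \<theta> k) * (B z * ennreal C))"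
    proof (rule nonneg_power_series_unique)
      fix u :: real assume u: "0 < u" "u < 1"
      have r: "(\<Sum>k. ennreal (negbin \<theta> k) * (B z * ennreal C) * ennreal (u ^ k)) = ennreal ((1 - u) powr (- \<theta>)) * (B z * ennreal C)"
      proof -
        have "(\<Sum>k. ennreal (negbin \<theta> k) * (B z * ennreal C) * ennreal (u ^ k)) = (\<Sum>k. ennreal (negbin \<theta> k) * ennreal (u ^ k) * (B z * ennreal C))"
          by (intro suminf_cong) (simp only: mult_ac)
        thus ?thesis unfolding ennreal_suminf_multc nb[OF u] .
      qed
      show "(\<Sum>k. (\<Sum>m. family_sum \<theta> q o0 k m * ennreal (z ^ m)) * ennreal (u ^ k)) = (\<Sum>k. ennreal (negbin \<theta> k) * (B z * ennreal C) * ennreal (u ^ k))"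
        unfolding r by (rule key[OF u z])
      show "(\<Sum>k. ennreal (negbin \<theta> k) * (B z * ennreal C) * ennreal (u ^ k)) < \<infinity>"
        unfolding r using B_fin[OF z(2)] by (simp add: ennreal_mult_less_top)
    qed
    from fun_cong[OF this, of k] show ?thesis .
  qed
  have res: "family_sum \<theta> q o0 k m = ennreal (C * negbin \<theta> k) * mixed_poisson a m" for k m
  proof -
    have Ck: "ennreal (C * negbin \<theta> k) = ennreal (negbin \<theta> k) * ennreal C"
      using C1 negbin_pos[OF \<theta>, of k] by (simp add: ennreal_mult mult.commute)
    have "(\<lambda>m. family_sum \<theta> q o0 k m) = (\<lambda>m. ennreal (C * negbin \<theta> k) * mixed_poisson a m)"
    proof (rule nonneg_power_series_unique)
      fix z :: real assume z: "0 < z" "z < 1"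
      have r: "(\<Sum>m. ennreal (C * negbin \<theta> k) * mixed_poisson a m * ennreal (z ^ m)) = ennreal (negbin \<theta> k) * (B z * ennreal C)"
        unfolding mult.assoc ennreal_suminf_cmult Bgf[OF z(1)] Ck by (simp only: mult_ac)
      show "(\<Sum>m. family_sum \<theta> q o0 k m * ennreal (z ^ m)) = (\<Sum>m. ennreal (C * negbin \<theta> k) * mixed_poisson a m * ennreal (z ^ m))"
        unfolding r by (rule step1[OF z])
      show "(\<Sum>m. ennreal (C * negbin \<theta> k) * mixed_poisson a m * ennreal (z ^ m)) < \<infinity>"
        unfolding r using B_fin[OF z(2)] by (simp add: ennreal_mult_less_top)
    qed
    from fun_cong[OF this, of m] show ?thesis .
  qed
  have Cpos: "0 < C" using C1 by linarith
  show ?thesis using that[of C] Cpos res by blast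
qed

end

section \<open>Reweighting by the occupation of the origin\<close>

text \<open>This is Gauss's product formula for the Gamma function.\<close>

lemma negbin_asymptotics:
  assumes "\<theta> > 0"
  shows "(\<lambda>m. negbin \<theta> m * real m powr (1 - \<theta>)) \<longlonglongrightarrow> 1 / Gamma \<theta>"
proof -
  have G: "Gamma \<theta> \<noteq> 0" using Gamma_real_pos[OF assms] by simp
  have "(\<lambda>m. inverse (Gamma_series' \<theta> m)) \<longlonglongrightarrow> inverse (Gamma \<theta>)"
    by (intro tendsto_inverse Gamma_series'_LIMSEQ G)
  moreover have "\<forall>\<^sub>F m in sequentially. inverse (Gamma_series' \<theta> m) = negbin \<theta> m * real m powr (1 - \<theta>)"
  proof (rule eventually_sequentiallyI[of 1])
    fix m :: nat assume m: "1 \<le> m"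
    then obtain l where l: "m = Suc l" by (cases m) auto
    have f: "fact m = real m * fact (m - 1)" unfolding l by simp
    have p: "real m powr (1 - \<theta>) = real m / real m powr \<theta>" using m by (simp add: powr_diff)
    have e: "exp (\<theta> * ln (real m)) = real m powr \<theta>" using m by (simp add: powr_def)
    have "Gamma_series' \<theta> m = fact (m - 1) * real m powr \<theta> / pochhammer \<theta> m"
      unfolding Gamma_series'_def using e by simp
    thus "inverse (Gamma_series' \<theta> m) = negbin \<theta> m * real m powr (1 - \<theta>)"
      unfolding negbin_def p f using m by simp
  qed
  ultimately show ?thesis using tendsto_cong[of "\<lambda>m. inverse (Gamma_series' \<theta> m)"] by (simp add: inverse_eq_divide)
qed

lemma negbin_le_power:
  assumes "\<theta> > 0"
  obtains B where "B > 0" and "\<And>m. negbin \<theta> m \<le> B * (real m + 1) powr \<theta>"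
proof -
  have "Bseq (\<lambda>m. negbin \<theta> m * real m powr (1 - \<theta>))"
    by (rule convergent_imp_Bseq) (use negbin_asymptotics[OF assms] in \<open>auto simp: convergent_def\<close>)
  then obtain K where K: "\<And>m. norm (negbin \<theta> m * real m powr (1 - \<theta>)) \<le> K" unfolding Bseq_def by blast
  define B where "B = max 1 K"
  have "negbin \<theta> m \<le> B * (real m + 1) powr \<theta>" for m
  proof (cases "m = 0")
    case True
    thus ?thesis by (simp add: negbin_def B_def)
  next
    case False
    hence m: "0 < real m" "1 \<le> real m" by simp_all
    have c: "real m powr (1 - \<theta>) * real m powr (\<theta> - 1) = 1" using m by (simp add: powr_add[symmetric])
    have "negbin \<theta> m * real m powr (1 - \<theta>) \<le> B" using K[of m] unfolding B_def real_norm_def abs_le_iff by linarith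
    hence "(negbin \<theta> m * real m powr (1 - \<theta>)) * real m powr (\<theta> - 1) \<le> B * real m powr (\<theta> - 1)"
      by (rule mult_right_mono) simp
    hence "negbin \<theta> m \<le> B * real m powr (\<theta> - 1)" unfolding mult.assoc c by simp
    also have "\<dots> \<le> B * (real m + 1) powr \<theta>"
    proof (rule mult_left_mono)
      have "real m powr (\<theta> - 1) \<le> real m powr \<theta>" using m by (intro powr_mono) auto
      also have "\<dots> \<le> (real m + 1) powr \<theta>" using m assms by (intro powr_mono2) auto
      finally show "real m powr (\<theta> - 1) \<le> (real m + 1) powr \<theta>" .
    qed (simp add: B_def)
    finally show ?thesis .
  qed
  moreover have "B > 0" by (simp add: B_def)
  ultimately show ?thesis using that by blast
qed

lemma polynomial_times_exp_tendsto_0: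
  fixes B g r d \<theta> c e :: real
  assumes "B > 0" "g > 0" "r > 0" "d > 0" "\<theta> > 0" "c > 0" "e > 0"
  shows "((\<lambda>x. (1 + B * (r * x powr d + 1) powr \<theta> * (g * (r * x powr d))) * exp (- (c * x powr e))) \<longlongrightarrow> 0) at_top"
  using assms by real_asymp

text \<open>The weight of the origin when the other sites hold \<open>s\<close> of \<open>n\<close> particles, divided by its asymptotic value at the typical
  occupation \<open>D\<close> of the origin.\<close>

definition tilt :: "real \<Rightarrow> nat \<Rightarrow> real \<Rightarrow> nat \<Rightarrow> real" where
  "tilt \<theta> n D s = (if s \<le> n then negbin \<theta> (n - s) / (D powr (\<theta> - 1) / Gamma \<theta>) else 0)"

text \<open>If \<open>(n - s) / D\<close> is close to \<open>1\<close> and \<open>n - s\<close> is large, then \<open>tilt\<close> is close to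
  \<open>((n - s) / D) powr (\<theta> - 1)\<close>, by the asymptotics of \<open>negbin\<close>.\<close>

lemma tilt_near_one:
  assumes \<theta>: "\<theta> > 0" and \<epsilon>: "0 < \<epsilon>"
  obtains \<eta> R where "0 < \<eta>" "\<eta> < 1" "\<And>n s D. R \<le> D \<Longrightarrow> \<bar>real n - real s - D\<bar> \<le> \<eta> * D \<Longrightarrow> \<bar>tilt \<theta> n D s - 1\<bar> \<le> \<epsilon>"
proof -
  define h where "h m = negbin \<theta> m * real m powr (1 - \<theta>)" for m
  have G: "Gamma \<theta> > 0" using Gamma_real_pos[OF \<theta>] .
  define \<epsilon>' where "\<epsilon>' = min 1 (\<epsilon> / 3)"
  have e': "0 < \<epsilon>'" "\<epsilon>' \<le> 1" "3 * \<epsilon>' \<le> \<epsilon>" using \<epsilon> by (auto simp: \<epsilon>'_def)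
  have "(\<lambda>m. h m * Gamma \<theta>) \<longlonglongrightarrow> 1 / Gamma \<theta> * Gamma \<theta>"
    unfolding h_def by (intro tendsto_intros negbin_asymptotics \<theta>)
  hence "(\<lambda>m. h m * Gamma \<theta>) \<longlonglongrightarrow> 1" using G by simp
  from LIMSEQ_D[OF this e'(1)] obtain M where M: "\<And>m. m \<ge> M \<Longrightarrow> \<bar>h m * Gamma \<theta> - 1\<bar> < \<epsilon>'" by auto
  have "isCont (\<lambda>r::real. r powr (\<theta> - 1)) 1" by (intro continuous_intros) auto
  hence "((\<lambda>r::real. r powr (\<theta> - 1)) \<longlongrightarrow> 1 powr (\<theta> - 1)) (at 1)" by (rule isContD)
  from LIM_D[OF this e'(1)] obtain \<eta>0 where \<eta>0: "\<eta>0 > 0" "\<And>r. r \<noteq> 1 \<Longrightarrow> \<bar>r - 1\<bar> < \<eta>0 \<Longrightarrow> \<bar>r powr (\<theta> - 1) - 1\<bar> < \<epsilon>'"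
    by auto
  define \<eta> where "\<eta> = min (1/2) (\<eta>0 / 2)"
  have \<eta>: "0 < \<eta>" "\<eta> \<le> 1/2" "\<eta> < \<eta>0" using \<eta>0(1) by (auto simp: \<eta>_def)
  define R where "R = 2 * real M + 2"
  have "\<bar>tilt \<theta> n D s - 1\<bar> \<le> \<epsilon>" if D: "R \<le> D" and near: "\<bar>real n - real s - D\<bar> \<le> \<eta> * D" for n s D
  proof -
    have D0: "0 < D" using D by (simp add: R_def)
    have "\<eta> * D \<le> 1/2 * D" using \<eta>(2) D0 by (intro mult_right_mono) auto
    hence ns: "D / 2 \<le> real n - real s" using near by linarith
    hence sn: "s < n" using D0 by linarith
    define m where "m = n - s"
    have rm: "real m = real n - real s" using sn by (simp add: m_def of_nat_diff)
    have mM: "M \<le> m" using ns D unfolding rm[symmetric] R_def by linarith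
    have m0: "0 < real m" using ns D0 rm by linarith
    define r where "r = real m / D"
    have r1: "\<bar>r - 1\<bar> \<le> \<eta>"
    proof -
      have "r - 1 = (real n - real s - D) / D" using D0 by (simp add: r_def rm diff_divide_distrib)
      hence "\<bar>r - 1\<bar> = \<bar>real n - real s - D\<bar> / D" using D0 by simp
      also have "\<dots> \<le> \<eta>" using near D0 by (simp add: pos_divide_le_eq)
      finally show ?thesis .
    qed
    have y: "\<bar>r powr (\<theta> - 1) - 1\<bar> \<le> \<epsilon>'"
    proof (cases "r = 1")
      case False thus ?thesis using \<eta>0(2)[OF False] r1 \<eta>(3) by force
    qed (use e' in simp)
    have x: "\<bar>h m * Gamma \<theta> - 1\<bar> \<le> \<epsilon>'" using M[OF mM] by simp
    have c: "real m powr (1 - \<theta>) * real m powr (\<theta> - 1) = 1" using m0 by (simp add: powr_add[symmetric])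
    have nb: "negbin \<theta> m = h m * real m powr (\<theta> - 1)" unfolding h_def mult.assoc c by simp
    have rp: "r powr (\<theta> - 1) = real m powr (\<theta> - 1) / D powr (\<theta> - 1)" unfolding r_def by (rule powr_divide)
    have "tilt \<theta> n D s = negbin \<theta> m / (D powr (\<theta> - 1) / Gamma \<theta>)" using sn by (simp add: tilt_def m_def)
    hence t: "tilt \<theta> n D s = (h m * Gamma \<theta>) * r powr (\<theta> - 1)" unfolding nb rp by simp
    define X where "X = h m * Gamma \<theta>"
    define Y where "Y = r powr (\<theta> - 1)"
    have "X * Y - 1 = (X - 1) * Y + (Y - 1)" by (simp add: algebra_simps)
    hence "\<bar>X * Y - 1\<bar> \<le> \<bar>X - 1\<bar> * \<bar>Y\<bar> + \<bar>Y - 1\<bar>" using abs_triangle_ineq[of "(X - 1) * Y" "Y - 1"] by (simp add: abs_mult)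
    also have "\<bar>X - 1\<bar> * \<bar>Y\<bar> \<le> \<epsilon>' * 2"
      using x y e' unfolding X_def[symmetric] Y_def[symmetric] by (intro mult_mono) auto
    finally have "\<bar>X * Y - 1\<bar> \<le> \<epsilon>' * 2 + \<epsilon>'" using y unfolding Y_def[symmetric] by linarith
    thus ?thesis unfolding t X_def[symmetric] Y_def[symmetric] using e'(3) by linarith
  qed
  thus ?thesis using that[of \<eta> R] \<eta> by simp
qed

text \<open>For \<open>s\<close> within \<open>\<eta> * D\<close> of its mean the tilt is within \<open>\<epsilon>\<close> of \<open>1\<close>. For the other \<open>s\<close> it is at most a power of
  \<open>L\<close>, called \<open>K\<close>, while the exponentials on the right exceed \<open>exp (c * L powr (d - \<delta>))\<close>. The power of \<open>L\<close>
  is genuine for \<open>\<theta> < 1\<close>, where the tilt is of order \<open>D powr (1 - \<theta>)\<close> at \<open>s = n\<close>.\<close>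

lemma tilt_bound:
  fixes L D :: "nat \<Rightarrow> real" and n :: "nat \<Rightarrow> nat" and d :: nat
  assumes \<theta>: "\<theta> > 0" and \<epsilon>: "0 < \<epsilon>" and L: "\<And>k. L k > 0" "filterlim L at_top sequentially"
    and d: "0 < \<delta>" "\<delta> < real d" and \<sigma>: "\<sigma> > 0" and \<kappa>: "\<kappa> > 0" and \<rho>: "\<rho> > 0"
    and n: "\<And>k. real (n k) = \<rho> * L k ^ d"
    and D: "\<forall>\<^sub>F k in sequentially. \<kappa> * L k ^ d \<le> D k" "\<And>k. D k \<le> \<rho> * L k ^ d"
  obtains B where "B \<longlonglongrightarrow> 0" and "\<And>k. 0 \<le> B k"
    and "\<forall>\<^sub>F k in sequentially. \<forall>s. \<bar>tilt \<theta> (n k) (D k) s - 1\<bar> \<le> \<epsilon> + B k * (exp (\<sigma> / L k powr \<delta> * (real s - (real (n k) - D k))) + exp (- (\<sigma> / L k powr \<delta>) * (real s - (real (n k) - D k))))"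
proof -
  obtain \<eta> R where \<eta>: "0 < \<eta>" "\<eta> < 1" and near: "\<And>n s D. R \<le> D \<Longrightarrow> \<bar>real n - real s - D\<bar> \<le> \<eta> * D \<Longrightarrow> \<bar>tilt \<theta> n D s - 1\<bar> \<le> \<epsilon>"
    using tilt_near_one[OF \<theta> \<epsilon>] by blast
  obtain B0 where B0: "B0 > 0" "\<And>m. negbin \<theta> m \<le> B0 * (real m + 1) powr \<theta>" using negbin_le_power[OF \<theta>] by blast
  have G: "Gamma \<theta> > 0" using Gamma_real_pos[OF \<theta>] .
  have d0: "0 < real d" using d by linarith
  have Ld: "L k powr real d = L k ^ d" for k using L(1)[of k] by (rule powr_realpow)
  define K where "K x = 1 + B0 * (\<rho> * x powr real d + 1) powr \<theta> * (Gamma \<theta> * (\<rho> * x powr real d))" for x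
  define c where "c = \<sigma> * (\<eta> * \<kappa>)"
  have c: "c > 0" using \<sigma> \<eta> \<kappa> by (simp add: c_def)
  define B where "B k = K (L k) * exp (- (c * L k powr (real d - \<delta>)))" for k
  have "((\<lambda>x. K x * exp (- (c * x powr (real d - \<delta>)))) \<longlongrightarrow> 0) at_top"
    unfolding K_def by (rule polynomial_times_exp_tendsto_0) (use B0 G \<rho> d0 \<theta> c d in auto)
  hence Blim: "B \<longlonglongrightarrow> 0" unfolding B_def by (rule filterlim_compose[OF _ L(2)])
  have K0: "0 \<le> K (L k)" for k unfolding K_def using B0(1) G \<rho> by (intro add_nonneg_nonneg mult_nonneg_nonneg) auto
  have Bn: "0 \<le> B k" for k unfolding B_def using K0 by simp
  have DL: "filterlim (\<lambda>k. \<kappa> * L k ^ d) at_top sequentially"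
    using d0 by (intro filterlim_tendsto_pos_mult_at_top[OF tendsto_const \<kappa>] filterlim_pow_at_top L(2)) simp
  \<comment> \<open>\<open>R\<close> serves the central range, and \<open>D k \<ge> 1\<close> gives \<open>D k powr (1 - \<theta>) \<le> D k\<close> in the other one\<close>
  have ev: "\<forall>\<^sub>F k in sequentially. max 1 R \<le> \<kappa> * L k ^ d" using DL unfolding filterlim_at_top by blast
  have main: "\<forall>\<^sub>F k in sequentially. \<forall>s. \<bar>tilt \<theta> (n k) (D k) s - 1\<bar> \<le> \<epsilon> + B k * (exp (\<sigma> / L k powr \<delta> * (real s - (real (n k) - D k))) + exp (- (\<sigma> / L k powr \<delta>) * (real s - (real (n k) - D k))))"
    using D(1) ev
  proof eventually_elim
    case (elim k)
    have Dk: "R \<le> D k" "1 \<le> D k" "0 < D k" using elim by linarith+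
    define t where "t = \<sigma> / L k powr \<delta>"
    have t: "t > 0" using \<sigma> L(1)[of k] by (simp add: t_def)
    show ?case
    proof
      fix s
      define y where "y = real s - (real (n k) - D k)"
      define T where "T = exp (t * y) + exp (- t * y)"
      have T0: "0 \<le> T" by (simp add: T_def)
      have "\<bar>tilt \<theta> (n k) (D k) s - 1\<bar> \<le> \<epsilon> + B k * T"
      proof (cases "\<bar>real (n k) - real s - D k\<bar> \<le> \<eta> * D k")
        case True
        have "0 \<le> B k * T" using Bn T0 by (rule mult_nonneg_nonneg)
        thus ?thesis using near[OF Dk(1) True] by linarith
      next
        case False
        have ay: "\<bar>y\<bar> = \<bar>real (n k) - real s - D k\<bar>" unfolding y_def by linarith
        have "\<eta> * (\<kappa> * L k ^ d) \<le> \<eta> * D k" using elim(1) \<eta>(1) by (intro mult_left_mono) auto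
        hence yL: "\<eta> * \<kappa> * L k ^ d \<le> \<bar>y\<bar>" using False ay by (simp add: mult.assoc)
        have "c * L k powr (real d - \<delta>) = t * (\<eta> * \<kappa> * L k ^ d)"
          unfolding c_def t_def powr_diff Ld by simp
        also have "\<dots> \<le> t * \<bar>y\<bar>" using yL t by (intro mult_left_mono) auto
        finally have "exp (c * L k powr (real d - \<delta>)) \<le> exp (t * \<bar>y\<bar>)" by simp
        also have "exp (t * \<bar>y\<bar>) \<le> T" unfolding T_def by (cases "y \<ge> 0") auto
        finally have "exp (- (c * L k powr (real d - \<delta>))) * exp (c * L k powr (real d - \<delta>)) \<le> exp (- (c * L k powr (real d - \<delta>))) * T"
          by (intro mult_left_mono) simp_all
        hence "1 \<le> exp (- (c * L k powr (real d - \<delta>))) * T" by (simp add: exp_minus)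
        hence "K (L k) * 1 \<le> K (L k) * (exp (- (c * L k powr (real d - \<delta>))) * T)" by (rule mult_left_mono[OF _ K0])
        hence KB: "K (L k) \<le> B k * T" by (simp add: B_def mult.assoc)
        have tn: "0 \<le> tilt \<theta> (n k) (D k) s" unfolding tilt_def using negbin_pos[OF \<theta>] G Dk by (auto intro!: divide_nonneg_nonneg less_imp_le)
        have tl: "tilt \<theta> (n k) (D k) s \<le> K (L k) - 1"
        proof (cases "s \<le> n k")
          case True
          have "negbin \<theta> (n k - s) \<le> B0 * (real (n k - s) + 1) powr \<theta>" by (rule B0(2))
          also have "\<dots> \<le> B0 * (\<rho> * L k powr real d + 1) powr \<theta>"
            using n[of k] B0(1) \<theta> True unfolding Ld by (intro mult_left_mono powr_mono2) (auto simp: of_nat_diff)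
          finally have nb: "negbin \<theta> (n k - s) \<le> B0 * (\<rho> * L k powr real d + 1) powr \<theta>" .
          have "D k powr (1 - \<theta>) \<le> D k powr 1" using Dk \<theta> by (intro powr_mono) auto
          hence Dp: "D k powr (1 - \<theta>) \<le> \<rho> * L k powr real d" using D(2)[of k] Dk unfolding Ld by simp
          have "tilt \<theta> (n k) (D k) s = negbin \<theta> (n k - s) * (Gamma \<theta> * D k powr (1 - \<theta>))"
          proof -
            have "D k powr (1 - \<theta>) = 1 / D k powr (\<theta> - 1)" using powr_minus_divide[of "D k" "\<theta> - 1"] by simp
            thus ?thesis using True by (simp add: tilt_def)
          qed
          also have "\<dots> \<le> (B0 * (\<rho> * L k powr real d + 1) powr \<theta>) * (Gamma \<theta> * (\<rho> * L k powr real d))"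
            using nb Dp G B0(1) by (intro mult_mono mult_left_mono) auto
          finally show ?thesis unfolding K_def by simp
        next
          case False
          have "0 \<le> B0 * (\<rho> * L k powr real d + 1) powr \<theta> * (Gamma \<theta> * (\<rho> * L k powr real d))"
            using B0(1) G \<rho> by (intro mult_nonneg_nonneg) auto
          thus ?thesis using False by (simp add: tilt_def K_def)
        qed
        have "\<bar>tilt \<theta> (n k) (D k) s - 1\<bar> \<le> K (L k)"
          using tn tl K0[of k] unfolding abs_le_iff by linarith
        thus ?thesis using KB \<epsilon> by linarith
      qed
      thus "\<bar>tilt \<theta> (n k) (D k) s - 1\<bar> \<le> \<epsilon> + B k * (exp (\<sigma> / L k powr \<delta> * (real s - (real (n k) - D k))) + exp (- (\<sigma> / L k powr \<delta>) * (real s - (real (n k) - D k))))"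
        unfolding T_def t_def y_def .
    qed
  qed
  show ?thesis by (rule that[OF Blim Bn main])
qed

section \<open>Mixed Poisson laws\<close>

lemma sums_of_ennreal_suminf:
  assumes f: "\<And>k. 0 \<le> f k" and r: "0 \<le> r" and eq: "(\<Sum>k. ennreal (f k)) = ennreal r"
  shows "f sums r"
proof -
  have "(\<Sum>k. ennreal (f k)) \<noteq> top" unfolding eq by simp
  hence s: "summable f" by (rule summable_suminf_not_top[OF f])
  have "ennreal (suminf f) = ennreal r" using suminf_ennreal2[OF f s] unfolding eq by (rule sym)
  hence "suminf f = r" using r suminf_nonneg[OF s f] by simp
  thus ?thesis using summable_sums[OF s] by simp
qed

lemma poisson_sums: "(\<lambda>m. exp (- y) * y ^ m / fact m) sums (1::real)"
proof -
  have "(\<lambda>m. y ^ m /\<^sub>R fact m) sums exp y" by (rule exp_converges)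
  from sums_mult[OF this, of "exp (- y)"] have "(\<lambda>m. exp (- y) * (y ^ m /\<^sub>R fact m)) sums (exp (- y) * exp y)" .
  moreover have "exp (- y) * (y ^ m /\<^sub>R fact m) = exp (- y) * y ^ m / fact m" for m by (simp add: inverse_eq_divide)
  moreover have "exp (- y) * exp y = 1" by (simp add: exp_minus)
  ultimately show ?thesis by (simp only:)
qed

lemma poisson_le_1:
  assumes "0 \<le> (y::real)" shows "exp (- y) * y ^ m / fact m \<le> 1"
proof -
  have "(\<Sum>m\<in>{m}. exp (- y) * y ^ m / fact m) \<le> (\<Sum>m. exp (- y) * y ^ m / fact m)"
    by (rule sum_le_suminf) (use assms sums_summable[OF poisson_sums] in auto)
  thus ?thesis unfolding sums_unique[OF poisson_sums, symmetric] by simp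
qed

text \<open>On the left half-plane the derivative of the exponential function is bounded by \<open>1\<close>.\<close>

lemma norm_exp_diff_le:
  assumes "Re z \<le> 0" "Re w \<le> 0"
  shows "norm (exp z - exp w) \<le> norm (z - w)"
proof -
  have "norm (exp z - exp w) \<le> 1 * norm (z - w)"
  proof (rule field_differentiable_bound[where S="{z. Re z \<le> 0}" and f'=exp])
    show "convex {z. Re z \<le> 0}" by (rule convex_halfspace_Re_le)
    show "(exp has_field_derivative exp z) (at z within {z. Re z \<le> 0})" for z :: complex
      by (rule has_field_derivative_at_within) (rule DERIV_exp)
    show "norm (exp z) \<le> 1" if "z \<in> {z. Re z \<le> 0}" for z using that by (simp add: norm_exp_eq_Re)
  qed (use assms in auto)
  thus ?thesis by simp
qed

lemma exp_minus_1_bounds: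
  assumes "\<bar>t\<bar> \<le> (1/2::real)"
  shows "\<bar>exp t - 1\<bar> \<le> 2 * \<bar>t\<bar>" "exp t - 1 - t \<le> t\<^sup>2" "0 \<le> exp t - 1 - t"
proof -
  show lo: "0 \<le> exp t - 1 - t" using exp_ge_add_one_self[of t] by linarith
  show up: "exp t - 1 - t \<le> t\<^sup>2"
  proof (cases "t \<ge> 0")
    case True
    thus ?thesis using exp_bound[of t] assms by auto
  next
    case False
    define x where "x = - t"
    have x: "0 \<le> x" "x \<le> 1/2" using False assms by (auto simp: x_def)
    have "1 + x + x\<^sup>2 / 2 \<le> exp x" by (rule exp_lower_Taylor_quadratic[OF x(1)])
    moreover have "1 \<le> (1 - x + x\<^sup>2) * (1 + x + x\<^sup>2 / 2)"
    proof -
      have "(1 - x + x\<^sup>2) * (1 + x + x\<^sup>2 / 2) = 1 + x\<^sup>2 / 2 + x\<^sup>2 * x / 2 + (x\<^sup>2)\<^sup>2 / 2"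
        by (simp add: power2_eq_square field_simps)
      moreover have "0 \<le> x\<^sup>2 * x" using x by simp
      ultimately show ?thesis by simp
    qed
    moreover have "0 \<le> 1 - x + x\<^sup>2" using x by (simp add: add_nonneg_nonneg)
    ultimately have "1 \<le> (1 - x + x\<^sup>2) * exp x" by (meson mult_left_mono order_trans)
    hence "exp (- x) * 1 \<le> exp (- x) * ((1 - x + x\<^sup>2) * exp x)" by (intro mult_left_mono) auto
    also have "exp (- x) * ((1 - x + x\<^sup>2) * exp x) = (1 - x + x\<^sup>2)" by (simp add: exp_minus)
    finally show ?thesis by (simp add: x_def)
  qed
  have "t\<^sup>2 \<le> \<bar>t\<bar>"
  proof -
    have "t\<^sup>2 = \<bar>t\<bar> * \<bar>t\<bar>" by (simp add: power2_eq_square)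
    also have "\<dots> \<le> 1 * \<bar>t\<bar>" using assms by (intro mult_right_mono) auto
    finally show ?thesis by simp
  qed
  thus "\<bar>exp t - 1\<bar> \<le> 2 * \<bar>t\<bar>" using lo up by linarith
qed

text \<open>The pointwise bound on the tilt, integrated against the law \<open>p\<close>. It holds for every \<open>g\<close> bounded by \<open>1\<close>, in particular for
  the exponentials of the characteristic function and for the constant \<open>1\<close> of the normalisation.\<close>

lemma tilted_sum_diff_le:
  fixes p T \<omega> :: "nat \<Rightarrow> real" and g :: "nat \<Rightarrow> complex"
  assumes p: "\<And>s. 0 \<le> p s" "p sums 1" and T: "summable (\<lambda>s. p s * T s)" "(\<Sum>s. p s * T s) \<le> C" and B: "0 \<le> B"
    and \<omega>: "\<And>s. \<bar>\<omega> s - 1\<bar> \<le> \<epsilon> + B * T s" "\<And>s. s > n \<Longrightarrow> \<omega> s = 0" and g: "\<And>s. norm (g s) \<le> 1"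
  shows "norm ((\<Sum>s\<le>n. of_real (p s * \<omega> s) * g s) - (\<Sum>s. of_real (p s) * g s)) \<le> \<epsilon> + B * C"
proof -
  have ps: "summable p" using p(2) by (rule sums_summable)
  have sg: "summable (\<lambda>s. of_real (p s) * g s)"
    by (rule summable_comparison_test'[OF ps, of 0]) (use p(1) g in \<open>auto simp: norm_mult intro!: mult_left_le\<close>)
  have s\<omega>: "(\<lambda>s. of_real (p s * \<omega> s) * g s) sums (\<Sum>s\<le>n. of_real (p s * \<omega> s) * g s)"
    by (rule sums_finite) (use \<omega>(2) in \<open>auto simp: not_le\<close>)
  have d: "(\<lambda>s. of_real (p s * \<omega> s) * g s - of_real (p s) * g s) sums ((\<Sum>s\<le>n. of_real (p s * \<omega> s) * g s) - (\<Sum>s. of_real (p s) * g s))"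
    by (rule sums_diff[OF s\<omega> summable_sums[OF sg]])
  have e: "(\<lambda>s. p s * \<epsilon> + B * (p s * T s)) sums (1 * \<epsilon> + B * (\<Sum>s. p s * T s))"
    by (intro sums_add sums_mult2 sums_mult p(2) summable_sums T(1))
  have le: "norm (of_real (p s * \<omega> s) * g s - of_real (p s) * g s) \<le> p s * \<epsilon> + B * (p s * T s)" for s
  proof -
    have eq: "of_real (p s * \<omega> s) * g s - of_real (p s) * g s = of_real (p s * (\<omega> s - 1)) * g s" by (simp add: algebra_simps)
    have "norm (of_real (p s * (\<omega> s - 1)) * g s) = p s * \<bar>\<omega> s - 1\<bar> * norm (g s)"
      using p(1)[of s] by (simp add: norm_mult abs_mult del: of_real_mult of_real_diff)
    also have "\<dots> \<le> p s * \<bar>\<omega> s - 1\<bar> * 1" using g p(1)[of s] by (intro mult_left_mono) auto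
    also have "\<dots> \<le> p s * (\<epsilon> + B * T s)" using \<omega>(1)[of s] p(1)[of s] by (simp add: mult_left_mono)
    also have "\<dots> = p s * \<epsilon> + B * (p s * T s)" by (simp add: algebra_simps)
    finally show ?thesis unfolding eq .
  qed
  have "norm (\<Sum>s. of_real (p s * \<omega> s) * g s - of_real (p s) * g s) \<le> (\<Sum>s. p s * \<epsilon> + B * (p s * T s))"
    by (rule norm_suminf_le) (use le sums_summable[OF e] in auto)
  also have "\<dots> = \<epsilon> + B * (\<Sum>s. p s * T s)" using sums_unique[OF e] by simp
  also have "\<dots> \<le> \<epsilon> + B * C" using T(2) B by (simp add: mult_left_mono)
  finally show ?thesis unfolding sums_unique[OF d, symmetric] .
qed

context gamma_field
begin

definition mixed_prob :: "('i \<Rightarrow> real) \<Rightarrow> nat \<Rightarrow> real" where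
  "mixed_prob a m = expectation (\<lambda>\<omega>. exp (- gamma_total a \<omega>) * gamma_total a \<omega> ^ m / fact m)"

lemma mixed_prob_integrable: "integrable M (\<lambda>\<omega>. exp (- gamma_total a \<omega>) * gamma_total a \<omega> ^ m / fact m)"
proof (rule integrable_const_bound[of _ 1])
  show "AE \<omega> in M. norm (exp (- gamma_total a \<omega>) * gamma_total a \<omega> ^ m / fact m) \<le> 1"
  proof (rule AE_I2)
    fix \<omega>
    have "0 \<le> exp (- gamma_total a \<omega>) * gamma_total a \<omega> ^ m / fact m" using gamma_total_nonneg[of a \<omega>] by simp
    thus "norm (exp (- gamma_total a \<omega>) * gamma_total a \<omega> ^ m / fact m) \<le> 1"
      unfolding real_norm_def using poisson_le_1[OF gamma_total_nonneg, of a \<omega> m] by (simp only: abs_of_nonneg)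
  qed
qed measurable

lemma mixed_prob_nonneg: "0 \<le> mixed_prob a m"
  unfolding mixed_prob_def by (intro integral_nonneg_AE AE_I2) (simp add: gamma_total_nonneg)

lemma mixed_poisson_eq: "mixed_poisson a m = ennreal (mixed_prob a m)"
  unfolding mixed_poisson_def mixed_prob_def
  by (rule nn_integral_eq_integral[OF mixed_prob_integrable]) (simp add: gamma_total_nonneg)

lemma mixed_prob_sums: "mixed_prob a sums 1"
proof (rule sums_of_ennreal_suminf[OF mixed_prob_nonneg])
  show "(\<Sum>k. ennreal (mixed_prob a k)) = ennreal 1"
    using mixed_poisson_generating_function[of 1 a] by (simp add: mixed_poisson_eq emeasure_space_1)
qed simp

lemma mixed_prob_0_pos: "0 < mixed_prob a 0"
proof -
  have e: "mixed_prob a 0 = expectation (\<lambda>\<omega>. exp (- gamma_total a \<omega>))" by (simp add: mixed_prob_def)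
  have i: "integrable M (\<lambda>\<omega>. exp (- gamma_total a \<omega>))" using mixed_prob_integrable[of a 0] by simp
  have "expectation (\<lambda>\<omega>. exp (- gamma_total a \<omega>)) \<noteq> 0"
  proof
    assume "expectation (\<lambda>\<omega>. exp (- gamma_total a \<omega>)) = 0"
    hence "AE \<omega> in M. exp (- gamma_total a \<omega>) = 0"
      using integral_nonneg_eq_0_iff_AE[OF i] by simp
    hence "AE \<omega> in M. False" by simp
    thus False by (simp add: AE_False)
  qed
  thus ?thesis using mixed_prob_nonneg[of a 0] unfolding e by linarith
qed

lemma gamma_total_integrable:
  assumes a: "\<And>x. 0 \<le> a x" "a summable_on UNIV" "(\<lambda>x. (a x)\<^sup>2) summable_on UNIV"
  shows "integrable M (gamma_total a)" "expectation (gamma_total a) \<le> \<theta> * (\<Sum>\<^sub>\<infinity>x. a x)"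
proof -
  have n: "0 \<le> \<theta> * (\<Sum>\<^sub>\<infinity>x. a x)" using \<theta> a by (intro mult_nonneg_nonneg infsum_nonneg) auto
  show i: "integrable M (gamma_total a)"
    by (rule integrableI_nonneg) (use gamma_total_mean_le[OF a] gamma_total_nonneg in \<open>auto simp: le_less_trans\<close>)
  have "ennreal (expectation (gamma_total a)) \<le> ennreal (\<theta> * (\<Sum>\<^sub>\<infinity>x. a x))"
    using nn_integral_eq_integral[OF i] gamma_total_mean_le[OF a] gamma_total_nonneg by simp
  thus "expectation (gamma_total a) \<le> \<theta> * (\<Sum>\<^sub>\<infinity>x. a x)" using n by simp
qed

text \<open>Given its mean \<open>\<Lambda>\<close>, a Poisson variable has characteristic function \<open>exp (\<Lambda> * (iexp (- \<tau>) - 1))\<close> (with the sign of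
  \<open>\<tau>\<close> reversed), and replacing \<open>iexp (- \<tau>) - 1\<close> by \<open>- \<i> * \<tau>\<close> replaces the variable by its mean. The two exponents
  differ by \<open>\<Lambda> * \<tau>\<^sup>2 / 2\<close> at most.\<close>

lemma mixed_prob_char_diff_le:
  assumes a: "\<And>x. 0 \<le> a x" "a summable_on UNIV" "(\<lambda>x. (a x)\<^sup>2) summable_on UNIV"
  shows "norm ((\<Sum>s. of_real (mixed_prob a s) * iexp (\<tau> * (\<mu> - real s))) - (CLINT \<omega>|M. iexp (\<tau> * (\<mu> - gamma_total a \<omega>))))
    \<le> \<tau>\<^sup>2 / 2 * (\<theta> * (\<Sum>\<^sub>\<infinity>x. a x))"
proof -
  define P where "P s \<omega> = exp (- gamma_total a \<omega>) * gamma_total a \<omega> ^ s / fact s" for s \<omega>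
  have P0: "0 \<le> P s \<omega>" for s \<omega> unfolding P_def using gamma_total_nonneg[of a \<omega>] by simp
  have Pi: "integrable M (P s)" for s unfolding P_def by (rule mixed_prob_integrable)
  have Ps: "(\<lambda>s. P s \<omega>) sums 1" for \<omega> unfolding P_def by (rule poisson_sums)
  have Pm: "mixed_prob a s = expectation (P s)" for s
  proof -
    have "P s = (\<lambda>\<omega>. exp (- gamma_total a \<omega>) * gamma_total a \<omega> ^ s / fact s)" by (rule ext) (rule P_def)
    thus ?thesis by (simp only: mixed_prob_def)
  qed
  define f where "f s \<omega> = of_real (P s \<omega>) * iexp (\<tau> * (\<mu> - real s))" for s \<omega>
  have nf: "norm (f s \<omega>) = P s \<omega>" for s \<omega> unfolding f_def using P0[of s \<omega>] by (simp add: norm_mult)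
  have fi: "integrable M (f s)" for s unfolding f_def using Pi[of s] by (intro integrable_mult_left) auto
  define E where "E \<omega> = iexp (\<tau> * \<mu>) * exp (of_real (gamma_total a \<omega>) * (iexp (- \<tau>) - 1))" for \<omega>
  have fs: "(\<lambda>s. f s \<omega>) sums E \<omega>" for \<omega>
  proof -
    define y where "y = gamma_total a \<omega>"
    define w where "w = of_real y * iexp (- \<tau>)"
    have "(\<lambda>s. w ^ s /\<^sub>R fact s) sums exp w" by (rule exp_converges)
    hence s1: "(\<lambda>s. (iexp (\<tau> * \<mu>) * of_real (exp (- y))) * (w ^ s /\<^sub>R fact s)) sums ((iexp (\<tau> * \<mu>) * of_real (exp (- y))) * exp w)"
      by (rule sums_mult)
    have t1: "(iexp (\<tau> * \<mu>) * of_real (exp (- y))) * (w ^ s /\<^sub>R fact s) = f s \<omega>" for s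
    proof -
      have "iexp (\<tau> * (\<mu> - real s)) = iexp (\<tau> * \<mu>) * iexp (- \<tau>) ^ s"
        unfolding exp_of_nat_mult[symmetric] exp_add[symmetric] by (simp add: algebra_simps)
      thus ?thesis unfolding f_def P_def y_def[symmetric] w_def
        by (simp add: power_mult_distrib scaleR_conv_of_real inverse_eq_divide)
    qed
    have t2: "(iexp (\<tau> * \<mu>) * of_real (exp (- y))) * exp w = E \<omega>"
    proof -
      have "of_real (exp (- y)) * exp w = exp (of_real y * (iexp (- \<tau>) - 1))"
        unfolding w_def exp_of_real[symmetric] exp_add[symmetric] by (simp add: algebra_simps)
      thus ?thesis unfolding E_def y_def[symmetric] by (simp only: mult.assoc)
    qed
    show ?thesis using s1 unfolding t1 t2 .
  qed
  have Esum: "E = (\<lambda>\<omega>. \<Sum>s. f s \<omega>)" using sums_unique[OF fs] by (intro ext)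
  have sm: "summable (\<lambda>s. expectation (\<lambda>\<omega>. norm (f s \<omega>)))"
    unfolding nf using sums_summable[OF mixed_prob_sums[of a]] unfolding Pm .
  have sa: "AE \<omega> in M. summable (\<lambda>s. norm (f s \<omega>))" unfolding nf using sums_summable[OF Ps] by simp
  have "(CLINT \<omega>|M. E \<omega>) = (\<Sum>s. CLINT \<omega>|M. f s \<omega>)"
    unfolding Esum by (rule integral_suminf[OF fi sa sm])
  also have "(\<lambda>s. CLINT \<omega>|M. f s \<omega>) = (\<lambda>s. of_real (mixed_prob a s) * iexp (\<tau> * (\<mu> - real s)))"
    unfolding f_def Pm by (intro ext) simp
  finally have IE: "(CLINT \<omega>|M. E \<omega>) = (\<Sum>s. of_real (mixed_prob a s) * iexp (\<tau> * (\<mu> - real s)))" .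
  have Ei: "integrable M E" unfolding Esum by (rule integrable_suminf[OF fi sa sm])
  have gi: "integrable M (\<lambda>\<omega>. iexp (\<tau> * (\<mu> - gamma_total a \<omega>)))" by (rule integrable_const_bound[of _ 1]) auto
  have le: "norm (E \<omega> - iexp (\<tau> * (\<mu> - gamma_total a \<omega>))) \<le> \<tau>\<^sup>2 / 2 * gamma_total a \<omega>" for \<omega>
  proof -
    define y where "y = gamma_total a \<omega>"
    have y: "0 \<le> y" by (simp add: y_def gamma_total_nonneg)
    define z where "z = of_real y * (iexp (- \<tau>) - 1)"
    define w where "w = of_real y * (\<i> * of_real (- \<tau>))"
    have "Re (iexp (- \<tau>)) \<le> 1" by (simp add: Re_exp)
    hence z: "Re z \<le> 0" unfolding z_def using y by (simp add: mult_nonneg_nonpos)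
    have w: "Re w \<le> 0" unfolding w_def by simp
    have g: "iexp (\<tau> * (\<mu> - y)) = iexp (\<tau> * \<mu>) * exp w" unfolding w_def exp_add[symmetric] by (simp add: algebra_simps)
    have "E \<omega> - iexp (\<tau> * (\<mu> - y)) = iexp (\<tau> * \<mu>) * (exp z - exp w)"
      unfolding g E_def z_def y_def[symmetric] by (simp only: right_diff_distrib)
    hence "norm (E \<omega> - iexp (\<tau> * (\<mu> - y))) = norm (exp z - exp w)" by (simp add: norm_mult)
    also have "\<dots> \<le> norm (z - w)" by (rule norm_exp_diff_le[OF z w])
    also have "z - w = of_real y * (iexp (- \<tau>) - (\<Sum>k\<le>1. (\<i> * of_real (- \<tau>)) ^ k / fact k))"
      unfolding z_def w_def by (simp add: right_diff_distrib algebra_simps)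
    also have "norm \<dots> \<le> y * (\<bar>- \<tau>\<bar> ^ Suc 1 / fact (Suc 1))"
      unfolding norm_mult using y iexp_approx1[of "- \<tau>" 1] by (intro mult_mono) auto
    also have "\<dots> = \<tau>\<^sup>2 / 2 * y" by (simp add: power2_eq_square)
    finally show ?thesis unfolding y_def .
  qed
  have "norm ((CLINT \<omega>|M. E \<omega>) - (CLINT \<omega>|M. iexp (\<tau> * (\<mu> - gamma_total a \<omega>)))) = norm (CLINT \<omega>|M. E \<omega> - iexp (\<tau> * (\<mu> - gamma_total a \<omega>)))"
    using Bochner_Integration.integral_diff[OF Ei gi] by simp
  also have "\<dots> \<le> (LINT \<omega>|M. norm (E \<omega> - iexp (\<tau> * (\<mu> - gamma_total a \<omega>))))" by (rule integral_norm_bound)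
  also have "\<dots> \<le> (LINT \<omega>|M. \<tau>\<^sup>2 / 2 * gamma_total a \<omega>)"
    by (rule integral_mono) (use le Ei gi gamma_total_integrable[OF a] in auto)
  also have "\<dots> = \<tau>\<^sup>2 / 2 * expectation (gamma_total a)" by simp
  also have "\<dots> \<le> \<tau>\<^sup>2 / 2 * (\<theta> * (\<Sum>\<^sub>\<infinity>x. a x))" using gamma_total_integrable[OF a] by (intro mult_left_mono) auto
  finally show ?thesis unfolding IE .
qed

lemma AE_gamma_series_cmult:
  assumes "(\<lambda>x. (a x)\<^sup>2) summable_on UNIV"
  shows "AE \<omega> in M. gamma_series (\<lambda>x. r * a x) \<omega> = r * gamma_series a \<omega>"
proof -
  have "(\<lambda>x. (r * a x)\<^sup>2) summable_on UNIV"
    unfolding power_mult_distrib by (intro summable_on_cmult_right assms)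
  from AE_gamma_sum_tendsto[OF this] AE_gamma_sum_tendsto[OF assms] show ?thesis
  proof eventually_elim
    case (elim \<omega>)
    have e: "gamma_sum (\<lambda>x. r * a x) m \<omega> = r * gamma_sum a m \<omega>" for m
      unfolding gamma_sum_def sum_distrib_left by (intro sum.cong) (simp_all only: mult_ac)
    show ?case by (rule LIMSEQ_unique[OF elim(1)[unfolded e] tendsto_mult_left[OF elim(2)]])
  qed
qed

text \<open>Averaging over the Poisson variable turns \<open>exp (\<tau> * s)\<close> into \<open>exp (\<Lambda> * (exp \<tau> - 1))\<close>, whose expectation is that of
  the exponential of a gamma series. For small \<open>\<tau>\<close> both terms of the exponent in \<open>C\<close> are of
  second order: the first one accounts for the Poisson noise, the second one for the random mean.\<close>

lemma mixed_prob_mgf_le: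
  assumes a: "\<And>x. 0 \<le> a x" "a summable_on UNIV" "(\<lambda>x. (a x)\<^sup>2) summable_on UNIV"
    and half: "\<And>x. \<bar>(exp \<tau> - 1) * a x\<bar> \<le> 1 / 2" and \<mu>: "\<mu> = \<theta> * (\<Sum>\<^sub>\<infinity>x. a x)"
  defines "C \<equiv> exp ((exp \<tau> - 1 - \<tau>) * \<mu> + 2 * \<theta> * ((exp \<tau> - 1)\<^sup>2 * (\<Sum>\<^sub>\<infinity>x. (a x)\<^sup>2)))"
  shows "summable (\<lambda>s. mixed_prob a s * exp (\<tau> * (real s - \<mu>)))" "(\<Sum>s. mixed_prob a s * exp (\<tau> * (real s - \<mu>))) \<le> C"
proof -
  define l where "l = exp \<tau> - 1"
  have sq: "(\<lambda>x. (- l * a x)\<^sup>2) summable_on UNIV" unfolding power_mult_distrib by (intro summable_on_cmult_right a)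
  have inf: "(\<Sum>\<^sub>\<infinity>x. (- l * a x)\<^sup>2) = l\<^sup>2 * (\<Sum>\<^sub>\<infinity>x. (a x)\<^sup>2)" unfolding power_mult_distrib by (simp add: infsum_cmult_right')
  have nn: "0 \<le> mixed_prob a s * exp (\<tau> * (real s - \<mu>))" for s by (intro mult_nonneg_nonneg mixed_prob_nonneg) simp
  have t: "ennreal (mixed_prob a s * exp (\<tau> * (real s - \<mu>))) = mixed_poisson a s * ennreal (exp \<tau> ^ s) * ennreal (exp (- \<tau> * \<mu>))" for s
  proof -
    have "exp (\<tau> * (real s - \<mu>)) = exp \<tau> ^ s * exp (- \<tau> * \<mu>)"
      unfolding exp_of_nat_mult[symmetric] exp_add[symmetric] by (simp add: algebra_simps)
    thus ?thesis unfolding mixed_poisson_eq by (simp add: ennreal_mult mixed_prob_nonneg mult.assoc)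
  qed
  have "(\<Sum>s. ennreal (mixed_prob a s * exp (\<tau> * (real s - \<mu>)))) = (\<integral>\<^sup>+\<omega>. ennreal (exp (gamma_total a \<omega> * (exp \<tau> - 1))) \<partial>M) * ennreal (exp (- \<tau> * \<mu>))"
    unfolding t ennreal_suminf_multc mixed_poisson_generating_function[OF exp_ge_zero] ..
  also have "(\<integral>\<^sup>+\<omega>. ennreal (exp (gamma_total a \<omega> * (exp \<tau> - 1))) \<partial>M) = (\<integral>\<^sup>+\<omega>. ennreal (exp (l * \<mu>)) * ennreal (exp (gamma_series (\<lambda>x. - l * a x) \<omega>)) \<partial>M)"
  proof (rule nn_integral_cong_AE)
    show "AE \<omega> in M. ennreal (exp (gamma_total a \<omega> * (exp \<tau> - 1))) = ennreal (exp (l * \<mu>)) * ennreal (exp (gamma_series (\<lambda>x. - l * a x) \<omega>))"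
      using AE_gamma_total[OF a] AE_gamma_series_cmult[OF a(3), of "- l"]
    proof eventually_elim
      case (elim \<omega>)
      have "gamma_total a \<omega> * (exp \<tau> - 1) = l * \<mu> + gamma_series (\<lambda>x. - l * a x) \<omega>"
        unfolding elim(2) unfolding elim(1)[THEN conjunct1] \<mu> l_def by (simp add: algebra_simps)
      thus ?case by (simp add: exp_add ennreal_mult)
    qed
  qed
  also have "\<dots> = ennreal (exp (l * \<mu>)) * (\<integral>\<^sup>+\<omega>. ennreal (exp (gamma_series (\<lambda>x. - l * a x) \<omega>)) \<partial>M)"
    by (rule nn_integral_cmult) measurable
  finally have eq: "(\<Sum>s. ennreal (mixed_prob a s * exp (\<tau> * (real s - \<mu>)))) = ennreal (exp (l * \<mu>)) * (\<integral>\<^sup>+\<omega>. ennreal (exp (gamma_series (\<lambda>x. - l * a x) \<omega>)) \<partial>M) * ennreal (exp (- \<tau> * \<mu>))" .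
  have "(\<integral>\<^sup>+\<omega>. ennreal (exp (gamma_series (\<lambda>x. - l * a x) \<omega>)) \<partial>M) \<le> ennreal (exp (2 * \<theta> * (l\<^sup>2 * (\<Sum>\<^sub>\<infinity>x. (a x)\<^sup>2))))"
    unfolding inf[symmetric] by (rule gamma_series_mgf_le[OF sq]) (use half in \<open>simp only: l_def mult_minus_left abs_minus_cancel\<close>)
  hence "(\<Sum>s. ennreal (mixed_prob a s * exp (\<tau> * (real s - \<mu>)))) \<le> ennreal (exp (l * \<mu>)) * ennreal (exp (2 * \<theta> * (l\<^sup>2 * (\<Sum>\<^sub>\<infinity>x. (a x)\<^sup>2)))) * ennreal (exp (- \<tau> * \<mu>))"
    unfolding eq by (intro mult_right_mono mult_left_mono) auto
  also have "\<dots> = ennreal (exp (l * \<mu>) * exp (2 * \<theta> * (l\<^sup>2 * (\<Sum>\<^sub>\<infinity>x. (a x)\<^sup>2))) * exp (- \<tau> * \<mu>))"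
    by (simp add: ennreal_mult)
  also have "exp (l * \<mu>) * exp (2 * \<theta> * (l\<^sup>2 * (\<Sum>\<^sub>\<infinity>x. (a x)\<^sup>2))) * exp (- \<tau> * \<mu>) = C"
    unfolding C_def l_def exp_add[symmetric] by (rule arg_cong[where f=exp]) (simp add: algebra_simps)
  finally have le: "(\<Sum>s. ennreal (mixed_prob a s * exp (\<tau> * (real s - \<mu>)))) \<le> ennreal C" .
  hence "(\<Sum>s. ennreal (mixed_prob a s * exp (\<tau> * (real s - \<mu>)))) \<noteq> top" using ennreal_less_top[of C] by (metis not_less)
  thus s: "summable (\<lambda>s. mixed_prob a s * exp (\<tau> * (real s - \<mu>)))" by (rule summable_suminf_not_top[OF nn])
  have "ennreal (\<Sum>s. mixed_prob a s * exp (\<tau> * (real s - \<mu>))) \<le> ennreal C" using le unfolding suminf_ennreal2[OF nn s] .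
  thus "(\<Sum>s. mixed_prob a s * exp (\<tau> * (real s - \<mu>))) \<le> C" by (simp add: C_def)
qed

end

section \<open>Conditioning on the total number of particles\<close>

lemma sum_convolution_reverse:
  fixes w p :: "nat \<Rightarrow> real" and f :: "nat \<Rightarrow> complex"
  shows "(\<Sum>k\<le>n. of_real (w k * p (n - k)) * f k) = (\<Sum>s\<le>n. of_real (w (n - s) * p s) * f (n - s))"
  by (rule sum.reindex_bij_witness[of _ "\<lambda>s. n - s" "\<lambda>k. n - k"]) auto

context gamma_field
begin

text \<open>The conditional law: given the total \<open>n\<close>, the number \<open>s\<close> of particles outside \<open>o0\<close> has the mixed Poisson law
  reweighted by \<open>negbin \<theta> (n - s)\<close>. The constant of \<open>family_sum_eq\<close> cancels.\<close>

lemma family_law: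
  fixes n :: nat
  assumes q: "q o0 = 1" "\<And>x. x \<noteq> o0 \<Longrightarrow> 0 < q x \<and> q x < 1"
    and a: "\<And>x. a x = (if x = o0 then 0 else q x / (1 - q x))" and sa: "a summable_on UNIV" "(\<lambda>x. (a x)\<^sup>2) summable_on UNIV"
  defines "S \<equiv> {p. valid_family p \<and> mset_size (p o0) + rest_size o0 p = n}"
  defines "P \<equiv> density (count_space S) (\<lambda>p. ennreal (family_weight \<theta> q p / (\<Sum>\<^sub>\<infinity>p\<in>S. family_weight \<theta> q p)))"
  defines "N \<equiv> (\<Sum>s\<le>n. negbin \<theta> (n - s) * mixed_prob a s)"
  shows "prob_space P" and "N > 0"
    and "\<And>f :: nat \<Rightarrow> complex. (CLINT p|P. f (mset_size (p o0))) = (\<Sum>s\<le>n. of_real (negbin \<theta> (n - s) * mixed_prob a s) * f (n - s)) / of_real N"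
proof -
  obtain C where C: "C > 0" and fs: "\<And>k m. family_sum \<theta> q o0 k m = ennreal (C * negbin \<theta> k) * mixed_poisson a m"
    using family_sum_eq[OF q a sa] by blast
  have q0: "0 \<le> q x" for x using q(1) q(2)[of x] by (cases "x = o0") auto
  have W0: "0 \<le> family_weight \<theta> q p" for p by (rule family_weight_nonneg[OF q0 \<theta>])
  define v where "v k = negbin \<theta> k * mixed_prob a (n - k)" for k
  have v0: "0 \<le> v k" for k unfolding v_def using negbin_pos[OF \<theta>, of k] by (intro mult_nonneg_nonneg mixed_prob_nonneg) simp
  have Nv: "N = (\<Sum>k\<le>n. v k)" unfolding N_def v_def
    by (rule sum.reindex_bij_witness[of _ "\<lambda>k. n - k" "\<lambda>s. n - s"]) auto
  show Npos: "N > 0"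
  proof -
    have "0 < v n" unfolding v_def using negbin_pos[OF \<theta>] mixed_prob_0_pos by simp
    thus ?thesis unfolding Nv by (intro sum_pos2[of _ n]) (use v0 in auto)
  qed
  define ind where "ind k p = (if mset_size (p o0) = k then 1 else 0 :: ennreal)" for k and p :: "'i \<Rightarrow> nat multiset"
  have part: "(\<integral>\<^sup>+p. ennreal (family_weight \<theta> q p) * ind k p \<partial>count_space S) = (if k \<le> n then ennreal (C * v k) else 0)" for k
  proof (cases "k \<le> n")
    case True
    have "(\<integral>\<^sup>+p. ennreal (family_weight \<theta> q p) * ind k p \<partial>count_space S) = (\<integral>\<^sup>+p. ennreal (family_weight \<theta> q p) * ind k p * indicator S p \<partial>count_space UNIV)"
      by (subst nn_integral_count_space_indicator) auto
    also have "\<dots> = family_sum \<theta> q o0 k (n - k)" unfolding family_sum_def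
      by (rule nn_integral_cong) (use True in \<open>auto simp: ind_def S_def indicator_def\<close>)
    finally have 1: "(\<integral>\<^sup>+p. ennreal (family_weight \<theta> q p) * ind k p \<partial>count_space S) = family_sum \<theta> q o0 k (n - k)" .
    have "ennreal (C * negbin \<theta> k) * ennreal (mixed_prob a (n - k)) = ennreal (C * negbin \<theta> k * mixed_prob a (n - k))"
      using C negbin_pos[OF \<theta>, of k] mixed_prob_nonneg by (intro ennreal_mult[symmetric]) auto
    thus ?thesis unfolding 1 fs mixed_poisson_eq using True by (simp add: v_def mult.assoc)
  next
    case False
    have "(\<integral>\<^sup>+p. ennreal (family_weight \<theta> q p) * ind k p \<partial>count_space S) = (\<integral>\<^sup>+p. 0 \<partial>count_space S)"
      by (rule nn_integral_cong) (use False in \<open>auto simp: ind_def S_def\<close>)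
    thus ?thesis using False by simp
  qed
  have tot: "(\<integral>\<^sup>+p. ennreal (family_weight \<theta> q p) \<partial>count_space S) = ennreal (C * N)"
  proof -
    have "(\<integral>\<^sup>+p. ennreal (family_weight \<theta> q p) \<partial>count_space S) = (\<integral>\<^sup>+p. (\<Sum>k\<le>n. ennreal (family_weight \<theta> q p) * ind k p) \<partial>count_space S)"
    proof (rule nn_integral_cong)
      fix p assume "p \<in> space (count_space S)"
      hence "mset_size (p o0) \<in> {..n}" by (auto simp: S_def)
      thus "ennreal (family_weight \<theta> q p) = (\<Sum>k\<le>n. ennreal (family_weight \<theta> q p) * ind k p)"
        unfolding ind_def sum_distrib_left[symmetric] by (simp add: sum.delta)
    qed
    also have "\<dots> = (\<Sum>k\<le>n. \<integral>\<^sup>+p. ennreal (family_weight \<theta> q p) * ind k p \<partial>count_space S)"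
      by (rule nn_integral_sum) simp
    also have "\<dots> = (\<Sum>k\<le>n. ennreal (C * v k))" by (rule sum.cong) (simp_all add: part)
    also have "\<dots> = ennreal (\<Sum>k\<le>n. C * v k)" by (rule sum_ennreal) (use C v0 in auto)
    also have "(\<Sum>k\<le>n. C * v k) = C * N" by (simp only: Nv sum_distrib_left)
    finally show ?thesis .
  qed
  have CN: "0 < C * N" using C Npos by simp
  have Z: "(\<Sum>\<^sub>\<infinity>p\<in>S. family_weight \<theta> q p) = C * N"
    by (rule infsumI[OF has_sum_of_nn_integral[OF W0 _ tot]]) (use CN in simp)
  have dens: "ennreal (family_weight \<theta> q p / (C * N)) = ennreal (1 / (C * N)) * ennreal (family_weight \<theta> q p)" for p
    using CN W0[of p] by (subst ennreal_mult[symmetric]) auto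
  have Pd: "P = density (count_space S) (\<lambda>p. ennreal (1 / (C * N)) * ennreal (family_weight \<theta> q p))"
    unfolding P_def Z dens ..
  have norm1: "ennreal (1 / (C * N)) * ennreal (C * N) = 1"
  proof -
    have "ennreal (1 / (C * N)) * ennreal (C * N) = ennreal (1 / (C * N) * (C * N))" using CN by (intro ennreal_mult[symmetric]) auto
    also have "1 / (C * N) * (C * N) = 1" using C Npos by simp
    finally show ?thesis by simp
  qed
  show prob: "prob_space P"
  proof (rule prob_spaceI)
    have "emeasure P (space P) = (\<integral>\<^sup>+p. ennreal (1 / (C * N)) * ennreal (family_weight \<theta> q p) * indicator S p \<partial>count_space S)"
      unfolding Pd by (subst emeasure_density) auto
    also have "\<dots> = (\<integral>\<^sup>+p. ennreal (1 / (C * N)) * ennreal (family_weight \<theta> q p) \<partial>count_space S)"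
      by (rule nn_integral_cong) simp
    also have "\<dots> = ennreal (1 / (C * N)) * ennreal (C * N)" by (subst nn_integral_cmult) (simp_all add: tot)
    finally show "emeasure P (space P) = 1" unfolding norm1 .
  qed
  define pk where "pk k = (if k \<le> n then v k / N else 0)" for k
  have pk0: "0 \<le> pk k" for k using v0 Npos by (simp add: pk_def)
  define D where "D = distr P (count_space UNIV) (\<lambda>p. mset_size (p o0))"
  have setsP: "sets P = sets (count_space S)" unfolding P_def by simp
  have meas[measurable]: "(\<lambda>p. mset_size (p o0)) \<in> measurable P (count_space UNIV)"
    unfolding measurable_cong_sets[OF setsP refl] by simp
  have DD: "D = density (count_space UNIV) (\<lambda>k. ennreal (pk k))"
  proof (rule measure_eqI_countable[where A=UNIV])
    fix k :: nat
    have pre: "(\<lambda>p. mset_size (p o0)) -` {k} \<inter> space P \<subseteq> S" unfolding P_def by auto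
    have "emeasure D {k} = emeasure P ((\<lambda>p. mset_size (p o0)) -` {k} \<inter> space P)"
      unfolding D_def by (rule emeasure_distr) auto
    also have "\<dots> = (\<integral>\<^sup>+p. ennreal (1 / (C * N)) * ennreal (family_weight \<theta> q p) * indicator ((\<lambda>p. mset_size (p o0)) -` {k} \<inter> space P) p \<partial>count_space S)"
      unfolding Pd by (rule emeasure_density) auto
    also have "\<dots> = (\<integral>\<^sup>+p. ennreal (1 / (C * N)) * (ennreal (family_weight \<theta> q p) * ind k p) \<partial>count_space S)"
      by (rule nn_integral_cong) (auto simp: ind_def indicator_def P_def mult.assoc)
    also have "\<dots> = ennreal (1 / (C * N)) * (if k \<le> n then ennreal (C * v k) else 0)"
      by (subst nn_integral_cmult) (simp_all add: part)
    also have "\<dots> = ennreal (pk k)"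
    proof (cases "k \<le> n")
      case True
      have "ennreal (1 / (C * N)) * ennreal (C * v k) = ennreal (1 / (C * N) * (C * v k))" using CN C v0 by (intro ennreal_mult[symmetric]) auto
      also have "1 / (C * N) * (C * v k) = v k / N" using C by simp
      finally show ?thesis using True by (simp add: pk_def)
    qed (simp add: pk_def)
    also have "\<dots> = emeasure (density (count_space UNIV) (\<lambda>k. ennreal (pk k))) {k}"
      by (subst emeasure_density) (simp_all add: nn_integral_indicator_singleton)
    finally show "emeasure D {k} = \<dots>" .
  qed (auto simp: D_def)
  fix f :: "nat \<Rightarrow> complex"
  have "(CLINT p|P. f (mset_size (p o0))) = (CLINT k|D. f k)"
    unfolding D_def by (rule integral_distr[symmetric]) auto
  also have "\<dots> = (LINT k|count_space UNIV. pk k *\<^sub>R f k)"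
    unfolding DD by (rule integral_density) (use pk0 in auto)
  also have "\<dots> = (\<Sum>k\<le>n. pk k *\<^sub>R f k)"
  proof (subst lebesgue_integral_count_space_finite_support)
    show fin: "finite {k \<in> UNIV. pk k *\<^sub>R f k \<noteq> 0}"
      by (rule finite_subset[of _ "{..n}"]) (auto simp: pk_def split: if_splits)
    show "(\<Sum>k | k \<in> UNIV \<and> pk k *\<^sub>R f k \<noteq> 0. pk k *\<^sub>R f k) = (\<Sum>k\<le>n. pk k *\<^sub>R f k)"
      by (rule sum.mono_neutral_left) (auto simp: pk_def split: if_splits)
  qed
  also have "\<dots> = (\<Sum>k\<le>n. of_real (v k) * f k / of_real N)"
    by (rule sum.cong) (simp_all add: pk_def scaleR_conv_of_real)
  also have "\<dots> = (\<Sum>k\<le>n. of_real (v k) * f k) / of_real N" by (rule sum_divide_distrib[symmetric])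
  also have "(\<Sum>k\<le>n. of_real (v k) * f k) = (\<Sum>s\<le>n. of_real (negbin \<theta> (n - s) * mixed_prob a s) * f (n - s))"
    unfolding v_def by (rule sum_convolution_reverse)
  finally show "(CLINT p|P. f (mset_size (p o0))) = (\<Sum>s\<le>n. of_real (negbin \<theta> (n - s) * mixed_prob a s) * f (n - s)) / of_real N" .
qed

end

definition inverse_power :: "real \<Rightarrow> int ^ 'd \<Rightarrow> real" where
  "inverse_power p x = (if x = 0 then 0 else norm (lattice_point x) powr (- p))"

lemma inverse_power_bounds:
  assumes "p > 0" shows "0 \<le> inverse_power p x" "inverse_power p x \<le> 1"
proof -
  show "0 \<le> inverse_power p x" by (simp add: inverse_power_def)
  show "inverse_power p x \<le> 1"
  proof (cases "x = 0")
    case False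
    have "norm (lattice_point x) powr (- p) \<le> norm (lattice_point x) powr 0"
      using norm_lattice_point_ge_1[OF False] assms by (intro powr_mono) auto
    thus ?thesis using False by (simp add: inverse_power_def lattice_point_0_iff)
  qed (simp add: inverse_power_def)
qed

lemma site_mean_le_inverse_power:
  assumes "c > 0" "L > 0"
  shows "site_mean c p L x \<le> L powr p / c * inverse_power p x"
proof (cases "x = 0")
  case False
  thus ?thesis using site_mean_le[OF assms False] by (simp add: inverse_power_def)
qed (simp add: site_mean_0 inverse_power_def)

lemma summable_inverse_power:
  assumes "real CARD('d) / 2 < \<delta>" "\<delta> < real CARD('d)"
  shows "(\<lambda>x::int^'d. (inverse_power \<delta> x)\<^sup>2) summable_on UNIV"
  unfolding inverse_power_def by (rule summable_inverse_square_weights[OF assms])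

lemma site_mean_square_summable:
  assumes d: "real CARD('d) / 2 < \<delta>" "\<delta> < real CARD('d)" and "c > 0" "L > 0"
  shows "(\<lambda>x::int^'d. (site_mean c \<delta> L x)\<^sup>2) summable_on UNIV"
    and "(\<Sum>\<^sub>\<infinity>x::int^'d. (site_mean c \<delta> L x)\<^sup>2) \<le> (L powr \<delta> / c)\<^sup>2 * (\<Sum>\<^sub>\<infinity>x::int^'d. (inverse_power \<delta> x)\<^sup>2)"
proof -
  have le: "(site_mean c \<delta> L x)\<^sup>2 \<le> (L powr \<delta> / c)\<^sup>2 * (inverse_power \<delta> x)\<^sup>2" for x :: "int^'d"
    unfolding power_mult_distrib[symmetric] by (intro power_mono site_mean_le_inverse_power site_mean_nonneg assms)
  have s: "(\<lambda>x::int^'d. (L powr \<delta> / c)\<^sup>2 * (inverse_power \<delta> x)\<^sup>2) summable_on UNIV"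
    by (intro summable_on_cmult_right summable_inverse_power d)
  show 1: "(\<lambda>x::int^'d. (site_mean c \<delta> L x)\<^sup>2) summable_on UNIV"
    by (rule summable_on_comparison_test[OF s]) (use le in auto)
  have "(\<Sum>\<^sub>\<infinity>x::int^'d. (site_mean c \<delta> L x)\<^sup>2) \<le> (\<Sum>\<^sub>\<infinity>x::int^'d. (L powr \<delta> / c)\<^sup>2 * (inverse_power \<delta> x)\<^sup>2)"
    by (rule infsum_mono[OF 1 s le])
  also have "\<dots> = (L powr \<delta> / c)\<^sup>2 * (\<Sum>\<^sub>\<infinity>x::int^'d. (inverse_power \<delta> x)\<^sup>2)" by (rule infsum_cmult_right')
  finally show "(\<Sum>\<^sub>\<infinity>x::int^'d. (site_mean c \<delta> L x)\<^sup>2) \<le> \<dots>" .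
qed

lemma scaled_bose_limit:
  assumes "c > 0" "y > (0::real)"
  shows "((\<lambda>t. c / t * (1 / (exp (c * (y / t)) - 1)) - 1 / y) \<longlongrightarrow> 0) at_top"
proof -
  have "((\<lambda>s::real. s / (exp s - 1)) \<longlongrightarrow> 1) (at_right 0)" by real_asymp
  moreover have "filterlim (\<lambda>t. c * y / t) (at_right 0) at_top" using assms by real_asymp
  ultimately have "((\<lambda>t. (c * y / t) / (exp (c * y / t) - 1)) \<longlongrightarrow> 1) at_top" by (rule filterlim_compose)
  hence lim: "((\<lambda>t. 1 / y * ((c * y / t) / (exp (c * y / t) - 1)) - 1 / y) \<longlongrightarrow> 1 / y * 1 - 1 / y) at_top"
    by (intro tendsto_intros)
  have e: "c / t * (1 / (exp (c * (y / t)) - 1)) = 1 / y * ((c * y / t) / (exp (c * y / t) - 1))" for t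
    using assms by simp
  have z: "1 / y * 1 - 1 / y = 0" by simp
  show ?thesis unfolding e using lim unfolding z .
qed

text \<open>The normalisation is such that the pointwise limit for \<open>L \<rightarrow> \<infinity>\<close> is \<open>inverse_power p\<close>.\<close>

definition scaled_mean :: "real \<Rightarrow> real \<Rightarrow> real \<Rightarrow> int ^ 'd \<Rightarrow> real" where
  "scaled_mean c p L x = c / L powr p * site_mean c p L x"

lemma scaled_mean_bounds:
  assumes "c > 0" "L > 0"
  shows "0 \<le> scaled_mean c p L x" "scaled_mean c p L x \<le> inverse_power p x"
proof -
  show "0 \<le> scaled_mean c p L x" unfolding scaled_mean_def using assms by (simp add: site_mean_nonneg)
  have "scaled_mean c p L x \<le> c / L powr p * (L powr p / c * inverse_power p x)"
    unfolding scaled_mean_def using assms by (intro mult_left_mono site_mean_le_inverse_power) auto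
  thus "scaled_mean c p L x \<le> inverse_power p x" using assms by simp
qed

text \<open>Dominated convergence with majorant \<open>inverse_power \<delta>\<close>, which is square summable for \<open>\<delta> > d / 2\<close>. The majorant comes from
  \<open>exp v - 1 \<ge> v\<close> and the limit from \<open>exp v - 1\<close> being asymptotic to \<open>v\<close>.\<close>

lemma scaled_mean_l2_convergence:
  assumes d: "real CARD('d) / 2 < \<delta>" "\<delta> < real CARD('d)" and c: "c > 0" and L: "\<And>k. L k > 0" "filterlim L at_top sequentially"
  shows "\<And>k. (\<lambda>x::int^'d. (scaled_mean c \<delta> (L k) x)\<^sup>2) summable_on UNIV"
    and "\<And>k. (\<lambda>x::int^'d. (scaled_mean c \<delta> (L k) x - inverse_power \<delta> x)\<^sup>2) summable_on UNIV"
    and "(\<lambda>k. \<Sum>\<^sub>\<infinity>x::int^'d. (scaled_mean c \<delta> (L k) x - inverse_power \<delta> x)\<^sup>2) \<longlonglongrightarrow> 0"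
proof -
  have "0 \<le> real CARD('d) / 2" by simp
  hence \<delta>0: "\<delta> > 0" using d(1) by linarith
  note sb = summable_inverse_power[OF d]
  have b: "0 \<le> scaled_mean c \<delta> (L k) x" "scaled_mean c \<delta> (L k) x \<le> inverse_power \<delta> x" for k and x :: "int^'d"
    by (rule scaled_mean_bounds[OF c L(1)])+
  have le: "(scaled_mean c \<delta> (L k) x - inverse_power \<delta> x)\<^sup>2 \<le> (inverse_power \<delta> x)\<^sup>2" for k and x :: "int^'d"
    unfolding abs_le_square_iff[symmetric] using b[of k x] by linarith
  show "(\<lambda>x::int^'d. (scaled_mean c \<delta> (L k) x)\<^sup>2) summable_on UNIV" for k
    by (rule summable_on_comparison_test[OF sb]) (auto intro!: power_mono b)
  show sd: "(\<lambda>x::int^'d. (scaled_mean c \<delta> (L k) x - inverse_power \<delta> x)\<^sup>2) summable_on UNIV" for k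
    by (rule summable_on_comparison_test[OF sb]) (auto intro!: le)
  have pt: "(\<lambda>k. scaled_mean c \<delta> (L k) x - inverse_power \<delta> x) \<longlonglongrightarrow> 0" for x :: "int^'d"
  proof (cases "x = 0")
    case True
    thus ?thesis by (simp add: scaled_mean_def site_mean_0 inverse_power_def)
  next
    case False
    define y where "y = norm (lattice_point x) powr \<delta>"
    have n: "norm (lattice_point x) > 0" using False by (simp add: lattice_point_0_iff)
    have y: "y > 0" using n by (simp add: y_def)
    have e: "scaled_mean c \<delta> (L k) x - inverse_power \<delta> x = c / L k powr \<delta> * (1 / (exp (c * (y / L k powr \<delta>)) - 1)) - 1 / y" for k
    proof -
      have "(norm (lattice_point x) / L k) powr \<delta> = y / L k powr \<delta>" unfolding y_def by (rule powr_divide)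
      hence 1: "site_mean c \<delta> (L k) x = 1 / (exp (c * (y / L k powr \<delta>)) - 1)"
        unfolding site_mean_def bose_def using n L(1)[of k] by simp
      have 2: "inverse_power \<delta> x = 1 / y" using False unfolding inverse_power_def y_def by (simp add: powr_minus_divide)
      show ?thesis unfolding scaled_mean_def 1 2 ..
    qed
    have "filterlim (\<lambda>k. L k powr \<delta>) at_top sequentially"
    proof -
      have "filterlim (\<lambda>t::real. t powr \<delta>) at_top at_top" using \<delta>0 by real_asymp
      thus ?thesis by (rule filterlim_compose[OF _ L(2)])
    qed
    from filterlim_compose[OF scaled_bose_limit[OF c y] this] show ?thesis unfolding e .
  qed
  have eq: "(\<integral>\<^sup>+x. ennreal ((scaled_mean c \<delta> (L k) x - inverse_power \<delta> x)\<^sup>2) \<partial>count_space (UNIV :: (int^'d) set)) = ennreal (\<Sum>\<^sub>\<infinity>x::int^'d. (scaled_mean c \<delta> (L k) x - inverse_power \<delta> x)\<^sup>2)" for k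
    by (rule nn_integral_of_has_sum[OF _ has_sum_infsum[OF sd]]) simp
  have "(\<lambda>k. \<integral>\<^sup>+x. ennreal ((scaled_mean c \<delta> (L k) x - inverse_power \<delta> x)\<^sup>2) \<partial>count_space (UNIV :: (int^'d) set)) \<longlonglongrightarrow> (\<integral>\<^sup>+x. 0 \<partial>count_space (UNIV :: (int^'d) set))"
  proof (rule nn_integral_dominated_convergence[where w="\<lambda>x. ennreal ((inverse_power \<delta> x)\<^sup>2)"])
    show "(\<integral>\<^sup>+x. ennreal ((inverse_power \<delta> x)\<^sup>2) \<partial>count_space (UNIV :: (int^'d) set)) < \<infinity>"
      using nn_integral_of_has_sum[OF _ has_sum_infsum[OF sb]] by simp
    show "AE x in count_space (UNIV :: (int^'d) set). (\<lambda>k. ennreal ((scaled_mean c \<delta> (L k) x - inverse_power \<delta> x)\<^sup>2)) \<longlonglongrightarrow> 0"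
    proof (rule AE_I2)
      fix x :: "int^'d"
      have "(\<lambda>k. ennreal ((scaled_mean c \<delta> (L k) x - inverse_power \<delta> x)\<^sup>2)) \<longlonglongrightarrow> ennreal (0\<^sup>2)"
        by (intro tendsto_ennrealI tendsto_power pt)
      thus "(\<lambda>k. ennreal ((scaled_mean c \<delta> (L k) x - inverse_power \<delta> x)\<^sup>2)) \<longlonglongrightarrow> 0" by simp
    qed
    show "AE x in count_space (UNIV :: (int^'d) set). ennreal ((scaled_mean c \<delta> (L k) x - inverse_power \<delta> x)\<^sup>2) \<le> ennreal ((inverse_power \<delta> x)\<^sup>2)" for k
      by (intro AE_I2 ennreal_leI le)
  qed auto
  hence lim: "(\<lambda>k. ennreal (\<Sum>\<^sub>\<infinity>x::int^'d. (scaled_mean c \<delta> (L k) x - inverse_power \<delta> x)\<^sup>2)) \<longlonglongrightarrow> ennreal 0" unfolding eq by simp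
  show "(\<lambda>k. \<Sum>\<^sub>\<infinity>x::int^'d. (scaled_mean c \<delta> (L k) x - inverse_power \<delta> x)\<^sup>2) \<longlonglongrightarrow> 0"
    by (rule tendsto_ennrealD[OF lim]) (auto intro!: always_eventually infsum_nonneg)
qed

section \<open>Removing the reweighting\<close>

lemma spatial_partitions_eq:
  "spatial_partitions n = {p. valid_family p \<and> mset_size (p 0) + rest_size 0 p = n}"
proof -
  have "(\<Sum>x | p x \<noteq> {#}. occupation x p) = mset_size (p 0) + rest_size 0 p" if "finite {x. p x \<noteq> {#}}" for p :: "int ^ 'd \<Rightarrow> nat multiset"
  proof -
    have o: "occupation x p = mset_size (p x)" for x by (simp add: occupation_def mset_size_def)
    show ?thesis
    proof (cases "p 0 = {#}")
      case True
      hence "{x. p x \<noteq> {#}} - {0} = {x. p x \<noteq> {#}}" by auto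
      thus ?thesis using True unfolding o rest_size_def by (simp add: mset_size_def)
    next
      case False
      thus ?thesis using sum.remove[OF that, of 0 "\<lambda>x. mset_size (p x)"] unfolding o rest_size_def by simp
    qed
  qed
  thus ?thesis unfolding spatial_partitions_def valid_family_def by auto
qed

lemma partition_weight_eq:
  "partition_weight (\<lambda>_. \<theta>) V L p = family_weight \<theta> (\<lambda>x. exp (- V (lattice_point x /\<^sub>R L))) p"
proof -
  have "exp (- real j * V y) = exp (- V y) ^ j" for j y unfolding exp_of_nat_mult[symmetric] by simp
  thus ?thesis unfolding partition_weight_def family_weight_def by simp
qed

lemma spatial_partition_measure_eq:
  "spatial_partition_measure (\<lambda>_. \<theta>) V L n =
    density (count_space {p. valid_family p \<and> mset_size (p 0) + rest_size 0 p = n})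
      (\<lambda>p. ennreal (family_weight \<theta> (\<lambda>x. exp (- V (lattice_point x /\<^sub>R L))) p /
        (\<Sum>\<^sub>\<infinity>p\<in>{p. valid_family p \<and> mset_size (p 0) + rest_size 0 p = n}. family_weight \<theta> (\<lambda>x. exp (- V (lattice_point x /\<^sub>R L))) p)))"
  unfolding spatial_partition_measure_def partition_function_def partition_weight_eq spatial_partitions_eq ..

context gamma_field
begin

text \<open>The weight of the origin does not influence the limit. The hypothesis on \<open>\<kappa>\<close> says that the origin typically holds a
  positive fraction of all particles, which is where the density exceeds the critical one.\<close>

lemma mixed_prob_sum_near_one:
  fixes L :: "nat \<Rightarrow> real" and n :: "nat \<Rightarrow> nat" and d :: nat and a :: "nat \<Rightarrow> 'i \<Rightarrow> real" and b :: "'i \<Rightarrow> real"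
  assumes L: "\<And>k. L k > 0" "filterlim L at_top sequentially" and d: "real d / 2 < \<delta>" "\<delta> < real d"
    and n: "\<And>k. real (n k) = \<rho> * L k ^ d" and \<rho>: "\<rho> > 0" and c: "c > 0"
    and a: "\<And>k x. 0 \<le> a k x" "\<And>k. a k summable_on UNIV" "\<And>k. (\<lambda>x. (a k x)\<^sup>2) summable_on UNIV"
    and ab: "\<And>k x. a k x \<le> L k powr \<delta> / c * b x" "\<And>x. 0 \<le> b x" "\<And>x. b x \<le> 1" "(\<lambda>x. (b x)\<^sup>2) summable_on UNIV"
    and \<mu>: "\<And>k. \<mu> k = \<theta> * (\<Sum>\<^sub>\<infinity>x. a k x)"
    and \<kappa>: "\<kappa> > 0" "\<forall>\<^sub>F k in sequentially. \<kappa> * L k ^ d \<le> real (n k) - \<mu> k"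
    and e: "e > 0"
  shows "\<forall>\<^sub>F k in sequentially. \<forall>g :: nat \<Rightarrow> complex. (\<forall>s. norm (g s) \<le> 1) \<longrightarrow>
    norm ((\<Sum>s\<le>n k. of_real (mixed_prob (a k) s * tilt \<theta> (n k) (real (n k) - \<mu> k) s) * g s) - (\<Sum>s. of_real (mixed_prob (a k) s) * g s)) \<le> e"
proof -
  have d0: "0 \<le> real d / 2" by simp
  hence \<delta>0: "\<delta> > 0" using d(1) by linarith
  \<comment> \<open>with this \<open>\<sigma>\<close>, \<open>\<bar>exp \<tau> - 1\<bar> * a k x \<le> 1/2\<close> at \<open>\<bar>\<tau>\<bar> = \<sigma> / L k powr \<delta>\<close>, as the bound on exponential moments requires\<close>
  define \<sigma> where "\<sigma> = c / 4"
  have \<sigma>: "\<sigma> > 0" using c by (simp add: \<sigma>_def)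
  have \<mu>0: "0 \<le> \<mu> k" for k unfolding \<mu> using \<theta> a by (intro mult_nonneg_nonneg infsum_nonneg) auto
  have Dle: "real (n k) - \<mu> k \<le> \<rho> * L k ^ d" for k using n[of k] \<mu>0[of k] by linarith
  define S2 where "S2 = (\<Sum>\<^sub>\<infinity>x. (b x)\<^sup>2)"
  define C where "C = exp (\<sigma>\<^sup>2 * \<rho> + 2 * \<theta> * (4 * \<sigma>\<^sup>2 / c\<^sup>2 * S2))"
  have C0: "C > 0" by (simp add: C_def)
  obtain B where B: "B \<longlonglongrightarrow> 0" "\<And>k. 0 \<le> B k" and tb: "\<forall>\<^sub>F k in sequentially. \<forall>s. \<bar>tilt \<theta> (n k) (real (n k) - \<mu> k) s - 1\<bar> \<le> e / 2 + B k * (exp (\<sigma> / L k powr \<delta> * (real s - (real (n k) - (real (n k) - \<mu> k)))) + exp (- (\<sigma> / L k powr \<delta>) * (real s - (real (n k) - (real (n k) - \<mu> k)))))"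
    using tilt_bound[OF \<theta> _ L \<delta>0 d(2) \<sigma> \<kappa>(1) \<rho> n \<kappa>(2) Dle, of "e / 2"] e by auto
  have B2: "(\<lambda>k. B k * (2 * C)) \<longlonglongrightarrow> 0 * (2 * C)" by (intro tendsto_intros B)
  have evB: "\<forall>\<^sub>F k in sequentially. B k * (2 * C) < e / 2"
    by (rule order_tendstoD(2)[OF B2]) (use e in simp)
  have "filterlim (\<lambda>t::real. t powr \<delta>) at_top at_top" using \<delta>0 by real_asymp
  hence Lp: "filterlim (\<lambda>k. L k powr \<delta>) at_top sequentially" by (rule filterlim_compose[OF _ L(2)])
  \<comment> \<open>beyond \<open>2 * \<sigma>\<close> the parameter \<open>\<sigma> / L k powr \<delta>\<close> is at most \<open>1/2\<close>, the range of the estimates for \<open>exp \<tau> - 1\<close>\<close>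
  have evL: "\<forall>\<^sub>F k in sequentially. max 1 (2 * \<sigma>) \<le> L k powr \<delta>" using Lp unfolding filterlim_at_top by blast
  have evL1: "\<forall>\<^sub>F k in sequentially. 1 \<le> L k" using L(2) unfolding filterlim_at_top by blast
  show ?thesis using tb evB evL evL1 \<kappa>(2)
  proof eventually_elim
    case (elim k)
    define X where "X = L k powr \<delta>"
    have X: "X > 0" "2 * \<sigma> \<le> X" "1 \<le> X" using elim(3) by (auto simp: X_def)
    define D where "D = real (n k) - \<mu> k"
    have D0: "0 \<le> D"
    proof -
      have "0 \<le> \<kappa> * L k ^ d" using \<kappa>(1) L(1)[of k] by simp
      thus ?thesis using elim(5) unfolding D_def by linarith
    qed
    define T where "T s = exp (\<sigma> / X * (real s - \<mu> k)) + exp (- (\<sigma> / X) * (real s - \<mu> k))" for s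
    have mgf: "summable (\<lambda>s. mixed_prob (a k) s * exp (\<tau> * (real s - \<mu> k))) \<and> (\<Sum>s. mixed_prob (a k) s * exp (\<tau> * (real s - \<mu> k))) \<le> C"
      if \<tau>: "\<bar>\<tau>\<bar> = \<sigma> / X" for \<tau>
    proof -
      have h: "\<bar>\<tau>\<bar> \<le> 1 / 2" unfolding \<tau> using X \<sigma> by (simp add: pos_divide_le_eq)
      note eb = exp_minus_1_bounds[OF h]
      have half: "\<bar>(exp \<tau> - 1) * a k x\<bar> \<le> 1 / 2" for x
      proof -
        have "\<bar>(exp \<tau> - 1) * a k x\<bar> = \<bar>exp \<tau> - 1\<bar> * a k x" using a(1)[of k x] by (simp add: abs_mult)
        also have "\<dots> \<le> (2 * (\<sigma> / X)) * (X / c * 1)"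
        proof (rule mult_mono)
          show "\<bar>exp \<tau> - 1\<bar> \<le> 2 * (\<sigma> / X)" using eb(1) unfolding \<tau> .
          have "X / c * b x \<le> X / c * 1" using ab(3)[of x] X c by (intro mult_left_mono) auto
          thus "a k x \<le> X / c * 1" using ab(1)[of k x] unfolding X_def by linarith
        qed (use a(1) X \<sigma> in auto)
        also have "\<dots> = 1 / 2" using X c by (simp add: \<sigma>_def)
        finally show ?thesis .
      qed
      have 1: "(exp \<tau> - 1 - \<tau>) * \<mu> k \<le> \<sigma>\<^sup>2 * \<rho>"
      proof -
        have "(exp \<tau> - 1 - \<tau>) * \<mu> k \<le> \<tau>\<^sup>2 * (\<rho> * L k ^ d)"
        proof (rule mult_mono)
          show "\<mu> k \<le> \<rho> * L k ^ d" using D0 n[of k] unfolding D_def by linarith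
        qed (use eb(2) \<mu>0 in auto)
        also have "\<tau>\<^sup>2 = \<sigma>\<^sup>2 / X\<^sup>2" using \<tau> by (metis power2_abs power_divide)
        also have "\<sigma>\<^sup>2 / X\<^sup>2 * (\<rho> * L k ^ d) = \<sigma>\<^sup>2 * \<rho> * (L k ^ d / X\<^sup>2)" by simp
        also have "\<dots> \<le> \<sigma>\<^sup>2 * \<rho> * 1"
        proof (rule mult_left_mono)
          have "L k ^ d = L k powr real d" using L(1)[of k] by (simp add: powr_realpow)
          also have "\<dots> \<le> L k powr (\<delta> + \<delta>)" using elim(4) d(1) by (intro powr_mono) auto
          also have "\<dots> = X\<^sup>2" unfolding X_def powr_add power2_eq_square ..
          finally show "L k ^ d / X\<^sup>2 \<le> 1" using X by (simp add: pos_divide_le_eq)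
        qed (use \<rho> in auto)
        finally show ?thesis by simp
      qed
      have 2: "(exp \<tau> - 1)\<^sup>2 * (\<Sum>\<^sub>\<infinity>x. (a k x)\<^sup>2) \<le> 4 * \<sigma>\<^sup>2 / c\<^sup>2 * S2"
      proof -
        have sb: "(\<lambda>x. (X / c)\<^sup>2 * (b x)\<^sup>2) summable_on UNIV" by (intro summable_on_cmult_right ab)
        have "(\<Sum>\<^sub>\<infinity>x. (a k x)\<^sup>2) \<le> (\<Sum>\<^sub>\<infinity>x. (X / c)\<^sup>2 * (b x)\<^sup>2)"
        proof (rule infsum_mono[OF a(3) sb])
          show "(a k x)\<^sup>2 \<le> (X / c)\<^sup>2 * (b x)\<^sup>2" for x
            unfolding power_mult_distrib[symmetric] X_def by (intro power_mono ab a)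
        qed
        also have "\<dots> = (X / c)\<^sup>2 * S2" unfolding S2_def by (rule infsum_cmult_right')
        finally have s: "(\<Sum>\<^sub>\<infinity>x. (a k x)\<^sup>2) \<le> (X / c)\<^sup>2 * S2" .
        have "(exp \<tau> - 1)\<^sup>2 = \<bar>exp \<tau> - 1\<bar>\<^sup>2" by simp
        also have "\<dots> \<le> (2 * (\<sigma> / X))\<^sup>2" using eb(1) unfolding \<tau> by (intro power_mono) auto
        finally have "(exp \<tau> - 1)\<^sup>2 * (\<Sum>\<^sub>\<infinity>x. (a k x)\<^sup>2) \<le> (2 * (\<sigma> / X))\<^sup>2 * ((X / c)\<^sup>2 * S2)"
          using s by (intro mult_mono) (auto intro!: infsum_nonneg)
        also have "\<dots> = 4 * \<sigma>\<^sup>2 / c\<^sup>2 * S2" using X by (simp add: power2_eq_square)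
        finally show ?thesis .
      qed
      have "2 * \<theta> * ((exp \<tau> - 1)\<^sup>2 * (\<Sum>\<^sub>\<infinity>x. (a k x)\<^sup>2)) \<le> 2 * \<theta> * (4 * \<sigma>\<^sup>2 / c\<^sup>2 * S2)"
        using 2 \<theta> by (intro mult_left_mono) auto
      hence "exp ((exp \<tau> - 1 - \<tau>) * \<mu> k + 2 * \<theta> * ((exp \<tau> - 1)\<^sup>2 * (\<Sum>\<^sub>\<infinity>x. (a k x)\<^sup>2))) \<le> C"
        unfolding C_def exp_le_cancel_iff using 1 by linarith
      with mixed_prob_mgf_le[OF a half \<mu>] show ?thesis by (meson order_trans)
    qed
    have m1: "summable (\<lambda>s. mixed_prob (a k) s * exp (\<sigma> / X * (real s - \<mu> k)))" "(\<Sum>s. mixed_prob (a k) s * exp (\<sigma> / X * (real s - \<mu> k))) \<le> C"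
      using mgf[of "\<sigma> / X"] \<sigma> X by simp_all
    have m2: "summable (\<lambda>s. mixed_prob (a k) s * exp (- (\<sigma> / X) * (real s - \<mu> k)))" "(\<Sum>s. mixed_prob (a k) s * exp (- (\<sigma> / X) * (real s - \<mu> k))) \<le> C"
      using mgf[of "- (\<sigma> / X)"] \<sigma> X by simp_all
    have Tp: "mixed_prob (a k) s * T s = mixed_prob (a k) s * exp (\<sigma> / X * (real s - \<mu> k)) + mixed_prob (a k) s * exp (- (\<sigma> / X) * (real s - \<mu> k))" for s
      unfolding T_def by (rule distrib_left)
    have T1: "summable (\<lambda>s. mixed_prob (a k) s * T s)" unfolding Tp by (rule summable_add[OF m1(1) m2(1)])
    have T2: "(\<Sum>s. mixed_prob (a k) s * T s) \<le> 2 * C"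
      unfolding Tp suminf_add[OF m1(1) m2(1), symmetric] using m1(2) m2(2) by linarith
    have \<omega>: "\<bar>tilt \<theta> (n k) D s - 1\<bar> \<le> e / 2 + B k * T s" for s
      using elim(1)[rule_format, of s] unfolding T_def X_def D_def by simp
    show ?case
    proof (intro allI impI)
      fix g :: "nat \<Rightarrow> complex" assume g: "\<forall>s. norm (g s) \<le> 1"
      have "norm ((\<Sum>s\<le>n k. of_real (mixed_prob (a k) s * tilt \<theta> (n k) D s) * g s) - (\<Sum>s. of_real (mixed_prob (a k) s) * g s)) \<le> e / 2 + B k * (2 * C)"
        by (rule tilted_sum_diff_le[OF mixed_prob_nonneg mixed_prob_sums T1 T2 B(2) \<omega>]) (use g in \<open>simp_all add: tilt_def\<close>)
      also have "\<dots> \<le> e" using elim(2) by linarith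
      finally show "norm ((\<Sum>s\<le>n k. of_real (mixed_prob (a k) s * tilt \<theta> (n k) (real (n k) - \<mu> k) s) * g s) - (\<Sum>s. of_real (mixed_prob (a k) s) * g s)) \<le> e"
        unfolding D_def .
    qed
  qed
qed

end

section \<open>Fluctuations of the condensate\<close>

theorem theorem6p4:
  fixes c \<delta> \<theta> \<rho> :: real
    and V :: "real ^ 'd \<Rightarrow> real"
    and n :: "nat \<Rightarrow> nat"
    and L :: "nat \<Rightarrow> real"
    and M :: "'a measure"
    and G :: "int ^ 'd \<Rightarrow> 'a \<Rightarrow> real"
    and A :: "nat \<Rightarrow> (int ^ 'd) set"
  assumes "c > 0"
    and "real CARD('d) / 2 < \<delta>" and "\<delta> < real CARD('d)"
    and "\<theta> > 0"
    and V: "\<And>x. V x = c * norm x powr \<delta>"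
    and "\<rho> > critical_density (\<lambda>_. \<theta>) V"
    and "\<And>k. L k > 0"
    and "filterlim L at_top sequentially"
    and "\<And>k. real (n k) = \<rho> * L k ^ CARD('d)"
    and "prob_space M"
    and "prob_space.indep_vars M (\<lambda>_. borel) G UNIV"
    and "\<And>x. distributed M lborel (G x) (\<lambda>t. ennreal (gamma_density \<theta> t))"
    and "\<And>m. finite (A m)" and "incseq A" and "(\<Union>m. A m) = UNIV"
  shows "(AE \<omega> in M. convergent
            (\<lambda>m. \<Sum>x\<in>A m - {0}. (\<theta> - G x \<omega>) / norm (lattice_point x) powr \<delta>)) \<and>
         weak_conv_m
           (\<lambda>k. distr (spatial_partition_measure (\<lambda>_. \<theta>) V (L k) (n k)) borel
              (\<lambda>p. (real (occupation 0 p)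
                     - (\<rho> - critical_density_scaled (\<lambda>_. \<theta>) V (L k)) * L k ^ CARD('d))
                   / L k powr \<delta>))
           (distr M borel
              (\<lambda>\<omega>. 1 / c *
                 lim (\<lambda>m. \<Sum>x\<in>A m - {0}. (\<theta> - G x \<omega>) / norm (lattice_point x) powr \<delta>)))"
proof -
  note c = assms(1) and d = assms(2,3) and \<theta> = assms(4) and \<rho>c = assms(6) and L = assms(7,8) and n = assms(9)
  interpret gamma_field M \<theta> G A
    by (intro gamma_field.intro gamma_field_axioms.intro assms)
  have "0 \<le> real CARD('d) / 2" by simp
  hence \<delta>0: "\<delta> > 0" using d(1) by linarith
  define b :: "int ^ 'd \<Rightarrow> real" where "b = inverse_power \<delta>"
  define a :: "nat \<Rightarrow> int ^ 'd \<Rightarrow> real" where "a k = site_mean c \<delta> (L k)" for k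
  define q :: "nat \<Rightarrow> int ^ 'd \<Rightarrow> real" where "q k x = exp (- V (lattice_point x /\<^sub>R L k))" for k x
  define \<beta> :: "nat \<Rightarrow> int ^ 'd \<Rightarrow> real" where "\<beta> k = scaled_mean c \<delta> (L k)" for k
  define P where "P k = spatial_partition_measure (\<lambda>_. \<theta>) V (L k) (n k)" for k
  define X :: "nat \<Rightarrow> (int ^ 'd \<Rightarrow> nat multiset) \<Rightarrow> real" where "X k p = (real (occupation 0 p) - (\<rho> - critical_density_scaled (\<lambda>_. \<theta>) V (L k)) * L k ^ CARD('d)) / L k powr \<delta>" for k p
  define I where "I = (LINT y|lborel. bose c \<delta> (norm (y::real^'d)))"
  define \<mu> where "\<mu> k = \<theta> * (\<Sum>\<^sub>\<infinity>x. a k x)" for k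
  have I0: "0 \<le> I" unfolding I_def by (intro integral_nonneg_AE AE_I2 bose_nonneg c)
  have crit: "critical_density (\<lambda>_. \<theta>) V = \<theta> * I"
    unfolding I_def by (rule critical_density_eq[OF d c \<theta> V])
  have \<rho>I: "\<theta> * I < \<rho>" using \<rho>c unfolding crit .
  have \<rho>: "\<rho> > 0" using \<rho>I mult_nonneg_nonneg[of \<theta> I] \<theta> I0 by linarith
  have a0: "0 \<le> a k x" for k x unfolding a_def by (rule site_mean_nonneg[OF c])
  have as: "a k summable_on UNIV" for k unfolding a_def by (rule summable_site_mean[OF d c L(1)])
  have a2: "(\<lambda>x. (a k x)\<^sup>2) summable_on UNIV" for k unfolding a_def by (rule site_mean_square_summable(1)[OF d c L(1)])
  have b2: "(\<lambda>x. (b x)\<^sup>2) summable_on UNIV" unfolding b_def by (rule summable_inverse_power[OF d])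
  have \<beta>2: "(\<lambda>x. (\<beta> k x)\<^sup>2) summable_on UNIV" "(\<lambda>x. (\<beta> k x - b x)\<^sup>2) summable_on UNIV" for k
    unfolding \<beta>_def b_def by (rule scaled_mean_l2_convergence[OF d c L])+
  have \<beta>lim: "(\<lambda>k. \<Sum>\<^sub>\<infinity>x. (\<beta> k x - b x)\<^sup>2) \<longlonglongrightarrow> 0"
    unfolding \<beta>_def b_def by (rule scaled_mean_l2_convergence[OF d c L])
  have Lp: "L k powr \<delta> > 0" for k using L(1)[of k] by simp
  have cd: "critical_density_scaled (\<lambda>_. \<theta>) V (L k) * L k ^ CARD('d) = \<mu> k" for k
    unfolding \<mu>_def a_def by (rule critical_density_scaled_eq[OF d c \<theta> L(1) V])
  have Xeq: "X k p = (real (occupation 0 p) - (real (n k) - \<mu> k)) / L k powr \<delta>" for k p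
    unfolding X_def left_diff_distrib cd n ..
  have \<mu>0: "0 \<le> \<mu> k" for k unfolding \<mu>_def using \<theta> a0 by (intro mult_nonneg_nonneg infsum_nonneg) auto

  have norm_pos: "0 < norm (lattice_point x)" if "x \<noteq> 0" for x :: "int ^ 'd" using that by (simp add: lattice_point_0_iff)
  have sums: "(\<Sum>x\<in>A m - {0}. (\<theta> - G x \<omega>) / norm (lattice_point x) powr \<delta>) = gamma_sum b m \<omega>" for m \<omega>
  proof -
    have "gamma_sum b m \<omega> = (\<Sum>x\<in>A m - {0}. (\<theta> - G x \<omega>) * b x)"
      unfolding gamma_sum_def by (rule sum.mono_neutral_right) (auto simp: A_finite b_def inverse_power_def)
    also have "\<dots> = (\<Sum>x\<in>A m - {0}. (\<theta> - G x \<omega>) / norm (lattice_point x) powr \<delta>)"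
      by (rule sum.cong) (auto simp: b_def inverse_power_def powr_minus_divide)
    finally show ?thesis by (rule sym)
  qed
  have conv: "AE \<omega> in M. convergent (\<lambda>m. \<Sum>x\<in>A m - {0}. (\<theta> - G x \<omega>) / norm (lattice_point x) powr \<delta>)"
    unfolding sums by (rule AE_gamma_sum_convergent[OF b2])
  have lim_eq: "lim (\<lambda>m. \<Sum>x\<in>A m - {0}. (\<theta> - G x \<omega>) / norm (lattice_point x) powr \<delta>) = gamma_series b \<omega>" for \<omega>
    unfolding sums gamma_series_def ..

  have q0: "q k 0 = 1" for k
  proof -
    have "lattice_point (0 :: int ^ 'd) = 0" by (simp add: lattice_point_0_iff)
    thus ?thesis by (simp add: q_def V)
  qed
  have q1: "0 < q k x \<and> q k x < 1" if "x \<noteq> 0" for k x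
    using that c L(1)[of k] by (simp add: q_def V lattice_point_0_iff)
  have aq: "a k x = (if x = 0 then 0 else q k x / (1 - q k x))" for k x
  proof (cases "x = 0")
    case False
    define v where "v = c * (norm (lattice_point x) / L k) powr \<delta>"
    have v: "v > 0" unfolding v_def using c L(1)[of k] norm_pos[OF False] by simp
    have 1: "a k x = 1 / (exp v - 1)" unfolding a_def site_mean_def bose_def v_def using norm_pos[OF False] L(1)[of k] by simp
    have nr: "norm (lattice_point x /\<^sub>R L k) = norm (lattice_point x) / L k" using L(1)[of k] by (simp add: inverse_eq_divide)
    have 2: "q k x = inverse (exp v)" unfolding q_def V nr v_def exp_minus ..
    have "inverse E / (1 - inverse E) = 1 / (E - 1)" if "E > 1" for E :: real using that by (simp add: field_simps)
    from this[of "exp v"] show ?thesis using False v unfolding 1 2 by simp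
  qed (simp add: a_def site_mean_0)

  define N where "N k = (\<Sum>s\<le>n k. negbin \<theta> (n k - s) * mixed_prob (a k) s)" for k
  have Pk: "P k = density (count_space {p. valid_family p \<and> mset_size (p 0) + rest_size 0 p = n k})
      (\<lambda>p. ennreal (family_weight \<theta> (q k) p / (\<Sum>\<^sub>\<infinity>p\<in>{p. valid_family p \<and> mset_size (p 0) + rest_size 0 p = n k}. family_weight \<theta> (q k) p)))" for k
    unfolding P_def spatial_partition_measure_eq q_def ..
  note law = family_law[OF q0 q1 aq as a2]
  have Pprob: "prob_space (P k)" for k unfolding Pk by (rule law(1))
  have Npos: "N k > 0" for k unfolding N_def by (rule law(2))
  have Plaw: "(CLINT p|P k. f (mset_size (p 0))) = (\<Sum>s\<le>n k. of_real (negbin \<theta> (n k - s) * mixed_prob (a k) s) * f (n k - s)) / of_real (N k)" for k and f :: "nat \<Rightarrow> complex"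
    unfolding Pk N_def by (rule law(3))
  have Xm: "X k \<in> borel_measurable (P k)" for k
  proof -
    have s: "sets (P k) = sets (count_space {p. valid_family p \<and> mset_size (p 0) + rest_size 0 p = n k})" unfolding Pk by simp
    show ?thesis unfolding measurable_cong_sets[OF s refl] by simp
  qed

  \<comment> \<open>the origin typically holds \<open>n - \<mu>\<close> particles; half of the excess density is a safe lower bound\<close>
  define \<kappa> where "\<kappa> = (\<rho> - \<theta> * I) / 2"
  have \<kappa>: "\<kappa> > 0" using \<rho>I by (simp add: \<kappa>_def)
  have ev\<kappa>: "\<forall>\<^sub>F k in sequentially. \<kappa> * L k ^ CARD('d) \<le> real (n k) - \<mu> k"
  proof -
    have "(\<lambda>k. (\<Sum>\<^sub>\<infinity>x. a k x) / L k ^ CARD('d)) \<longlonglongrightarrow> I"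
      unfolding a_def I_def by (rule site_mean_riemann_sum[OF d c L])
    hence "(\<lambda>k. \<theta> * ((\<Sum>\<^sub>\<infinity>x. a k x) / L k ^ CARD('d))) \<longlonglongrightarrow> \<theta> * I" by (intro tendsto_intros)
    hence "\<forall>\<^sub>F k in sequentially. \<theta> * ((\<Sum>\<^sub>\<infinity>x. a k x) / L k ^ CARD('d)) < \<rho> - \<kappa>"
      by (rule order_tendstoD(2)) (use \<rho>I in \<open>simp add: \<kappa>_def field_simps\<close>)
    thus ?thesis
    proof eventually_elim
      case (elim k)
      have p: "0 < L k ^ CARD('d)" using L(1)[of k] by simp
      have "\<mu> k / L k ^ CARD('d) < \<rho> - \<kappa>" using elim by (simp add: \<mu>_def)
      hence "\<mu> k < (\<rho> - \<kappa>) * L k ^ CARD('d)" using p by (simp add: pos_divide_less_eq)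
      thus ?case using n[of k] by (simp add: left_diff_distrib)
    qed
  qed
  have ab: "a k x \<le> L k powr \<delta> / c * b x" for k x unfolding a_def b_def by (rule site_mean_le_inverse_power[OF c L(1)])
  have b01: "0 \<le> b x" "b x \<le> 1" for x unfolding b_def by (rule inverse_power_bounds[OF \<delta>0])+

  have char_lim: "(\<lambda>k. CLINT p|P k. iexp (t * X k p)) \<longlonglongrightarrow> (CLINT \<omega>|M. iexp (t * (1 / c * gamma_series b \<omega>)))" for t
  proof -
    define \<tau> where "\<tau> k = t / L k powr \<delta>" for k
    define g where "g k s = iexp (\<tau> k * (\<mu> k - real s))" for k and s :: nat
    have g1: "norm (g k s) \<le> 1" for k s unfolding g_def by simp
    define \<phi> where "\<phi> k = (\<Sum>s. of_real (mixed_prob (a k) s) * g k s)" for k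
    define num where "num k h = (\<Sum>s\<le>n k. of_real (mixed_prob (a k) s * tilt \<theta> (n k) (real (n k) - \<mu> k) s) * h s)" for k and h :: "nat \<Rightarrow> complex"
    have near: "\<forall>\<^sub>F k in sequentially. \<forall>g :: nat \<Rightarrow> complex. (\<forall>s. norm (g s) \<le> 1) \<longrightarrow> norm (num k g - (\<Sum>s. of_real (mixed_prob (a k) s) * g s)) \<le> e" if "e > 0" for e
      unfolding num_def
      by (rule mixed_prob_sum_near_one[OF L d n \<rho> c a0 as a2 ab b01 b2 \<mu>_def \<kappa> ev\<kappa> that])
    have num\<phi>: "(\<lambda>k. num k (g k) - \<phi> k) \<longlonglongrightarrow> 0"
    proof (rule tendstoI)
      fix e :: real assume "e > 0"
      hence "e / 2 > 0" by simp
      from near[OF this] show "\<forall>\<^sub>F k in sequentially. dist (num k (g k) - \<phi> k) 0 < e"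
      proof eventually_elim
        case (elim k)
        have "norm (num k (g k) - \<phi> k) \<le> e / 2" unfolding \<phi>_def using elim g1 by blast
        thus ?case using \<open>e > 0\<close> by simp
      qed
    qed
    have s1: "(\<Sum>s. of_real (mixed_prob (a k) s) * (1 :: complex)) = 1" for k
    proof -
      have "(\<lambda>s. of_real (mixed_prob (a k) s) :: complex) sums of_real 1" by (rule sums_of_real[OF mixed_prob_sums])
      from sums_unique[OF this] show ?thesis by simp
    qed
    have num1: "(\<lambda>k. num k (\<lambda>_. 1)) \<longlonglongrightarrow> 1"
    proof (rule LIM_zero_cancel, rule tendstoI)
      fix e :: real assume "e > 0"
      hence "e / 2 > 0" by simp
      from near[OF this] show "\<forall>\<^sub>F k in sequentially. dist (num k (\<lambda>_. 1) - 1) 0 < e"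
      proof eventually_elim
        case (elim k)
        have "norm (num k (\<lambda>_. 1) - (\<Sum>s. of_real (mixed_prob (a k) s) * (1 :: complex))) \<le> e / 2"
          by (rule elim[rule_format]) simp
        thus ?case unfolding s1 using \<open>e > 0\<close> by simp
      qed
    qed
    \<comment> \<open>once \<open>n - \<mu>\<close> is positive, weights may be divided by their value there, which turns them into tilts\<close>
    have ratio: "\<forall>\<^sub>F k in sequentially. (CLINT p|P k. iexp (t * X k p)) = num k (g k) / num k (\<lambda>_. 1)"
      using ev\<kappa>
    proof eventually_elim
      case (elim k)
      define D where "D = real (n k) - \<mu> k"
      have "0 < \<kappa> * L k ^ CARD('d)" using \<kappa> L(1)[of k] by simp
      hence D: "D > 0" using elim unfolding D_def by linarith
      define B where "B = D powr (\<theta> - 1) / Gamma \<theta>"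
      have B: "B > 0" unfolding B_def using D Gamma_\<theta>_pos by simp
      have nm: "num k h = (\<Sum>s\<le>n k. of_real (negbin \<theta> (n k - s) * mixed_prob (a k) s) * h s) / of_real B" for h
        unfolding num_def sum_divide_distrib
        by (rule sum.cong) (simp_all add: tilt_def B_def D_def)
      have one: "(\<Sum>s\<le>n k. of_real (negbin \<theta> (n k - s) * mixed_prob (a k) s) * (1 :: complex)) = of_real (N k)"
        unfolding N_def by simp
      define f where "f j = iexp (t * ((real j - D) / L k powr \<delta>))" for j
      have "(CLINT p|P k. iexp (t * X k p)) = (CLINT p|P k. f (mset_size (p 0)))"
        unfolding f_def Xeq D_def occupation_def mset_size_def ..
      also have "\<dots> = (\<Sum>s\<le>n k. of_real (negbin \<theta> (n k - s) * mixed_prob (a k) s) * f (n k - s)) / of_real (N k)"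
        by (rule Plaw)
      also have "(\<Sum>s\<le>n k. of_real (negbin \<theta> (n k - s) * mixed_prob (a k) s) * f (n k - s)) = (\<Sum>s\<le>n k. of_real (negbin \<theta> (n k - s) * mixed_prob (a k) s) * g k s)"
      proof (rule sum.cong[OF refl])
        fix s assume "s \<in> {..n k}"
        hence "real (n k - s) - D = \<mu> k - real s" by (simp add: D_def of_nat_diff)
        hence "f (n k - s) = g k s" unfolding f_def g_def \<tau>_def by (simp only: times_divide_eq_left times_divide_eq_right)
        thus "of_real (negbin \<theta> (n k - s) * mixed_prob (a k) s) * f (n k - s) = of_real (negbin \<theta> (n k - s) * mixed_prob (a k) s) * g k s" by simp
      qed
      finally have "(CLINT p|P k. iexp (t * X k p)) = (\<Sum>s\<le>n k. of_real (negbin \<theta> (n k - s) * mixed_prob (a k) s) * g k s) / of_real (N k)" .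
      thus ?case unfolding nm one using B by simp
    qed
    \<comment> \<open>from here on only the random Poisson mean is kept; this costs the Poisson variance over \<open>L powr (2 * \<delta>)\<close>\<close>
    define \<psi> where "\<psi> k = (CLINT \<omega>|M. iexp (\<tau> k * (\<mu> k - gamma_total (a k) \<omega>)))" for k
    have "(\<lambda>k. \<phi> k - \<psi> k) \<longlonglongrightarrow> 0"
    proof (rule Lim_null_comparison)
      show "\<forall>\<^sub>F k in sequentially. norm (\<phi> k - \<psi> k) \<le> t\<^sup>2 / 2 * \<rho> * L k powr (real CARD('d) - 2 * \<delta>)"
        using ev\<kappa>
      proof eventually_elim
        case (elim k)
        have "0 \<le> \<kappa> * L k ^ CARD('d)" using \<kappa> L(1)[of k] by simp
        hence m: "\<mu> k \<le> \<rho> * L k ^ CARD('d)" using elim n[of k] by linarith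
        have "norm (\<phi> k - \<psi> k) \<le> (\<tau> k)\<^sup>2 / 2 * (\<theta> * (\<Sum>\<^sub>\<infinity>x. a k x))"
          unfolding \<phi>_def \<psi>_def g_def by (rule mixed_prob_char_diff_le[OF a0 as a2])
        also have "\<dots> \<le> (\<tau> k)\<^sup>2 / 2 * (\<rho> * L k ^ CARD('d))" using m unfolding \<mu>_def by (intro mult_left_mono) auto
        also have "(\<tau> k)\<^sup>2 / 2 * (\<rho> * L k ^ CARD('d)) = t\<^sup>2 / 2 * \<rho> * (L k ^ CARD('d) / (L k powr \<delta>)\<^sup>2)"
          unfolding \<tau>_def power_divide by simp
        also have "L k ^ CARD('d) / (L k powr \<delta>)\<^sup>2 = L k powr (real CARD('d) - 2 * \<delta>)"
        proof -
          have "(L k powr \<delta>)\<^sup>2 = L k powr (2 * \<delta>)" unfolding power2_eq_square powr_add[symmetric] by (simp only: mult_2)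
          moreover have "L k ^ CARD('d) = L k powr real CARD('d)" using L(1)[of k] by (simp add: powr_realpow)
          ultimately show ?thesis by (simp only: powr_diff)
        qed
        finally show "norm (\<phi> k - \<psi> k) \<le> t\<^sup>2 / 2 * \<rho> * L k powr (real CARD('d) - 2 * \<delta>)" .
      qed
      have "real CARD('d) - 2 * \<delta> < 0" using d(1) by simp
      hence "(\<lambda>k. L k powr (real CARD('d) - 2 * \<delta>)) \<longlonglongrightarrow> 0" by (rule tendsto_neg_powr[OF _ L(2)])
      hence "(\<lambda>k. t\<^sup>2 / 2 * \<rho> * L k powr (real CARD('d) - 2 * \<delta>)) \<longlonglongrightarrow> t\<^sup>2 / 2 * \<rho> * 0" by (intro tendsto_intros)
      thus "(\<lambda>k. t\<^sup>2 / 2 * \<rho> * L k powr (real CARD('d) - 2 * \<delta>)) \<longlonglongrightarrow> 0" by simp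
    qed
    \<comment> \<open>the scaled mean is \<open>1 / c\<close> times a gamma series whose coefficients converge in mean square\<close>
    moreover have \<psi>eq: "\<psi> k = (CLINT \<omega>|M. iexp (t / c * gamma_series (\<beta> k) \<omega>))" for k
      unfolding \<psi>_def
    proof (rule integral_cong_AE)
      show "AE \<omega> in M. iexp (\<tau> k * (\<mu> k - gamma_total (a k) \<omega>)) = iexp (t / c * gamma_series (\<beta> k) \<omega>)"
        using AE_gamma_total[OF a0 as a2, of k] AE_gamma_series_cmult[OF a2, of "c / L k powr \<delta>" k]
      proof eventually_elim
        case (elim \<omega>)
        have 1: "gamma_series (\<beta> k) \<omega> = c / L k powr \<delta> * gamma_series (a k) \<omega>"
          using elim(2) unfolding \<beta>_def a_def scaled_mean_def[abs_def] .
        have 2: "\<mu> k - gamma_total (a k) \<omega> = gamma_series (a k) \<omega>"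
          using elim(1) unfolding \<mu>_def by linarith
        show ?case unfolding 1 2 \<tau>_def using c by simp
      qed
    qed auto
    moreover have "(\<lambda>k. \<psi> k - (CLINT \<omega>|M. iexp (t / c * gamma_series b \<omega>))) \<longlonglongrightarrow> 0"
    proof (rule Lim_null_comparison[OF always_eventually], rule allI)
      show "norm (\<psi> k - (CLINT \<omega>|M. iexp (t / c * gamma_series b \<omega>))) \<le> \<bar>t / c\<bar> * sqrt (\<theta> * (\<Sum>\<^sub>\<infinity>x. (\<beta> k x - b x)\<^sup>2))" for k
        unfolding \<psi>eq by (rule char_gamma_series_diff_le[OF \<beta>2(1) b2 \<beta>2(2)])
      have "(\<lambda>k. \<bar>t / c\<bar> * sqrt (\<theta> * (\<Sum>\<^sub>\<infinity>x. (\<beta> k x - b x)\<^sup>2))) \<longlonglongrightarrow> \<bar>t / c\<bar> * sqrt (\<theta> * 0)"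
        by (intro tendsto_mult tendsto_const tendsto_real_sqrt \<beta>lim)
      thus "(\<lambda>k. \<bar>t / c\<bar> * sqrt (\<theta> * (\<Sum>\<^sub>\<infinity>x. (\<beta> k x - b x)\<^sup>2))) \<longlonglongrightarrow> 0" by simp
    qed
    ultimately have "(\<lambda>k. (num k (g k) - \<phi> k) + ((\<phi> k - \<psi> k) + (\<psi> k - (CLINT \<omega>|M. iexp (t / c * gamma_series b \<omega>))))) \<longlonglongrightarrow> 0 + (0 + 0)"
      by (intro tendsto_add num\<phi>)
    hence "(\<lambda>k. num k (g k) - (CLINT \<omega>|M. iexp (t / c * gamma_series b \<omega>))) \<longlonglongrightarrow> 0" by simp
    hence "(\<lambda>k. num k (g k)) \<longlonglongrightarrow> (CLINT \<omega>|M. iexp (t / c * gamma_series b \<omega>))" by (rule LIM_zero_cancel)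
    from tendsto_divide[OF this num1] have "(\<lambda>k. num k (g k) / num k (\<lambda>_. 1)) \<longlonglongrightarrow> (CLINT \<omega>|M. iexp (t / c * gamma_series b \<omega>))" by simp
    hence "(\<lambda>k. CLINT p|P k. iexp (t * X k p)) \<longlonglongrightarrow> (CLINT \<omega>|M. iexp (t / c * gamma_series b \<omega>))"
      unfolding tendsto_cong[OF ratio] .
    thus ?thesis by simp
  qed

  have "weak_conv_m (\<lambda>k. distr (P k) borel (X k)) (distr M borel (\<lambda>\<omega>. 1 / c * gamma_series b \<omega>))"
  proof (rule levy_continuity)
    show "real_distribution (distr (P k) borel (X k))" for k
    proof -
      interpret P: prob_space "P k" by (rule Pprob)
      show ?thesis using Xm by (rule P.real_distribution_distr)
    qed
    have Tm: "(\<lambda>\<omega>. 1 / c * gamma_series b \<omega>) \<in> borel_measurable M" by measurable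
    show "real_distribution (distr M borel (\<lambda>\<omega>. 1 / c * gamma_series b \<omega>))"
      using Tm by (rule real_distribution_distr)
    fix t
    have 1: "char (distr (P k) borel (X k)) t = (CLINT p|P k. iexp (t * X k p))" for k
      unfolding char_def by (subst integral_distr[OF Xm]) auto
    have 2: "char (distr M borel (\<lambda>\<omega>. 1 / c * gamma_series b \<omega>)) t = (CLINT \<omega>|M. iexp (t * (1 / c * gamma_series b \<omega>)))"
      unfolding char_def by (subst integral_distr[OF Tm]) auto
    show "(\<lambda>k. char (distr (P k) borel (X k)) t) \<longlonglongrightarrow> char (distr M borel (\<lambda>\<omega>. 1 / c * gamma_series b \<omega>)) t"
      unfolding 1 2 by (rule char_lim)
  qed
  hence "weak_conv_m
      (\<lambda>k. distr (spatial_partition_measure (\<lambda>_. \<theta>) V (L k) (n k)) borel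
        (\<lambda>p. (real (occupation 0 p) - (\<rho> - critical_density_scaled (\<lambda>_. \<theta>) V (L k)) * L k ^ CARD('d)) / L k powr \<delta>))
      (distr M borel (\<lambda>\<omega>. 1 / c * lim (\<lambda>m. \<Sum>x\<in>A m - {0}. (\<theta> - G x \<omega>) / norm (lattice_point x) powr \<delta>)))"
    unfolding lim_eq P_def X_def .
  with conv show ?thesis by blast
qed

end
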